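(* Let $k\ge2$. Then the model checking problem of $\mathrm{LTL}_k(\sim,\mathsf F,\mathsf X)$ is logspace-reducible to the satisfiability problem of $\mathrm{LTL}_k(\sim,\mathsf F,\mathsf X)$.
   Context: Let $\mathrm{AP}$ be a countably infinite set of atomic propositions. A trace is an infinite sequence $t=t(0)t(1)\cdots\in(\wp\mathrm{AP})^\omega$, and $t^i=t(i)t(i+1)\cdots$. A team is a (possibly empty) set $T$ of traces, and $T^i=\{t^i: t\in T\}$. Formulas of $\mathrm{LTL}(\sim)$ are given by $\varphi::=p\mid\neg\varphi\mid\varphi\wedge\varphi\mid\varphi\vee\varphi\mid\mathsf X\varphi\mid\mathsf F\varphi\mid\mathsf G\varphi\mid\varphi\,\mathsf U\,\varphi\mid\varphi\,\mathsf R\,\varphi\mid{\sim}\varphi$ with $p\in\mathrm{AP}$. Synchronous team semantics: $T\models p$ iff $p\in t(0)$ for all $t\in T$; $T\models\neg\varphi$ iff $\{t\}\not\models\varphi$ for all $t\in T$; $T\models\varphi\wedge\psi$ iff $T\models\varphi$ and $T\models\psi$; $T\models\varphi\vee\psi$ iff $T=S\cup U$ for some $S,U$ with $S\models\varphi$ and $U\models\psi$; $T\models\mathsf X\varphi$ iff $T^1\models\varphi$; $T\models\mathsf F\varphi$ iff $T^k\models\varphi$ for some $k\ge0$; $T\models\mathsf G\varphi$ iff $T^k\models\varphi$ for all $k\ge0$; $T\models\varphi\,\mathsf U\,\psi$ iff there is $k\ge0$ with $T^k\models\psi$ and $T^j\models\varphi$ for all $j<k$; $T\models\varphi\,\mathsf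 R\,\psi$ iff for all $k\ge0$, $T^k\models\psi$ or $T^j\models\varphi$ for some $j<k$; $T\models{\sim}\varphi$ iff $T\not\models\varphi$. The temporal depth of a formula is the maximal nesting depth of the temporal operators $\mathsf X,\mathsf F,\mathsf G,\mathsf U,\mathsf R$; $\mathrm{LTL}_k(\sim,O_1,\dots,O_n)$ is the set of $\mathrm{LTL}(\sim)$-formulas of temporal depth at most $k$ whose only temporal operators are among $O_1,\dots,O_n$ (the connectives $\neg,\wedge,\vee,\sim$ are unrestricted). A finite Kripke structure is $K=(W,R,\eta,r)$ with $W$ finite nonempty, $R\subseteq W\times W$ serial, $\eta:W\to\wp\mathrm{AP}$ with finite labels, and root $r\in W$; a path is $\pi\in W^\omega$ with $\pi(0)=r$ and $(\pi(i),\pi(i+1))\in R$; it induces the trace $(\eta(\pi(i)))_{i\ge0}$; $T(K)$ is the team of all induced traces. Model checking of a fragment $L$: the set of pairs $(K,\varphi)$ with $\varphi\in L$, $K$ a finite Kripke structure and $T(K)\models\varphi$. Satisfiability of $L$: the set of $\varphi\in L$ satisfied by some team. *)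

theory Defs
  imports Complex_Main
begin

datatype fml =
    Prop nat
  | Neg fml
  | Conj fml fml
  | Disj fml fml
  | Nxt fml
  | Fut fml
  | Glob fml
  | Until fml fml
  | Rel fml fml
  | Sim fml

type_synonym trace = "nat \<Rightarrow> nat set"
type_synonym team = "trace set"

definition suffix_team :: "nat \<Rightarrow> team \<Rightarrow> team" where
  "suffix_team i T = (\<lambda>t n. t (n + i)) ` T"

primrec tsat :: "team \<Rightarrow> fml \<Rightarrow> bool" where
  "tsat T (Prop p) = (\<forall>t\<in>T. p \<in> t 0)"
| "tsat T (Neg \<phi>) = (\<forall>t\<in>T. \<not> tsat {t} \<phi>)"
| "tsat T (Conj \<phi> \<psi>) = (tsat T \<phi> \<and> tsat T \<psi>)"
| "tsat T (Disj \<phi> \<psi>) = (\<exists>S U. T = S \<union> U \<and> tsat S \<phi> \<and> tsat U \<psi>)"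
| "tsat T (Nxt \<phi>) = tsat (suffix_team 1 T) \<phi>"
| "tsat T (Fut \<phi>) = (\<exists>k. tsat (suffix_team k T) \<phi>)"
| "tsat T (Glob \<phi>) = (\<forall>k. tsat (suffix_team k T) \<phi>)"
| "tsat T (Until \<phi> \<psi>) = (\<exists>k. tsat (suffix_team k T) \<psi> \<and> (\<forall>j<k. tsat (suffix_team j T) \<phi>))"
| "tsat T (Rel \<phi> \<psi>) = (\<forall>k. tsat (suffix_team k T) \<psi> \<or> (\<exists>j<k. tsat (suffix_team j T) \<phi>))"
| "tsat T (Sim \<phi>) = (\<not> tsat T \<phi>)"

primrec tdepth :: "fml \<Rightarrow> nat" where
  "tdepth (Prop p) = 0"
| "tdepth (Neg \<phi>) = tdepth \<phi>"
| "tdepth (Conj \<phi> \<psi>) = max (tdepth \<phi>) (tdepth \<psi>)"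
| "tdepth (Disj \<phi> \<psi>) = max (tdepth \<phi>) (tdepth \<psi>)"
| "tdepth (Nxt \<phi>) = Suc (tdepth \<phi>)"
| "tdepth (Fut \<phi>) = Suc (tdepth \<phi>)"
| "tdepth (Glob \<phi>) = Suc (tdepth \<phi>)"
| "tdepth (Until \<phi> \<psi>) = Suc (max (tdepth \<phi>) (tdepth \<psi>))"
| "tdepth (Rel \<phi> \<psi>) = Suc (max (tdepth \<phi>) (tdepth \<psi>))"
| "tdepth (Sim \<phi>) = tdepth \<phi>"

primrec only_FX :: "fml \<Rightarrow> bool" where
  "only_FX (Prop p) = True"
| "only_FX (Neg \<phi>) = only_FX \<phi>"
| "only_FX (Conj \<phi> \<psi>) = (only_FX \<phi> \<and> only_FX \<psi>)"
| "only_FX (Disj \<phi> \<psi>) = (only_FX \<phi> \<and> only_FX \<psi>)"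
| "only_FX (Nxt \<phi>) = only_FX \<phi>"
| "only_FX (Fut \<phi>) = only_FX \<phi>"
| "only_FX (Glob \<phi>) = False"
| "only_FX (Until \<phi> \<psi>) = False"
| "only_FX (Rel \<phi> \<psi>) = False"
| "only_FX (Sim \<phi>) = only_FX \<phi>"

definition LTL_FX :: "nat \<Rightarrow> fml set" where
  "LTL_FX k = {\<phi>. only_FX \<phi> \<and> tdepth \<phi> \<le> k}"

text \<open>A finite Kripke structure with state set {0..<kn}, edge list kE, labels kL (state i is
  labelled by set (kL ! i)), root kr. Every finite Kripke structure is isomorphic to one of this
  form, and the team of induced traces is invariant under isomorphism.\<close>

record kripke =
  kn :: nat
  kE :: "(nat \<times> nat) list"
  kL :: "nat list list"
  kr :: nat

definition wf_kripke :: "kripke \<Rightarrow> bool" where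
  "wf_kripke K \<longleftrightarrow> 0 < kn K \<and> kr K < kn K \<and> length (kL K) = kn K
     \<and> (\<forall>(a,b)\<in>set (kE K). a < kn K \<and> b < kn K)
     \<and> (\<forall>a<kn K. \<exists>b. (a,b) \<in> set (kE K))"

definition is_path :: "kripke \<Rightarrow> (nat \<Rightarrow> nat) \<Rightarrow> bool" where
  "is_path K \<pi> \<longleftrightarrow> \<pi> 0 = kr K \<and> (\<forall>i. (\<pi> i, \<pi> (Suc i)) \<in> set (kE K))"

definition team_of :: "kripke \<Rightarrow> team" where
  "team_of K = {(\<lambda>i. set (kL K ! \<pi> i)) | \<pi>. is_path K \<pi>}"

datatype sym = B0 | B1 | Sep | TP | TNeg | TConj | TDisj | TNxt | TFut | TGlob | TUntil | TRel
  | TSim | TState | TEdge | TLab | TRoot | THash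

fun bin :: "nat \<Rightarrow> sym list" where
  "bin n = (if n < 2 then [if n = 0 then B0 else B1]
            else bin (n div 2) @ [if even n then B0 else B1])"

definition enc_nat :: "nat \<Rightarrow> sym list" where
  "enc_nat n = bin n @ [Sep]"

primrec enc_fml :: "fml \<Rightarrow> sym list" where
  "enc_fml (Prop p) = TP # enc_nat p"
| "enc_fml (Neg \<phi>) = TNeg # enc_fml \<phi>"
| "enc_fml (Conj \<phi> \<psi>) = TConj # enc_fml \<phi> @ enc_fml \<psi>"
| "enc_fml (Disj \<phi> \<psi>) = TDisj # enc_fml \<phi> @ enc_fml \<psi>"
| "enc_fml (Nxt \<phi>) = TNxt # enc_fml \<phi>"
| "enc_fml (Fut \<phi>) = TFut # enc_fml \<phi>"
| "enc_fml (Glob \<phi>) = TGlob # enc_fml \<phi>"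
| "enc_fml (Until \<phi> \<psi>) = TUntil # enc_fml \<phi> @ enc_fml \<psi>"
| "enc_fml (Rel \<phi> \<psi>) = TRel # enc_fml \<phi> @ enc_fml \<psi>"
| "enc_fml (Sim \<phi>) = TSim # enc_fml \<phi>"

definition enc_kripke :: "kripke \<Rightarrow> sym list" where
  "enc_kripke K = TState # enc_nat (kn K)
     @ concat (map (\<lambda>(a,b). TEdge # enc_nat a @ enc_nat b) (kE K))
     @ concat (map (\<lambda>ps. TLab # concat (map enc_nat ps)) (kL K))
     @ TRoot # enc_nat (kr K)"

definition MC_lang :: "nat \<Rightarrow> sym list set" where
  "MC_lang k = {enc_kripke K @ THash # enc_fml \<phi> | K \<phi>.
                  wf_kripke K \<and> \<phi> \<in> LTL_FX k \<and> tsat (team_of K) \<phi>}"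

definition SAT_lang :: "nat \<Rightarrow> sym list set" where
  "SAT_lang k = {enc_fml \<phi> | \<phi>. \<phi> \<in> LTL_FX k \<and> (\<exists>T. tsat T \<phi>)}"

text \<open>Deterministic Turing transducer: read-only two-way input tape (positions 1..n hold the
  input, positions 0 and n+1 are end markers read as None), one work tape over the alphabet
  {0..<ng} (0 = blank) with a one-way-infinite tape, and a write-only output stream.\<close>

datatype dir = Lft | Stay | Rgt

record tm =
  nq :: nat
  ng :: nat
  delta :: "nat \<Rightarrow> sym option \<Rightarrow> nat \<Rightarrow> nat \<times> dir \<times> nat \<times> dir \<times> sym option"
  q0 :: nat
  halting :: "nat set"

definition valid_tm :: "tm \<Rightarrow> bool" where
  "valid_tm M \<longleftrightarrow> q0 M < nq M \<and> 0 < ng M \<and> halting M \<subseteq> {0..<nq M}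
     \<and> (\<forall>q<nq M. \<forall>a g. g < ng M \<longrightarrow>
           (case delta M q a g of (q', _, g', _, _) \<Rightarrow> q' < nq M \<and> g' < ng M))"

record config =
  cq :: nat
  ipos :: nat
  wtape :: "nat \<Rightarrow> nat"
  wpos :: nat
  outp :: "sym list"

definition read_in :: "sym list \<Rightarrow> nat \<Rightarrow> sym option" where
  "read_in w i = (if 0 < i \<and> i \<le> length w then Some (w ! (i - 1)) else None)"

definition move :: "dir \<Rightarrow> nat \<Rightarrow> nat" where
  "move d i = (case d of Lft \<Rightarrow> i - 1 | Stay \<Rightarrow> i | Rgt \<Rightarrow> Suc i)"

definition step :: "tm \<Rightarrow> sym list \<Rightarrow> config \<Rightarrow> config" where
  "step M w c = (if cq c \<in> halting M then c else
     (case delta M (cq c) (read_in w (ipos c)) (wtape c (wpos c)) of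
        (q', di, g', dw, ot) \<Rightarrow>
          \<lparr>cq = q', ipos = min (move di (ipos c)) (Suc (length w)),
           wtape = (wtape c)(wpos c := g'), wpos = move dw (wpos c),
           outp = outp c @ (case ot of None \<Rightarrow> [] | Some s \<Rightarrow> [s])\<rparr>))"

definition init_config :: "tm \<Rightarrow> config" where
  "init_config M = \<lparr>cq = q0 M, ipos = 0, wtape = (\<lambda>_. 0), wpos = 0, outp = []\<rparr>"

definition run :: "tm \<Rightarrow> sym list \<Rightarrow> nat \<Rightarrow> config" where
  "run M w t = (step M w ^^ t) (init_config M)"

definition logspace_computes :: "tm \<Rightarrow> (sym list \<Rightarrow> sym list) \<Rightarrow> bool" where
  "logspace_computes M f \<longleftrightarrow> valid_tm M \<and>
     (\<exists>c::nat. \<forall>w. \<exists>t. cq (run M w t) \<in> halting M \<and> outp (run M w t) = f w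
        \<and> (\<forall>t'\<le>t. wpos (run M w t') \<le> c * nat \<lceil>log 2 (real (length w + 2))\<rceil>))"

definition logspace_reducible :: "sym list set \<Rightarrow> sym list set \<Rightarrow> bool" where
  "logspace_reducible A B \<longleftrightarrow>
     (\<exists>M f. logspace_computes M f \<and> (\<forall>w. w \<in> A \<longleftrightarrow> f w \<in> B))"

end

theory Submission
  imports Defs
begin

text \<open>
  From K and a formula, build a formula whose models are teams over state propositions. Besides
  path traces such a team contains, for every position n and every state i, a marker trace that is
  marked at n only and is in state i there. The subteams of the marker traces range over all
  sequences of states, so one team disjunction under a negation forces every sequence of states to
  be realised by some trace; this uses temporal depth 2 and makes uncountable teams describable. A
  second disjunction cuts the team down to the traces that are paths of K, on which the given formula is
  evaluated after replacing each proposition by a Boolean combination of state propositions.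

  The transformation is a first-order definable string transduction extended by counting state labels
  and evaluating binary numbers; loops over input positions need only a bounded number of registers
  with values linear in the input length, stored in binary on the work tape. The given formula is
  copied token by token to the end of the output, so its syntax, its operators and its temporal
  depth need not be checked: by unique readability they are right iff those of the output are.
\<close>

section \<open>Transducers with arbitrary finite state sets and alphabets\<close>

text \<open>The obstacle is presence: conditions on single traces can only forbid traces, while
  \<open>team_of K\<close> may be uncountable and all of it must be there.
  \<open>Sim (Neg \<phi>)\<close> can demand one trace at a time. To demand all sequences,
  \<open>Sim (Disj a (Sim b))\<close> is read as a universal quantifier: whatever part satisfying
  \<open>a\<close> is split off, the rest satisfies \<open>b\<close>. Realising all sequences and
  not just the paths keeps \<open>full\<close> independent of the edges. Two kinds of numbers in the
  input can be exponential in its length. The state count is written in binary, so it is compared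
  with the number of label lists, which is linear, and only then do states serve as loop bounds.
  Propositions of the given formula are never evaluated, only compared digit by digit. State
  propositions are numbered \<open>2 ^ (i + 2) - 1\<close> because such a numeral is a run of ones,
  printable by counting. Inputs that are not well formed are sent to \<open>[THash]\<close>, which
  encodes no formula.\<close>

type_synonym ('q, 'g) adelta = "'q \<Rightarrow> sym option \<Rightarrow> 'g \<Rightarrow> 'q \<times> dir \<times> 'g \<times> dir \<times> sym option"
type_synonym ('q, 'g) aconf = "'q \<times> nat \<times> (nat \<Rightarrow> 'g) \<times> nat \<times> sym list"

definition astep :: "('q, 'g) adelta \<Rightarrow> 'q set \<Rightarrow> sym list \<Rightarrow> ('q, 'g) aconf \<Rightarrow> ('q, 'g) aconf" where
  "astep D H w c = (case c of (q, ip, tp, wp, out) \<Rightarrow>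
     if q \<in> H then c else
     (case D q (read_in w ip) (tp wp) of (q', di, g', dw, ot) \<Rightarrow>
        (q', min (move di ip) (Suc (length w)), tp(wp := g'), move dw wp,
         out @ (case ot of None \<Rightarrow> [] | Some s \<Rightarrow> [s]))))"

text \<open>The chosen element gets number 0 because 0 is the blank of a \<open>tm\<close>; the same
  normalisation later gives the start state of an automaton the number 0.\<close>

lemma finite_enum_with_zero:
  assumes "finite A" "b \<in> A"
  obtains e :: "'a \<Rightarrow> nat" where "inj_on e A" "e ` A \<subseteq> {..<card A}" "e b = 0"
proof -
  have "finite (A - {b})" using assms by simp
  from ex_bij_betw_finite_nat[OF this] obtain h where h: "bij_betw h (A - {b}) {0..<card (A - {b})}" by blast
  define e where "e x = (if x = b then 0 else Suc (h x))" for x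
  have "inj_on e A"
    using h by (auto simp: inj_on_def e_def bij_betw_def)
  moreover have "e ` A \<subseteq> {..<card A}"
  proof
    fix y assume "y \<in> e ` A"
    then obtain x where x: "x \<in> A" "y = e x" by blast
    have pos: "card A > 0" using assms by (auto simp: card_gt_0_iff)
    have c: "card (A - {b}) = card A - 1" using assms by simp
    show "y \<in> {..<card A}"
    proof (cases "x = b")
      case True then show ?thesis using x pos by (simp add: e_def)
    next
      case False
      then have "h x \<in> {0..<card (A - {b})}" using h x by (auto simp: bij_betw_def)
      then show ?thesis using x False c pos by (simp add: e_def)
    qed
  qed
  ultimately show ?thesis using that[of e] by (simp add: e_def)
qed

definition agrees :: "'q set \<Rightarrow> tm \<Rightarrow> config \<Rightarrow> ('q, 'g) aconf \<Rightarrow> bool" where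
  "agrees H M c x \<longleftrightarrow> (case x of (q, ip, tp, wp, out) \<Rightarrow>
     (cq c \<in> halting M \<longleftrightarrow> q \<in> H) \<and> outp c = out \<and> wpos c = wp)"

text \<open>Control states and tape cells may come from any type, even an infinite one, as long as
  the machine stays within finite sets. This allows stacks of commands as states and sets of
  registers as cells.\<close>

theorem realize_machine:
  fixes D :: "('q, 'g) adelta"
  assumes fin: "finite Q" "finite G" and start: "s \<in> Q" "b \<in> G"
    and closed: "\<And>q a g q' di g' dw ot. q \<in> Q \<Longrightarrow> g \<in> G \<Longrightarrow> D q a g = (q', di, g', dw, ot) \<Longrightarrow> q' \<in> Q \<and> g' \<in> G"
  shows "\<exists>M. valid_tm M \<and> (\<forall>w t. agrees H M (run M w t) ((astep D H w ^^ t) (s, 0, (\<lambda>_. b), 0, [])))"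
proof -
  obtain e :: "'q \<Rightarrow> nat" where e: "inj_on e Q" "e ` Q \<subseteq> {..<card Q}" "e s = 0"
    using finite_enum_with_zero[OF fin(1) start(1)] by blast
  obtain f :: "'g \<Rightarrow> nat" where f: "inj_on f G" "f ` G \<subseteq> {..<card G}" "f b = 0"
    using finite_enum_with_zero[OF fin(2) start(2)] by blast
  \<comment> \<open>Numbers outside the image decode to \<open>s\<close> and \<open>b\<close>, so
    decoding always lands in \<open>Q\<close> and \<open>G\<close> and the closure assumption
    applies to every number.\<close>
  define dq where "dq n = (if n \<in> e ` Q then inv_into Q e n else s)" for n
  define dg where "dg n = (if n \<in> f ` G then inv_into G f n else b)" for n
  have dq: "dq n \<in> Q" for n using start by (auto simp: dq_def inv_into_into)
  have dg: "dg n \<in> G" for n using start by (auto simp: dg_def inv_into_into)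
  have dqe: "dq (e q) = q" if "q \<in> Q" for q using that e by (simp add: dq_def)
  have dgf: "dg (f g) = g" if "g \<in> G" for g using that f by (simp add: dg_def)
  define M where "M = \<lparr>nq = card Q, ng = card G,
     delta = (\<lambda>q a g. case D (dq q) a (dg g) of (q', di, g', dw, ot) \<Rightarrow> (e q', di, f g', dw, ot)),
     q0 = e s, halting = e ` (H \<inter> Q)\<rparr>"
  have valid: "valid_tm M"
    unfolding valid_tm_def
  proof (intro conjI allI impI)
    show "q0 M < nq M" using e start by (auto simp: M_def)
    show "0 < ng M" using fin start by (auto simp: M_def card_gt_0_iff)
    show "halting M \<subseteq> {0..<nq M}" using e by (fastforce simp: M_def)
    fix q a g
    obtain q' di g' dw ot where d: "D (dq q) a (dg g) = (q', di, g', dw, ot)" by (metis prod_cases5)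
    then have "q' \<in> Q \<and> g' \<in> G" using closed[OF dq dg] by blast
    then show "case delta M q a g of (q', _, g', _, _) \<Rightarrow> q' < nq M \<and> g' < ng M"
      using d e f by (auto simp: M_def)
  qed
  define rep where "rep c = (case c of (q, ip, tp, wp, out) \<Rightarrow>
      \<lparr>cq = e q, ipos = ip, wtape = f \<circ> tp, wpos = wp, outp = out\<rparr>)" for c :: "('q, 'g) aconf"
  define ok where "ok c = (case c of (q, ip, tp, wp, out) \<Rightarrow> q \<in> Q \<and> (\<forall>i. tp i \<in> G))" for c :: "('q, 'g) aconf"
  \<comment> \<open>The renumbering is injective on \<open>Q\<close> only, which is why the halting
    set is cut down to \<open>H \<inter> Q\<close>.\<close>
  have eH: "e q \<in> e ` (H \<inter> Q) \<longleftrightarrow> q \<in> H" if "q \<in> Q" for q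
    using that e by (auto simp: inj_on_def subset_iff)
  have stp: "ok (astep D H w c) \<and> step M w (rep c) = rep (astep D H w c)" if "ok c" for w c
  proof -
    obtain q ip tp wp out where c: "c = (q, ip, tp, wp, out)" by (metis prod_cases5)
    have q: "q \<in> Q" and tp: "\<And>i. tp i \<in> G" using that by (auto simp: ok_def c)
    obtain q' di g' dw ot where d: "D q (read_in w ip) (tp wp) = (q', di, g', dw, ot)" by (metis prod_cases5)
    have cl: "q' \<in> Q" "g' \<in> G" using closed[OF q tp d] by auto
    show ?thesis
    proof (cases "q \<in> H")
      case True
      then show ?thesis using that by (simp add: astep_def step_def c rep_def M_def eH q)
    next
      case False
      have "(f \<circ> tp)(wp := f g') = f \<circ> tp(wp := g')" by auto
      with False show ?thesis using d cl tp q
        by (simp add: astep_def step_def c rep_def M_def eH ok_def dqe dgf)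
    qed
  qed
  have sim: "ok ((astep D H w ^^ t) (s, 0, (\<lambda>_. b), 0, [])) \<and>
     run M w t = rep ((astep D H w ^^ t) (s, 0, (\<lambda>_. b), 0, []))" for w t
  proof (induction t)
    case 0
    show ?case using start e f by (auto simp: run_def ok_def rep_def init_config_def M_def)
  next
    case (Suc t)
    then show ?case using stp by (simp add: run_def)
  qed
  have "agrees H M (run M w t) ((astep D H w ^^ t) (s, 0, (\<lambda>_. b), 0, []))" for w t
  proof -
    obtain q ip tp wp out where c: "(astep D H w ^^ t) (s, 0, (\<lambda>_. b), 0, []) = (q, ip, tp, wp, out)" by (metis prod_cases5)
    have q: "q \<in> Q" using sim[of t w] by (simp add: c ok_def)
    have "run M w t = rep (q, ip, tp, wp, out)" using sim[of t w] c by simp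
    then show ?thesis using eH[OF q] unfolding c by (simp add: rep_def M_def agrees_def)
  qed
  with valid show ?thesis by blast
qed

section \<open>Register programs on a logarithmic work tape\<close>

text \<open>Registers are touched only by \<open>Add\<close> and \<open>Cmp\<close>, and
  \<open>Cmp\<close> leaves its verdict in the finite memory. The guards of \<open>If\<close> and
  \<open>While\<close> therefore depend on memory and scanned symbol alone and cost a single machine
  step.\<close>

datatype cmd =
    Mv dir
  | Emt sym
  | Ctl "nat \<Rightarrow> sym option \<Rightarrow> nat"
  | Add nat nat nat bool
  | Cmp nat nat
  | Seq cmd cmd
  | If "nat \<Rightarrow> sym option \<Rightarrow> bool" cmd cmd
  | While "nat \<Rightarrow> sym option \<Rightarrow> bool" cmd

type_synonym st = "nat \<times> (nat \<Rightarrow> nat) \<times> nat \<times> sym list"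

text \<open>\<open>B\<close> caps every value written to a register. A derivation thus certifies
  termination and the space bound at once.\<close>

inductive bs :: "sym list \<Rightarrow> nat \<Rightarrow> cmd \<Rightarrow> st \<Rightarrow> st \<Rightarrow> bool" for w B where
  Mv: "bs w B (Mv d) (h, r, m, out) (min (move d h) (Suc (length w)), r, m, out)"
| Emt: "bs w B (Emt s) (h, r, m, out) (h, r, m, out @ [s])"
| Ctl: "bs w B (Ctl f) (h, r, m, out) (h, r, f m (read_in w h), out)"
| Add: "r j + r l + of_bool b < B \<Longrightarrow>
    bs w B (Add i j l b) (h, r, m, out) (h, r(i := r j + r l + of_bool b), m, out)"
| Cmp: "bs w B (Cmp i j) (h, r, m, out) (h, r, of_bool (r i < r j), out)"
| Seq: "bs w B c s s' \<Longrightarrow> bs w B d s' s'' \<Longrightarrow> bs w B (Seq c d) s s''"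
| IfT: "P m (read_in w h) \<Longrightarrow> bs w B c (h, r, m, out) s' \<Longrightarrow> bs w B (If P c d) (h, r, m, out) s'"
| IfF: "\<not> P m (read_in w h) \<Longrightarrow> bs w B d (h, r, m, out) s' \<Longrightarrow> bs w B (If P c d) (h, r, m, out) s'"
| WhF: "\<not> P m (read_in w h) \<Longrightarrow> bs w B (While P c) (h, r, m, out) (h, r, m, out)"
| WhT: "P m (read_in w h) \<Longrightarrow> bs w B c (h, r, m, out) s' \<Longrightarrow> bs w B (While P c) s' s'' \<Longrightarrow>
    bs w B (While P c) (h, r, m, out) s''"

primrec wfc :: "nat \<Rightarrow> nat \<Rightarrow> cmd \<Rightarrow> bool" where
  "wfc R mb (Mv d) \<longleftrightarrow> True"
| "wfc R mb (Emt s) \<longleftrightarrow> True"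
| "wfc R mb (Ctl f) \<longleftrightarrow> (\<forall>m<mb. \<forall>a. f m a < mb)"
| "wfc R mb (Add i j l b) \<longleftrightarrow> i < R \<and> j < R \<and> l < R"
| "wfc R mb (Cmp i j) \<longleftrightarrow> i < R \<and> j < R"
| "wfc R mb (Seq c d) \<longleftrightarrow> wfc R mb c \<and> wfc R mb d"
| "wfc R mb (If P c d) \<longleftrightarrow> wfc R mb c \<and> wfc R mb d"
| "wfc R mb (While P c) \<longleftrightarrow> wfc R mb c"

datatype phase = Init | Main | AddS nat nat nat bool | CmpS nat nat bool | Ret

type_synonym mstate = "cmd list \<times> phase \<times> nat"
type_synonym cell = "nat set option"

text \<open>A control state holds the stack of pending commands, the phase of a work-tape sweep, and the
  finite memory. Work-tape cell number j holds the set of registers whose j-th bit is set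
  (least significant bit at the left end); the extra element R marks cell 0.\<close>

fun mdelta :: "nat \<Rightarrow> (mstate, cell) adelta" where
  "mdelta R (k, Init, m) a g = ((k, Main, m), Stay, Some {R}, Stay, None)"
| "mdelta R ([], Main, m) a g = (([], Main, m), Stay, g, Stay, None)"
| "mdelta R (Mv d # k, Main, m) a g = ((k, Main, m), d, g, Stay, None)"
| "mdelta R (Emt s # k, Main, m) a g = ((k, Main, m), Stay, g, Stay, Some s)"
| "mdelta R (Ctl f # k, Main, m) a g = ((k, Main, f m a), Stay, g, Stay, None)"
| "mdelta R (Add i j l b # k, Main, m) a g = ((k, AddS i j l b, m), Stay, g, Stay, None)"
| "mdelta R (Cmp i j # k, Main, m) a g = ((k, CmpS i j False, m), Stay, g, Stay, None)"
| "mdelta R (Seq c d # k, Main, m) a g = ((c # d # k, Main, m), Stay, g, Stay, None)"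
| "mdelta R (If P c d # k, Main, m) a g = (((if P m a then c else d) # k, Main, m), Stay, g, Stay, None)"
| "mdelta R (While P c # k, Main, m) a g =
     ((if P m a then c # While P c # k else k, Main, m), Stay, g, Stay, None)"
| "mdelta R (k, AddS i j l b, m) a (Some A) =
     ((k, AddS i j l (j \<in> A \<and> l \<in> A \<or> j \<in> A \<and> b \<or> l \<in> A \<and> b), m), Stay,
      Some (if (j \<in> A) = ((l \<in> A) = b) then insert i A else A - {i}), Rgt, None)"
| "mdelta R (k, AddS i j l b, m) a None =
     ((k, Ret, m), Stay, if b then Some {i} else None, Lft, None)"
| "mdelta R (k, CmpS i j lt, m) a (Some A) =
     ((k, CmpS i j (if (i \<in> A) = (j \<in> A) then lt else j \<in> A), m), Stay, Some A, Rgt, None)"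
| "mdelta R (k, CmpS i j lt, m) a None = ((k, Ret, of_bool lt), Stay, None, Lft, None)"
| "mdelta R (k, Ret, m) a (Some A) =
     (if R \<in> A then ((k, Main, m), Stay, Some A, Stay, None) else ((k, Ret, m), Stay, Some A, Lft, None))"
| "mdelta R (k, Ret, m) a None = ((k, Ret, m), Stay, None, Stay, None)"

text \<open>The continuations that can arise while \<open>c\<close> runs on top of \<open>k\<close>.
  A loop puts itself below its body and never piles up, so the set is finite and the stack can be
  part of the control state.\<close>

primrec stacks :: "cmd \<Rightarrow> cmd list \<Rightarrow> cmd list set" where
  "stacks (Mv d) k = {Mv d # k, k}"
| "stacks (Emt s) k = {Emt s # k, k}"
| "stacks (Ctl f) k = {Ctl f # k, k}"
| "stacks (Add i j l b) k = {Add i j l b # k, k}"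
| "stacks (Cmp i j) k = {Cmp i j # k, k}"
| "stacks (Seq c d) k = {Seq c d # k, k} \<union> stacks c (d # k) \<union> stacks d k"
| "stacks (If P c d) k = {If P c d # k, k} \<union> stacks c k \<union> stacks d k"
| "stacks (While P c) k = {While P c # k, k} \<union> stacks c (While P c # k)"

lemma finite_stacks: "finite (stacks c k)"
  by (induction c arbitrary: k) auto

lemma stacks_self [simp]: "c # k \<in> stacks c k"
  by (cases c) auto

lemma stacks_rest [simp]: "k \<in> stacks c k"
  by (cases c) auto

definition phases :: "nat \<Rightarrow> phase set" where
  "phases R = {Init, Main, Ret} \<union> {AddS i j l b | i j l b. i < R \<and> j < R \<and> l < R}
     \<union> {CmpS i j b | i j b. i < R \<and> j < R}"

lemma finite_phases: "finite (phases R)"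
proof -
  have "phases R \<subseteq> {Init, Main, Ret} \<union>
      (\<lambda>(i, j, l, b). AddS i j l b) ` ({..<R} \<times> {..<R} \<times> {..<R} \<times> UNIV) \<union>
      (\<lambda>(i, j, b). CmpS i j b) ` ({..<R} \<times> {..<R} \<times> UNIV)"
    unfolding phases_def by force
  then show ?thesis by (rule finite_subset) simp
qed

lemma phases_simps [simp]:
  "Init \<in> phases R" "Main \<in> phases R" "Ret \<in> phases R"
  "AddS i j l b \<in> phases R \<longleftrightarrow> i < R \<and> j < R \<and> l < R"
  "CmpS i j b \<in> phases R \<longleftrightarrow> i < R \<and> j < R"
  by (auto simp: phases_def)

text \<open>The case \<open>x = k\<close> is excluded so that the induction can change the
  continuation: once a subcommand is used up, the remaining stack belongs to the enclosing
  command.\<close>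

lemma mdelta_stack_closed:
  assumes "mdelta R (x, Main, m) a g = ((x', ph', m'), di, g', dw, ot)"
    and "x \<in> stacks c k" "x \<noteq> k" "wfc R mb c" "m < mb"
  shows "x' \<in> stacks c k \<and> m' < mb \<and> ph' \<in> phases R \<and> g' = g"
  using assms
proof (induction c arbitrary: k)
  case (Seq c1 c2)
  consider "x = Seq c1 c2 # k" | "x \<in> stacks c1 (c2 # k)" "x \<noteq> c2 # k" | "x \<in> stacks c2 k"
    using Seq.prems(2,3) by (cases "x = c2 # k") auto
  then show ?case
  proof cases
    case 1
    then show ?thesis using Seq.prems by (auto simp: phases_def)
  next
    case 2
    then show ?thesis using Seq.IH(1)[of "c2 # k"] Seq.prems by auto
  next
    case 3
    then show ?thesis using Seq.IH(2)[of k] Seq.prems by auto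
  qed
next
  case (If P c1 c2)
  consider "x = If P c1 c2 # k" | "x \<in> stacks c1 k" | "x \<in> stacks c2 k"
    using If.prems by auto
  then show ?case
  proof cases
    case 1
    then show ?thesis using If.prems by (cases "P m a") (auto simp: phases_def)
  next
    case 2
    then show ?thesis using If.IH(1)[of "k"] If.prems by auto
  next
    case 3
    then show ?thesis using If.IH(2)[of k] If.prems by auto
  qed
next
  case (While P c)
  consider "x = While P c # k" | "x \<in> stacks c (While P c # k)" "x \<noteq> While P c # k"
    using While.prems by auto
  then show ?case
  proof cases
    case 1
    then show ?thesis using While.prems by (cases "P m a") (auto simp: phases_def)
  next
    case 2
    then show ?thesis using While.IH[of "While P c # k"] While.prems by auto
  qed
qed (auto simp: phases_def)

text \<open>The bound \<open>2 \<le> mb\<close> makes room for the two verdicts of a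
  comparison.\<close>

lemma mdelta_closed:
  assumes c: "wfc R mb c" and mb: "2 \<le> mb"
    and q: "q \<in> stacks c [] \<times> phases R \<times> {..<mb}"
    and g: "g \<in> insert None (Some ` Pow {..R})"
    and d: "mdelta R q a g = (q', di, g', dw, ot)"
  shows "q' \<in> stacks c [] \<times> phases R \<times> {..<mb} \<and> g' \<in> insert None (Some ` Pow {..R})"
proof -
  obtain x ph m where qq: "q = (x, ph, m)" by (cases q) auto
  have ph: "ph \<in> phases R" and x: "x \<in> stacks c []" and m: "m < mb" using q qq by auto
  show ?thesis
  proof (cases "ph = Main \<and> x \<noteq> []")
    case True
    obtain x' ph' m' where q': "q' = (x', ph', m')" by (cases q') auto
    show ?thesis using mdelta_stack_closed[of R x m a g x' ph' m' di g' dw ot c "[]" mb] True d qq q' c x m g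
      by auto
  next
    case False
    have mb': "of_bool b < mb" for b using mb by auto
    show ?thesis
    proof (cases ph)
      case Main
      then show ?thesis using False d qq x m g by auto
    next
      case (AddS i j l b)
      show ?thesis
      proof (cases g)
        case None
        then have "q' = (x, Ret, m)" "g' = (if b then Some {i} else None)" using d qq AddS by auto
        then show ?thesis using x m ph AddS by auto
      next
        case (Some A)
        then have *: "fst q' = x" "fst (snd q') = AddS i j l (j \<in> A \<and> l \<in> A \<or> j \<in> A \<and> b \<or> l \<in> A \<and> b)"
           "snd (snd q') = m" "g' = Some (if (j \<in> A) = ((l \<in> A) = b) then insert i A else A - {i})"
          using d qq AddS by (auto split del: if_split)
        have "insert i A \<subseteq> {..R}" "A - {i} \<subseteq> {..R}" using Some g ph AddS by auto
        then have "g' \<in> Some ` Pow {..R}" using *(4) by (simp split: if_split)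
        then show ?thesis using x m ph AddS * by (auto simp: mem_Times_iff simp del: image_eqI)
      qed
    next
      case (CmpS i j b)
      show ?thesis
      proof (cases g)
        case None
        then have "q' = (x, Ret, of_bool b)" "g' = None" using d qq CmpS by auto
        then show ?thesis using x mb' by auto
      next
        case (Some A)
        then have "q' = (x, CmpS i j (if (i \<in> A) = (j \<in> A) then b else j \<in> A), m)" "g' = g"
          using d qq CmpS by (auto split del: if_split)
        then show ?thesis using x m ph CmpS g by auto
      qed
    next
      case Init
      then show ?thesis using d qq x m g ph by auto
    next
      case Ret
      show ?thesis
      proof (cases g)
        case None
        then show ?thesis using d qq Ret x m by auto
      next
        case (Some A)
        then have "q' = (x, if R \<in> A then Main else Ret, m)" "g' = g"
          using d qq Ret by (auto split: if_splits)
        then show ?thesis using x m g by auto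
      qed
    qed
  qed
qed

section \<open>Runs with a bound on the work-tape head\<close>

definition wp_of :: "('q, 'g) aconf \<Rightarrow> nat" where
  "wp_of c = fst (snd (snd (snd c)))"

text \<open>The bound is required at every intermediate configuration, so it composes along runs and
  is the space bound in the end.\<close>

definition reach :: "('q, 'g) adelta \<Rightarrow> 'q set \<Rightarrow> sym list \<Rightarrow> nat \<Rightarrow> ('q, 'g) aconf \<Rightarrow> ('q, 'g) aconf \<Rightarrow> bool" where
  "reach D H w b x y \<longleftrightarrow> (\<exists>t. (astep D H w ^^ t) x = y \<and> (\<forall>t'\<le>t. wp_of ((astep D H w ^^ t') x) \<le> b))"

lemma reach_refl: "wp_of x \<le> b \<Longrightarrow> reach D H w b x x"
  unfolding reach_def by (rule exI[of _ 0]) auto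

lemma reach_trans [trans]:
  assumes "reach D H w b x y" "reach D H w b y z"
  shows "reach D H w b x z"
proof -
  obtain t where t: "(astep D H w ^^ t) x = y" "\<And>t'. t' \<le> t \<Longrightarrow> wp_of ((astep D H w ^^ t') x) \<le> b"
    using assms(1) by (auto simp: reach_def)
  obtain u where u: "(astep D H w ^^ u) y = z" "\<And>t'. t' \<le> u \<Longrightarrow> wp_of ((astep D H w ^^ t') y) \<le> b"
    using assms(2) by (auto simp: reach_def)
  have "wp_of ((astep D H w ^^ t') x) \<le> b" if "t' \<le> u + t" for t'
  proof (cases "t' \<le> t")
    case False
    then have "t' = (t' - t) + t" by simp
    then have "(astep D H w ^^ t') x = (astep D H w ^^ (t' - t)) y"
      using t(1) by (metis comp_apply funpow_add)
    then show ?thesis using u(2)[of "t' - t"] that by simp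
  qed (use t in auto)
  moreover have "(astep D H w ^^ (u + t)) x = z" using t(1) u(1) by (simp add: funpow_add)
  ultimately show ?thesis unfolding reach_def by blast
qed

lemma reach_step:
  assumes "wp_of x \<le> b" "reach D H w b (astep D H w x) z"
  shows "reach D H w b x z"
proof -
  have "reach D H w b x (astep D H w x)"
    unfolding reach_def
  proof (intro exI conjI allI impI)
    show "(astep D H w ^^ 1) x = astep D H w x" by simp
    fix t' :: nat assume "t' \<le> 1"
    moreover have "wp_of (astep D H w x) \<le> b" using assms(2) by (auto simp: reach_def)
    ultimately show "wp_of ((astep D H w ^^ t') x) \<le> b" using assms(1) by (cases t') auto
  qed
  then show ?thesis using assms(2) reach_trans by blast
qed

lemma reach_one: "astep D H w x = y \<Longrightarrow> wp_of x \<le> b \<Longrightarrow> wp_of y \<le> b \<Longrightarrow> reach D H w b x y"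
  using reach_step[of x b D H w y] reach_refl[of y b D H w] by simp

section \<open>Binary registers on the work tape\<close>

definition cellof :: "nat \<Rightarrow> (nat \<Rightarrow> nat) \<Rightarrow> nat \<Rightarrow> nat set" where
  "cellof R r j = {i. i < R \<and> bit (r i) j} \<union> (if j = 0 then {R} else {})"

text \<open>The first blank, at \<open>L\<close>, stops a sweep to the right; the mark
  \<open>R\<close> in cell 0 stops the way back.\<close>

definition tape :: "nat \<Rightarrow> (nat \<Rightarrow> nat) \<Rightarrow> nat \<Rightarrow> nat \<Rightarrow> cell" where
  "tape R r L j = (if j < L then Some (cellof R r j) else None)"

abbreviation "halts \<equiv> {q :: mstate. fst q = [] \<and> fst (snd q) = Main}"

lemma reach_ret:
  assumes "p < L" "p \<le> b" "h \<le> Suc (length w)"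
  shows "reach (mdelta R) halts w b ((k, Ret, m), h, tape R r L, p, out) ((k, Main, m), h, tape R r L, 0, out)"
  using assms
proof (induction p)
  case 0
  then have t: "tape R r L 0 = Some (cellof R r 0)" by (simp add: tape_def)
  then have up: "(tape R r L)(0 := Some (cellof R r 0)) = tape R r L" by (rule fun_upd_idem)
  have "R \<in> cellof R r 0" by (simp add: cellof_def)
  then have "astep (mdelta R) halts w ((k, Ret, m), h, tape R r L, 0, out) =
      ((k, Main, m), h, tape R r L, 0, out)"
    using 0 t up by (simp add: astep_def move_def)
  then show ?case by - (rule reach_step, simp_all add: wp_of_def reach_refl)
next
  case (Suc p)
  then have t: "tape R r L (Suc p) = Some (cellof R r (Suc p))" by (simp add: tape_def)
  have "(tape R r L)(Suc p := Some (cellof R r (Suc p))) = tape R r L" using t by (rule fun_upd_idem)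
  moreover have "R \<notin> cellof R r (Suc p)" by (simp add: cellof_def)
  ultimately have "astep (mdelta R) halts w ((k, Ret, m), h, tape R r L, Suc p, out) =
      ((k, Ret, m), h, tape R r L, p, out)"
    using Suc.prems t by (simp add: astep_def move_def)
  then show ?case using Suc by - (rule reach_step, simp_all add: wp_of_def)
qed

text \<open>\<open>cy j\<close> is the carry into position \<open>j\<close>: the two parts below
  \<open>2 ^ j\<close> together with the initial bit overflow. As this sum stays below
  \<open>2 * 2 ^ j\<close>, the carry is a single bit, updated by majority.\<close>

lemma bit_add_carry:
  fixes x y :: nat and b :: bool
  defines "cy j \<equiv> 2 ^ j \<le> x mod 2 ^ j + y mod 2 ^ j + of_bool b"
  shows "bit (x + y + of_bool b) j \<longleftrightarrow> (bit x j \<longleftrightarrow> (bit y j \<longleftrightarrow> cy j))"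
    and "cy (Suc j) \<longleftrightarrow> (bit x j \<and> bit y j \<or> bit x j \<and> cy j \<or> bit y j \<and> cy j)"
proof -
  define s where "s = x mod 2 ^ j + y mod 2 ^ j + of_bool b"
  define q where "q = x div 2 ^ j" define q' where "q' = y div 2 ^ j"
  have xm: "x mod 2 ^ j < 2 ^ j" "y mod 2 ^ j < 2 ^ j" by simp_all
  have s2: "s < 2 * 2 ^ j" using xm unfolding s_def by (cases b; simp; linarith)
  have cy: "cy j \<longleftrightarrow> 2 ^ j \<le> s" unfolding cy_def s_def ..
  have sd: "s div 2 ^ j = of_bool (cy j)"
  proof (cases "cy j")
    case True
    then have "s div 2 ^ j = 1" using s2 cy by (intro div_nat_eqI) auto
    then show ?thesis using True by simp
  next
    case False then show ?thesis using cy by simp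
  qed
  have sum: "x + y + of_bool b = s + (q + q') * 2 ^ j"
  proof -
    have "x = q * 2 ^ j + x mod 2 ^ j" "y = q' * 2 ^ j + y mod 2 ^ j"
      unfolding q_def q'_def by (simp_all add: div_mult_mod_eq)
    then show ?thesis unfolding s_def by (simp add: algebra_simps)
  qed
  have "(x + y + of_bool b) div 2 ^ j = q + q' + of_bool (cy j)"
    unfolding sum using sd by simp
  then show "bit (x + y + of_bool b) j \<longleftrightarrow> (bit x j \<longleftrightarrow> (bit y j \<longleftrightarrow> cy j))"
    unfolding bit_iff_odd q_def q'_def by auto
  have mS: "z mod 2 ^ Suc j = z mod 2 ^ j + of_bool (bit z j) * 2 ^ j" for z :: nat
    by (simp add: bit_iff_odd mod2_eq_if mod_mult2_eq power_Suc2 del: power_Suc)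
  have "cy (Suc j) \<longleftrightarrow> 2 * 2 ^ j \<le> s + (of_bool (bit x j) + of_bool (bit y j)) * 2 ^ j"
    unfolding cy_def mS s_def by (simp add: algebra_simps)
  then show "cy (Suc j) \<longleftrightarrow> (bit x j \<and> bit y j \<or> bit x j \<and> cy j \<or> bit y j \<and> cy j)"
    using cy s2 by (cases "bit x j"; cases "bit y j") auto
qed

text \<open>Bits arrive from the least significant end, so a later difference overrules the verdict
  so far and equal bits keep it.\<close>

lemma less_mod_Suc:
  fixes x y :: nat
  shows "x mod 2 ^ Suc j < y mod 2 ^ Suc j \<longleftrightarrow>
    (if bit x j = bit y j then x mod 2 ^ j < y mod 2 ^ j else bit y j)"
proof -
  have mS: "z mod 2 ^ Suc j = z mod 2 ^ j + of_bool (bit z j) * 2 ^ j" for z :: nat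
    by (simp add: bit_iff_odd mod2_eq_if mod_mult2_eq power_Suc2 del: power_Suc)
  have "x mod 2 ^ j < 2 ^ j" "y mod 2 ^ j < 2 ^ j" by simp_all
  then show ?thesis unfolding mS by (cases "bit x j"; cases "bit y j") (auto simp del: mod_less_divisor)
qed

lemma reach_cmp_scan:
  assumes "p \<le> L" "L \<le> b" "h \<le> Suc (length w)" "i < R" "j < R"
    and "lt = (r i mod 2 ^ p < r j mod 2 ^ p)"
  shows "reach (mdelta R) halts w b ((k, CmpS i j lt, m), h, tape R r L, p, out)
     ((k, CmpS i j (r i mod 2 ^ L < r j mod 2 ^ L), m), h, tape R r L, L, out)"
  using assms
proof (induction "L - p" arbitrary: p lt)
  case 0
  then show ?case by (simp add: reach_refl wp_of_def)
next
  case (Suc n)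
  then have p: "p < L" by simp
  let ?lt = "r i mod 2 ^ Suc p < r j mod 2 ^ Suc p"
  have t: "tape R r L p = Some (cellof R r p)" using p by (simp add: tape_def)
  have up: "(tape R r L)(p := Some (cellof R r p)) = tape R r L" using t by (rule fun_upd_idem)
  have "i \<in> cellof R r p \<longleftrightarrow> bit (r i) p" "j \<in> cellof R r p \<longleftrightarrow> bit (r j) p"
    using Suc.prems by (auto simp: cellof_def)
  then have "astep (mdelta R) halts w ((k, CmpS i j lt, m), h, tape R r L, p, out) =
      ((k, CmpS i j ?lt, m), h, tape R r L, Suc p, out)"
    unfolding less_mod_Suc using Suc.prems t up by (simp add: astep_def move_def)
  moreover have "reach (mdelta R) halts w b ((k, CmpS i j ?lt, m), h, tape R r L, Suc p, out)
     ((k, CmpS i j (r i mod 2 ^ L < r j mod 2 ^ L), m), h, tape R r L, L, out)"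
    using Suc p by (intro Suc.hyps) auto
  ultimately show ?case using Suc.prems by - (rule reach_step, simp_all add: wp_of_def)
qed

lemma reach_cmp:
  assumes "1 \<le> L" "L \<le> b" "h \<le> Suc (length w)" "i < R" "j < R" "r i < 2 ^ L" "r j < 2 ^ L"
  shows "reach (mdelta R) halts w b ((Cmp i j # k, Main, m), h, tape R r L, 0, out)
     ((k, Main, of_bool (r i < r j)), h, tape R r L, 0, out)"
proof -
  have 1: "astep (mdelta R) halts w ((Cmp i j # k, Main, m), h, tape R r L, 0, out) =
      ((k, CmpS i j False, m), h, tape R r L, 0, out)"
    using assms by (simp add: astep_def move_def)
  have 2: "reach (mdelta R) halts w b ((k, CmpS i j False, m), h, tape R r L, 0, out)
     ((k, CmpS i j (r i mod 2 ^ L < r j mod 2 ^ L), m), h, tape R r L, L, out)"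
    using assms by (intro reach_cmp_scan) auto
  have 3: "reach (mdelta R) halts w b ((k, CmpS i j (r i mod 2 ^ L < r j mod 2 ^ L), m), h, tape R r L, L, out)
      ((k, Main, of_bool (r i < r j)), h, tape R r L, 0, out)"
  proof (rule reach_step)
    have "tape R r L L = None" "(tape R r L)(L := None) = tape R r L" by (auto simp: tape_def)
    then have "astep (mdelta R) halts w ((k, CmpS i j (r i mod 2 ^ L < r j mod 2 ^ L), m), h, tape R r L, L, out) =
       ((k, Ret, of_bool (r i < r j)), h, tape R r L, L - 1, out)"
      using assms by (simp add: astep_def move_def)
    then show "reach (mdelta R) halts w b (astep (mdelta R) halts w
       ((k, CmpS i j (r i mod 2 ^ L < r j mod 2 ^ L), m), h, tape R r L, L, out))
      ((k, Main, of_bool (r i < r j)), h, tape R r L, 0, out)"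
      using assms by (auto intro!: reach_ret)
  qed (use assms in \<open>simp add: wp_of_def\<close>)
  show ?thesis
    by (rule reach_step) (use 1 reach_trans[OF 2 3] in \<open>simp_all add: wp_of_def\<close>)
qed

definition mixed :: "nat \<Rightarrow> (nat \<Rightarrow> nat) \<Rightarrow> (nat \<Rightarrow> nat) \<Rightarrow> nat \<Rightarrow> nat \<Rightarrow> nat \<Rightarrow> cell" where
  "mixed R r' r L p q = (if q < p then tape R r' L q else tape R r L q)"

text \<open>The target may be one of the summands: each cell is read before it is overwritten, and
  the cells from \<open>p\<close> on still show the old contents, which is what \<open>mixed\<close>
  records.\<close>

lemma reach_add_scan:
  fixes r :: "nat \<Rightarrow> nat"
  assumes "p \<le> L" "L \<le> b" "h \<le> Suc (length w)" "i < R" "j < R" "l < R"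
    and "cy = (2 ^ p \<le> r j mod 2 ^ p + r l mod 2 ^ p + of_bool bb)"
    and "r' = r(i := r j + r l + of_bool bb)"
  shows "reach (mdelta R) halts w b ((k, AddS i j l cy, m), h, mixed R r' r L p, p, out)
     ((k, AddS i j l (2 ^ L \<le> r j mod 2 ^ L + r l mod 2 ^ L + of_bool bb), m), h, tape R r' L, L, out)"
  using assms
proof (induction "L - p" arbitrary: p cy)
  case 0
  then have "mixed R r' r L p = tape R r' L" by (auto simp: mixed_def tape_def)
  then show ?case using 0 by (simp add: reach_refl wp_of_def)
next
  case (Suc n)
  then have p: "p < L" by simp
  let ?cy = "2 ^ Suc p \<le> r j mod 2 ^ Suc p + r l mod 2 ^ Suc p + of_bool bb"
  let ?A = "cellof R r p"
  have t: "mixed R r' r L p p = Some ?A" using p by (simp add: tape_def mixed_def)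
  have mem: "j \<in> ?A \<longleftrightarrow> bit (r j) p" "l \<in> ?A \<longleftrightarrow> bit (r l) p"
    using Suc.prems by (auto simp: cellof_def)
  note c = bit_add_carry[where x = "r j" and y = "r l" and b = bb and j = p]
  have new: "cellof R r' p = (if (j \<in> ?A) = ((l \<in> ?A) = cy) then insert i ?A else ?A - {i})"
  proof -
    have "bit (r' i) p \<longleftrightarrow> (j \<in> ?A) = ((l \<in> ?A) = cy)"
      using c(1) mem Suc.prems by simp
    then show ?thesis using Suc.prems by (auto simp: cellof_def split: if_splits)
  qed
  have up: "(mixed R r' r L p)(p := Some (cellof R r' p)) = mixed R r' r L (Suc p)"
    using p by (auto simp: mixed_def tape_def less_Suc_eq)
  have cy': "?cy = (j \<in> ?A \<and> l \<in> ?A \<or> j \<in> ?A \<and> cy \<or> l \<in> ?A \<and> cy)"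
    using c(2) mem Suc.prems(7) by simp
  have "astep (mdelta R) halts w ((k, AddS i j l cy, m), h, mixed R r' r L p, p, out) =
      ((k, AddS i j l ?cy, m), h, mixed R r' r L (Suc p), Suc p, out)"
    unfolding cy' using Suc.prems(3) t up new by (simp add: astep_def move_def del: power_Suc)
  moreover have "reach (mdelta R) halts w b ((k, AddS i j l ?cy, m), h, mixed R r' r L (Suc p), Suc p, out)
     ((k, AddS i j l (2 ^ L \<le> r j mod 2 ^ L + r l mod 2 ^ L + of_bool bb), m), h, tape R r' L, L, out)"
    using Suc p by (intro Suc.hyps) auto
  ultimately show ?case using Suc.prems by - (rule reach_step, simp_all add: wp_of_def)
qed

text \<open>The tape grows by one cell exactly if a carry is left at the end. The sum is then at
  least \<open>2 ^ L\<close>, so its bound \<open>2 ^ b\<close> gives \<open>L < b\<close> and there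
  is room for the cell.\<close>

lemma reach_add:
  fixes r :: "nat \<Rightarrow> nat"
  assumes L: "1 \<le> L" "L \<le> b" and h: "h \<le> Suc (length w)" and ijl: "i < R" "j < R" "l < R"
    and r: "\<And>i. i < R \<Longrightarrow> r i < 2 ^ L"
    and sum: "r j + r l + of_bool bb < 2 ^ b"
    and r': "r' = r(i := r j + r l + of_bool bb)"
  obtains L' where "1 \<le> L'" "L' \<le> b" "\<And>i. i < R \<Longrightarrow> r' i < 2 ^ L'"
    "reach (mdelta R) halts w b ((Add i j l bb # k, Main, m), h, tape R r L, 0, out)
     ((k, Main, m), h, tape R r' L', 0, out)"
proof -
  let ?s = "r j + r l + of_bool bb"
  let ?cy = "2 ^ L \<le> ?s"
  have mods: "r j mod 2 ^ L = r j" "r l mod 2 ^ L = r l" using r ijl by auto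
  have 1: "astep (mdelta R) halts w ((Add i j l bb # k, Main, m), h, tape R r L, 0, out) =
      ((k, AddS i j l bb, m), h, mixed R r' r L 0, 0, out)"
    using h by (auto simp add: astep_def move_def mixed_def)
  have 2: "reach (mdelta R) halts w b ((k, AddS i j l bb, m), h, mixed R r' r L 0, 0, out)
     ((k, AddS i j l ?cy, m), h, tape R r' L, L, out)"
    using reach_add_scan[where p = 0 and cy = bb and bb = bb and r' = r' and r = r, of L b h w i R j l k m out]
      assms mods by simp
  have 12: "reach (mdelta R) halts w b ((Add i j l bb # k, Main, m), h, tape R r L, 0, out)
      ((k, AddS i j l ?cy, m), h, tape R r' L, L, out)"
    by (rule reach_step) (use 1 2 in \<open>simp_all add: wp_of_def\<close>)
  define L' where "L' = (if ?cy then Suc L else L)"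
  have s2: "?s < 2 ^ L'"
  proof (cases ?cy)
    case True
    have "(of_bool bb :: nat) \<le> 1" by simp
    then have "?s < 2 ^ L + 2 ^ L" using r[OF ijl(2)] r[OF ijl(3)] by linarith
    then show ?thesis using True by (simp add: L'_def)
  qed (simp add: L'_def)
  have L'b: "L' \<le> b"
  proof (cases ?cy)
    case True
    then have "(2::nat) ^ L < 2 ^ b" using sum by (rule le_less_trans)
    then have "L < b" by simp
    then show ?thesis using True by (simp add: L'_def)
  qed (use L in \<open>simp add: L'_def\<close>)
  have r'b: "r' q < 2 ^ L'" if "q < R" for q
  proof (cases "q = i")
    case False
    have "r q < 2 ^ L" using r that .
    also have "\<dots> \<le> 2 ^ L'" by (simp add: L'_def)
    finally show ?thesis using False r' by simp
  qed (use s2 r' in simp)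
  have tp: "(tape R r' L)(L := (if ?cy then Some {i} else None)) = tape R r' L'"
  proof (cases ?cy)
    case True
    \<comment> \<open>All other registers are still below \<open>2 ^ L\<close>, so the overflow bit
      belongs to register \<open>i\<close> alone and the fresh cell is the singleton written by the
      machine.\<close>
    have "bit (r' q) L \<longleftrightarrow> q = i" if "q < R" for q
    proof (cases "q = i")
      case True
      have "r' q div 2 ^ L = 1" using True \<open>?cy\<close> s2 r' by (intro div_nat_eqI) (auto simp: L'_def)
      then show ?thesis using True by (simp add: bit_iff_odd)
    next
      case False
      then have "r' q < 2 ^ L" using r r' that by simp
      then show ?thesis using False by (simp add: bit_iff_odd)
    qed
    then have "cellof R r' L = {i}" using L ijl by (auto simp: cellof_def)
    then show ?thesis using True by (auto simp: tape_def L'_def less_Suc_eq)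
  next
    case False
    then show ?thesis by (auto simp: tape_def L'_def)
  qed
  have "tape R r' L L = None" by (simp add: tape_def)
  then have "astep (mdelta R) halts w ((k, AddS i j l ?cy, m), h, tape R r' L, L, out) =
       ((k, Ret, m), h, tape R r' L', L - 1, out)"
    using h tp by (simp add: astep_def move_def split del: if_split)
  moreover have "reach (mdelta R) halts w b ((k, Ret, m), h, tape R r' L', L - 1, out) ((k, Main, m), h, tape R r' L', 0, out)"
    using L h by (intro reach_ret) (auto simp: L'_def)
  ultimately have "reach (mdelta R) halts w b ((k, AddS i j l ?cy, m), h, tape R r' L, L, out)
      ((k, Main, m), h, tape R r' L', 0, out)"
    using L(2) by - (rule reach_step, simp_all add: wp_of_def)
  with 12 have "reach (mdelta R) halts w b ((Add i j l bb # k, Main, m), h, tape R r L, 0, out)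
      ((k, Main, m), h, tape R r' L', 0, out)" by (rule reach_trans)
  moreover have "1 \<le> L'" using L by (simp add: L'_def)
  ultimately show ?thesis using that[of L'] L'b r'b by blast
qed

abbreviation mconf :: "nat \<Rightarrow> cmd list \<Rightarrow> st \<Rightarrow> nat \<Rightarrow> (mstate, cell) aconf" where
  "mconf R k s L \<equiv> (case s of (h, r, m, out) \<Rightarrow> ((k, Main, m), h, tape R r L, 0, out))"

text \<open>Values below \<open>2 ^ b\<close> fit into \<open>b\<close> cells; this turns the
  arithmetic budget of \<open>bs\<close> into a bound on head positions. The final width is
  existential because additions may lengthen the tape.\<close>

lemma reach_bs:
  assumes "bs w (2 ^ b) c s s'" "wfc R mb c" "1 \<le> L" "L \<le> b"
    and "\<And>i. i < R \<Longrightarrow> fst (snd s) i < 2 ^ L" and "fst s \<le> Suc (length w)"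
  shows "\<exists>L'. 1 \<le> L' \<and> L' \<le> b \<and> (\<forall>i<R. fst (snd s') i < 2 ^ L') \<and> fst s' \<le> Suc (length w) \<and>
     reach (mdelta R) halts w b (mconf R (c # k) s L) (mconf R k s' L')"
  using assms
proof (induction arbitrary: k L rule: bs.induct)
  case (Mv d h r m out)
  then show ?case
    by (intro exI[of _ L]) (auto simp: astep_def move_def wp_of_def intro!: reach_one)
next
  case (Emt s h r m out)
  then show ?case
    by (intro exI[of _ L]) (auto simp: astep_def move_def wp_of_def intro!: reach_one)
next
  case (Ctl f h r m out)
  then show ?case
    by (intro exI[of _ L]) (auto simp: astep_def move_def wp_of_def intro!: reach_one)
next
  case (Add r j l bb i h m out)
  define r' where "r' = r(i := r j + r l + of_bool bb)"
  obtain L' where "1 \<le> L'" "L' \<le> b" "\<And>i. i < R \<Longrightarrow> r' i < 2 ^ L'"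
    "reach (mdelta R) halts w b ((Add i j l bb # k, Main, m), h, tape R r L, 0, out)
     ((k, Main, m), h, tape R r' L', 0, out)"
    using reach_add[of L b h w i R j l r bb r' k m out] Add r'_def by auto
  then show ?case using Add.prems by (intro exI[of _ L']) (auto simp: r'_def)
next
  case (Cmp i j h r m out)
  then show ?case using reach_cmp[of L b h w i R j r k m out] by (intro exI[of _ L]) auto
next
  case (Seq c s s' d s'')
  obtain L1 where L1: "1 \<le> L1" "L1 \<le> b" "\<forall>i<R. fst (snd s') i < 2 ^ L1" "fst s' \<le> Suc (length w)"
     "reach (mdelta R) halts w b (mconf R (c # d # k) s L) (mconf R (d # k) s' L1)"
    using Seq.IH(1)[of L "d # k"] Seq.prems by auto
  obtain L2 where L2: "1 \<le> L2" "L2 \<le> b" "\<forall>i<R. fst (snd s'') i < 2 ^ L2" "fst s'' \<le> Suc (length w)"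
     "reach (mdelta R) halts w b (mconf R (d # k) s' L1) (mconf R k s'' L2)"
    using Seq.IH(2)[of L1 "k"] Seq.prems L1 by auto
  have "reach (mdelta R) halts w b (mconf R (Seq c d # k) s L) (mconf R (c # d # k) s L)"
    using Seq.prems by (auto simp: astep_def move_def wp_of_def intro!: reach_one split: prod.splits)
  then show ?case using L1(5) L2 reach_trans by blast
next
  case (IfT P m h c r out s' d)
  obtain L1 where L1: "1 \<le> L1" "L1 \<le> b" "\<forall>i<R. fst (snd s') i < 2 ^ L1" "fst s' \<le> Suc (length w)"
     "reach (mdelta R) halts w b (mconf R (c # k) (h, r, m, out) L) (mconf R k s' L1)"
    using IfT.IH[of L "k"] IfT.prems by auto
  have "reach (mdelta R) halts w b (mconf R (If P c d # k) (h, r, m, out) L) (mconf R (c # k) (h, r, m, out) L)"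
    using IfT by (auto simp: astep_def move_def wp_of_def intro!: reach_one)
  then show ?case using L1 reach_trans by blast
next
  case (IfF P m h d r out s' c)
  obtain L1 where L1: "1 \<le> L1" "L1 \<le> b" "\<forall>i<R. fst (snd s') i < 2 ^ L1" "fst s' \<le> Suc (length w)"
     "reach (mdelta R) halts w b (mconf R (d # k) (h, r, m, out) L) (mconf R k s' L1)"
    using IfF.IH[of L "k"] IfF.prems by auto
  have "reach (mdelta R) halts w b (mconf R (If P c d # k) (h, r, m, out) L) (mconf R (d # k) (h, r, m, out) L)"
    using IfF by (auto simp: astep_def move_def wp_of_def intro!: reach_one)
  then show ?case using L1 reach_trans by blast
next
  case (WhF P m h c r out)
  then show ?case
    by (intro exI[of _ L]) (auto simp: astep_def move_def wp_of_def intro!: reach_one)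
next
  case (WhT P m h c r out s' s'')
  obtain L1 where L1: "1 \<le> L1" "L1 \<le> b" "\<forall>i<R. fst (snd s') i < 2 ^ L1" "fst s' \<le> Suc (length w)"
     "reach (mdelta R) halts w b (mconf R (c # While P c # k) (h, r, m, out) L) (mconf R (While P c # k) s' L1)"
    using WhT.IH(1)[of L "While P c # k"] WhT.prems by auto
  obtain L2 where L2: "1 \<le> L2" "L2 \<le> b" "\<forall>i<R. fst (snd s'') i < 2 ^ L2" "fst s'' \<le> Suc (length w)"
     "reach (mdelta R) halts w b (mconf R (While P c # k) s' L1) (mconf R k s'' L2)"
    using WhT.IH(2)[of L1 "k"] WhT.prems L1 by auto
  have "reach (mdelta R) halts w b (mconf R (While P c # k) (h, r, m, out) L) (mconf R (c # While P c # k) (h, r, m, out) L)"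
    using WhT by (auto simp: astep_def move_def wp_of_def intro!: reach_one)
  then show ?case using L1(5) L2 reach_trans by blast
qed

lemma two_power_log_bound:
  "4 * (n + 2) \<le> 2 ^ (nat \<lceil>log 2 (real (n + 2))\<rceil> + 2)"
proof -
  have "real (n + 2) = 2 powr (log 2 (real (n + 2)))" by simp
  also have "\<dots> \<le> 2 powr real (nat \<lceil>log 2 (real (n + 2))\<rceil>)"
    by (intro powr_mono) linarith+
  also have "\<dots> = real (2 ^ nat \<lceil>log 2 (real (n + 2))\<rceil>)" by (subst powr_realpow) simp_all
  finally have "n + 2 \<le> 2 ^ nat \<lceil>log 2 (real (n + 2))\<rceil>" by (simp only: of_nat_le_iff)
  then show ?thesis by simp
qed

lemma bs_mono: "bs w B c s s' \<Longrightarrow> B \<le> B' \<Longrightarrow> bs w B' c s s'"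
proof (induction rule: bs.induct)
  case (Add r j l b i h m out)
  then show ?case by (intro bs.Add) linarith
qed (rule bs.intros; assumption)+

theorem logspace_cmd:
  assumes c: "wfc R mb c" and mb: "2 \<le> mb"
    and exec: "\<And>w. \<exists>h r m. bs w (4 * (length w + 2)) c (0, (\<lambda>_. 0), 0, []) (h, r, m, f w)"
  shows "\<exists>M. logspace_computes M f"
proof -
  let ?Q = "stacks c [] \<times> phases R \<times> {..<mb}"
  let ?G = "insert None (Some ` Pow {..R})"
  let ?D = "mdelta R"
  have fin: "finite ?Q" "finite ?G" using finite_stacks finite_phases by auto
  have start: "([c], Init, 0) \<in> ?Q" "None \<in> ?G" using mb by auto
  define start_conf :: "(mstate, cell) aconf" where "start_conf = (([c], Init, 0), 0, (\<lambda>_. None), 0, [])"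
  have "\<exists>M. valid_tm M \<and> (\<forall>w t. agrees halts M (run M w t) ((astep ?D halts w ^^ t) start_conf))"
    unfolding start_conf_def
    by (rule realize_machine[OF fin start]) (rule mdelta_closed[OF c mb])
  then obtain M where M: "valid_tm M" "\<And>w t. agrees halts M (run M w t) ((astep ?D halts w ^^ t) start_conf)"
    by blast
  have "logspace_computes M f"
    unfolding logspace_computes_def
  proof (rule conjI[OF M(1)], rule exI[of _ 4], rule allI)
    fix w :: "sym list"
    define l where "l = nat \<lceil>log 2 (real (length w + 2))\<rceil>"
    \<comment> \<open>Absorbs the additive constant: \<open>l + 2 \<le> 4 * l\<close>.\<close>
    have l1: "1 \<le> l"
    proof -
      have "0 < log 2 (real (length w + 2))" by simp
      then have "0 < \<lceil>log 2 (real (length w + 2))\<rceil>" by linarith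
      then show ?thesis unfolding l_def by linarith
    qed
    obtain h r m where "bs w (4 * (length w + 2)) c (0, (\<lambda>_. 0), 0, []) (h, r, m, f w)"
      using exec by blast
    then have ex: "bs w (2 ^ (l + 2)) c (0, (\<lambda>_. 0), 0, []) (h, r, m, f w)"
      unfolding l_def by (rule bs_mono) (rule two_power_log_bound)
    obtain L' where L': "reach ?D halts w (l + 2) (mconf R (c # []) (0, (\<lambda>_. 0), 0, []) 1) (mconf R [] (h, r, m, f w) L')"
      using reach_bs[OF ex c, of 1 "[]"] by auto
    have "(\<lambda>_. None)(0 := Some {R}) = tape R (\<lambda>_. 0) 1"
      by (auto simp: tape_def cellof_def)
    then have "astep ?D halts w start_conf = mconf R [c] (0, (\<lambda>_. 0), 0, []) 1"
      by (simp add: astep_def move_def start_conf_def)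
    with L' have "reach ?D halts w (l + 2) start_conf (mconf R [] (h, r, m, f w) L')"
      by - (rule reach_step, simp_all add: wp_of_def start_conf_def)
    then obtain t where t: "(astep ?D halts w ^^ t) start_conf = (([], Main, m), h, tape R r L', 0, f w)"
      "\<And>t'. t' \<le> t \<Longrightarrow> wp_of ((astep ?D halts w ^^ t') start_conf) \<le> l + 2"
      unfolding reach_def by auto
    have "wpos (run M w t') \<le> 4 * l" if "t' \<le> t" for t'
    proof -
      have "wpos (run M w t') \<le> l + 2"
        using t(2)[OF that] M(2)[of w t'] by (auto simp: wp_of_def agrees_def split: prod.splits)
      then show ?thesis using l1 by simp
    qed
    moreover have "cq (run M w t) \<in> halting M \<and> outp (run M w t) = f w"
      using M(2)[of w t] unfolding t(1) by (simp add: agrees_def)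
    ultimately show "\<exists>t. cq (run M w t) \<in> halting M \<and> outp (run M w t) = f w
        \<and> (\<forall>t'\<le>t. wpos (run M w t') \<le> 4 * nat \<lceil>log 2 (real (length w + 2))\<rceil>)"
      unfolding l_def by blast
  qed
  then show ?thesis by blast
qed

section \<open>First-order programs over input positions\<close>

abbreviation npos :: "sym list \<Rightarrow> nat" where "npos w \<equiv> length w + 2"
abbreviation exc :: "sym list \<Rightarrow> cmd \<Rightarrow> st \<Rightarrow> st \<Rightarrow> bool" where
  "exc w \<equiv> bs w (4 * npos w)"

abbreviation is_bit :: "sym \<Rightarrow> bool" where "is_bit s \<equiv> s = B0 \<or> s = B1"

text \<open>Horner evaluation that freezes once \<open>b\<close> is reached. A numeral of
  exponential value thus stays below \<open>2 * b\<close>, while comparison with numbers below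
  \<open>b\<close> remains exact.\<close>

definition satval :: "nat \<Rightarrow> nat \<Rightarrow> sym list \<Rightarrow> nat" where
  "satval b = foldl (\<lambda>x s. if x < b then x + x + of_bool (s = B1) else x)"

text \<open>\<open>Sy\<close> reads at a sum of variables, which provides a position plus an offset,
  as needed to compare two numerals digit by digit. \<open>Df\<close> runs a finite automaton over
  the whole input.\<close>

datatype tst =
    Sy "nat list" "sym option \<Rightarrow> bool"
  | Lt nat nat
  | Ct nat nat
  | Vl nat nat
  | Df "nat \<Rightarrow> sym \<Rightarrow> nat" "nat \<Rightarrow> bool"
  | Nt tst
  | An tst tst
  | Exi tst

datatype prg =
    PEmit "sym list"
  | PSeq prg prg
  | PIf tst prg prg
  | PFor prg

text \<open>Variables are de Bruijn levels: a binder in a context with d variables binds variable d.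
  Variable 0 always holds the number npos w of head positions.\<close>

primrec tsem :: "sym list \<Rightarrow> nat list \<Rightarrow> tst \<Rightarrow> bool" where
  "tsem w \<rho> (Sy us P) \<longleftrightarrow> P (read_in w (sum_list (map (\<lambda>u. \<rho> ! u) us)))"
| "tsem w \<rho> (Lt u v) \<longleftrightarrow> \<rho> ! u < \<rho> ! v"
| "tsem w \<rho> (Ct u v) \<longleftrightarrow> length (filter (\<lambda>i. read_in w i = Some TLab) [0..<\<rho> ! u]) = \<rho> ! v"
| "tsem w \<rho> (Vl u v) \<longleftrightarrow> satval (npos w) 0 (takeWhile is_bit (drop (\<rho> ! u) w)) = \<rho> ! v"
| "tsem w \<rho> (Df \<delta> acc) \<longleftrightarrow> acc (foldl \<delta> 0 w)"
| "tsem w \<rho> (Nt t) \<longleftrightarrow> \<not> tsem w \<rho> t"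
| "tsem w \<rho> (An t u) \<longleftrightarrow> tsem w \<rho> t \<and> tsem w \<rho> u"
| "tsem w \<rho> (Exi t) \<longleftrightarrow> (\<exists>v<npos w. tsem w (\<rho> @ [v]) t)"

primrec psem :: "sym list \<Rightarrow> nat list \<Rightarrow> prg \<Rightarrow> sym list" where
  "psem w \<rho> (PEmit xs) = xs"
| "psem w \<rho> (PSeq p q) = psem w \<rho> p @ psem w \<rho> q"
| "psem w \<rho> (PIf t p q) = (if tsem w \<rho> t then psem w \<rho> p else psem w \<rho> q)"
| "psem w \<rho> (PFor p) = concat (map (\<lambda>v. psem w (\<rho> @ [v]) p) [0..<npos w])"

primrec wft :: "nat \<Rightarrow> nat \<Rightarrow> tst \<Rightarrow> bool" where
  "wft mb d (Sy us P) \<longleftrightarrow> (\<forall>u\<in>set us. u < d)"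
| "wft mb d (Lt u v) \<longleftrightarrow> u < d \<and> v < d"
| "wft mb d (Ct u v) \<longleftrightarrow> u < d \<and> v < d"
| "wft mb d (Vl u v) \<longleftrightarrow> u < d \<and> v < d"
| "wft mb d (Df \<delta> acc) \<longleftrightarrow> (\<forall>m<mb. \<forall>s. \<delta> m s < mb)"
| "wft mb d (Nt t) \<longleftrightarrow> wft mb d t"
| "wft mb d (An t u) \<longleftrightarrow> wft mb d t \<and> wft mb d u"
| "wft mb d (Exi t) \<longleftrightarrow> wft mb (Suc d) t"

primrec wfprg :: "nat \<Rightarrow> nat \<Rightarrow> prg \<Rightarrow> bool" where
  "wfprg mb d (PEmit xs) \<longleftrightarrow> True"
| "wfprg mb d (PSeq p q) \<longleftrightarrow> wfprg mb d p \<and> wfprg mb d q"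
| "wfprg mb d (PIf t p q) \<longleftrightarrow> wft mb d t \<and> wfprg mb d p \<and> wfprg mb d q"
| "wfprg mb d (PFor p) \<longleftrightarrow> wfprg mb (Suc d) p"

text \<open>Registers 0 and 1 are scratch, register 2 is constantly 0, and variable i lives in
  register 3 + i.\<close>

definition Skip :: cmd where "Skip = Ctl (\<lambda>m _. m)"

text \<open>The unconditional first move leaves the right end marker, which reads
  \<open>None\<close> like the left one; at position 0 it has no effect.\<close>

definition rewind :: cmd where
  "rewind = Seq (Mv Lft) (While (\<lambda>_ a. a \<noteq> None) (Mv Lft))"

definition advance :: "nat \<Rightarrow> cmd" where
  "advance i = Seq (Add 0 2 2 False) (Seq (Cmp 0 i)
     (While (\<lambda>m _. m = 1) (Seq (Mv Rgt) (Seq (Add 0 0 2 True) (Cmp 0 i)))))"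

primrec advances :: "nat list \<Rightarrow> cmd" where
  "advances [] = Skip"
| "advances (u # us) = Seq (advance (3 + u)) (advances us)"

definition eqc :: "nat \<Rightarrow> nat \<Rightarrow> cmd" where
  "eqc i j = Seq (Cmp i j) (If (\<lambda>m _. m = 1) (Ctl (\<lambda>_ _. 0)) (Seq (Cmp j i) (Ctl (\<lambda>m _. 1 - m))))"

definition count_labs :: "nat \<Rightarrow> cmd" where
  "count_labs i = Seq rewind (Seq (Add 1 2 2 False) (Seq (Add 0 2 2 False) (Seq (Cmp 0 i)
     (While (\<lambda>m _. m = 1) (Seq (If (\<lambda>_ a. a = Some TLab) (Add 1 1 2 True) Skip)
        (Seq (Mv Rgt) (Seq (Add 0 0 2 True) (Cmp 0 i))))))))"

definition read_num :: cmd where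
  "read_num = Seq (Mv Rgt) (Seq (Add 1 2 2 False)
     (While (\<lambda>_ a. a = Some B0 \<or> a = Some B1) (Seq (Cmp 1 3)
        (Seq (If (\<lambda>m a. m = 1 \<and> a = Some B1) (Add 1 1 1 True) (If (\<lambda>m a. m = 1) (Add 1 1 1 False) Skip))
           (Mv Rgt)))))"

definition run_dfa :: "(nat \<Rightarrow> sym \<Rightarrow> nat) \<Rightarrow> cmd" where
  "run_dfa \<delta> = Seq rewind (Seq (Mv Rgt) (Seq (Ctl (\<lambda>_ _. 0))
     (While (\<lambda>_ a. a \<noteq> None) (Seq (Ctl (\<lambda>m a. case a of None \<Rightarrow> m | Some s \<Rightarrow> \<delta> m s)) (Mv Rgt)))))"

text \<open>In the search loop of \<open>Exi\<close>, memory 1 means that the search goes on, 2 that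
  a witness was found and 0 that the range is exhausted. This is why three memory values are
  required later.\<close>

primrec ct :: "nat \<Rightarrow> tst \<Rightarrow> cmd" where
  "ct d (Sy us P) = Seq rewind (Seq (advances us) (Ctl (\<lambda>_ a. of_bool (P a))))"
| "ct d (Lt u v) = Cmp (3 + u) (3 + v)"
| "ct d (Ct u v) = Seq (count_labs (3 + u)) (eqc 1 (3 + v))"
| "ct d (Vl u v) = Seq rewind (Seq (advance (3 + u)) (Seq read_num (eqc 1 (3 + v))))"
| "ct d (Df \<delta> acc) = Seq (run_dfa \<delta>) (Ctl (\<lambda>m _. of_bool (acc m)))"
| "ct d (Nt t) = Seq (ct d t) (Ctl (\<lambda>m _. 1 - m))"
| "ct d (An t u) = Seq (ct d t) (If (\<lambda>m _. m = 1) (ct d u) Skip)"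
| "ct d (Exi t) = Seq (Add (3 + d) 2 2 False) (Seq (Ctl (\<lambda>_ _. 1))
     (Seq (While (\<lambda>m _. m = 1) (Seq (ct (Suc d) t)
        (If (\<lambda>m _. m = 1) (Ctl (\<lambda>_ _. 2)) (Seq (Add (3 + d) (3 + d) 2 True) (Cmp (3 + d) 3)))))
      (Ctl (\<lambda>m _. of_bool (m = 2)))))"

primrec emits :: "sym list \<Rightarrow> cmd" where
  "emits [] = Skip"
| "emits (x # xs) = Seq (Emt x) (emits xs)"

primrec cp :: "nat \<Rightarrow> prg \<Rightarrow> cmd" where
  "cp d (PEmit xs) = emits xs"
| "cp d (PSeq p q) = Seq (cp d p) (cp d q)"
| "cp d (PIf t p q) = Seq (ct d t) (If (\<lambda>m _. m = 1) (cp d p) (cp d q))"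
| "cp d (PFor p) = Seq (Add (3 + d) 2 2 False) (Seq (Ctl (\<lambda>_ _. 1))
     (While (\<lambda>m _. m = 1) (Seq (cp (Suc d) p) (Seq (Add (3 + d) (3 + d) 2 True) (Cmp (3 + d) 3)))))"

section \<open>Correctness of the compilation\<close>

lemma exc_Skip: "exc w Skip (h, r, m, out) (h, r, m, out)"
  unfolding Skip_def by (rule bs.Ctl)

lemma exc_stop: "\<not> P m (read_in w h) \<Longrightarrow> s = (h, r, m, out) \<Longrightarrow> s' = (h, r, m, out) \<Longrightarrow> exc w (While P c) s s'"
  by (simp add: bs.WhF)

lemma exc_rewind: "h \<le> Suc (length w) \<Longrightarrow> exc w rewind (h, r, m, out) (0, r, m, out)"
proof -
  have loop: "h \<le> length w \<Longrightarrow> exc w (While (\<lambda>_ a. a \<noteq> None) (Mv Lft)) (h, r, m, out) (0, r, m, out)" for h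
  proof (induction h)
    case 0
    then show ?case by (intro bs.WhF) (simp add: read_in_def)
  next
    case (Suc h)
    have "exc w (Mv Lft) (Suc h, r, m, out) (h, r, m, out)"
      using bs.Mv[of w "4 * npos w" Lft "Suc h" r m out] Suc.prems by (simp add: move_def)
    then show ?case using Suc by (intro bs.WhT) (auto simp: read_in_def)
  qed
  assume "h \<le> Suc (length w)"
  then have "exc w (Mv Lft) (h, r, m, out) (h - 1, r, m, out)"
    using bs.Mv[of w "4 * npos w" Lft "h" r m out] by (simp add: move_def min_def split: if_splits)
  moreover have "exc w (While (\<lambda>_ a. a \<noteq> None) (Mv Lft)) (h - 1, r, m, out) (0, r, m, out)"
    using \<open>h \<le> Suc (length w)\<close> by (intro loop) auto
  ultimately show ?thesis unfolding rewind_def by (rule bs.Seq)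
qed

lemma exc_right: "exc w (Mv Rgt) (h, r, m, out) (min (Suc h) (Suc (length w)), r, m, out)"
  using bs.Mv[of w "4 * npos w" Rgt h r m out] by (simp add: move_def)

lemma exc_inc: "r 2 = 0 \<Longrightarrow> r i < npos w \<Longrightarrow> exc w (Add i i 2 True) (h, r, m, out) (h, r(i := Suc (r i)), m, out)"
  using bs.Add[where r = r and j = i and l = 2 and b = True and B = "4 * npos w" and w = w and i = i and h = h and m = m and out = out]
  by simp

lemma exc_zero: "r 2 = 0 \<Longrightarrow> exc w (Add i 2 2 False) (h, r, m, out) (h, r(i := 0), m, out)"
  using bs.Add[where r = r and j = 2 and l = 2 and b = False and B = "4 * npos w" and w = w and i = i and h = h and m = m and out = out]
  by simp

lemma exc_advance:
  assumes "r 2 = 0" "r i \<le> npos w" "i \<noteq> 0" "h \<le> Suc (length w)"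
  shows "exc w (advance i) (h, r, m, out) (min (h + r i) (Suc (length w)), r(0 := r i), 0, out)"
proof -
  let ?W = "While (\<lambda>m _. m = 1) (Seq (Mv Rgt) (Seq (Add 0 0 2 True) (Cmp 0 i)))"
  have loop: "s \<le> r i \<Longrightarrow> h \<le> Suc (length w) \<Longrightarrow> exc w ?W (h, r(0 := s), of_bool (s < r i), out)
      (min (h + (r i - s)) (Suc (length w)), r(0 := r i), 0, out)" for s h
  proof (induction "r i - s" arbitrary: s h)
    case 0
    then have "s = r i" by simp
    with 0 show ?case
      by (intro exc_stop[where m = 0 and h = h and r = "r(0 := r i)" and out = out]) (simp_all add: fun_eq_iff)
  next
    case (Suc n)
    then have s: "s < r i" by simp
    have 1: "exc w (Seq (Mv Rgt) (Seq (Add 0 0 2 True) (Cmp 0 i))) (h, r(0 := s), of_bool (s < r i), out)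
       (min (Suc h) (Suc (length w)), r(0 := Suc s), of_bool (Suc s < r i), out)"
    proof (intro bs.Seq)
      show "exc w (Mv Rgt) (h, r(0 := s), of_bool (s < r i), out) (min (Suc h) (Suc (length w)), r(0 := s), of_bool (s < r i), out)"
        by (rule exc_right)
      show "exc w (Add 0 0 2 True) (min (Suc h) (Suc (length w)), r(0 := s), of_bool (s < r i), out)
          (min (Suc h) (Suc (length w)), r(0 := Suc s), of_bool (s < r i), out)"
        using exc_inc[of "r(0 := s)" 0 w "min (Suc h) (Suc (length w))" "of_bool (s < r i)" out] assms s by simp
      show "exc w (Cmp 0 i) (min (Suc h) (Suc (length w)), r(0 := Suc s), of_bool (s < r i), out)
        (min (Suc h) (Suc (length w)), r(0 := Suc s), of_bool (Suc s < r i), out)"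
        using bs.Cmp[where i = 0 and j = i and r = "r(0 := Suc s)" and w = w and B = "4 * npos w"] assms by simp
    qed
    have "exc w ?W (min (Suc h) (Suc (length w)), r(0 := Suc s), of_bool (Suc s < r i), out)
      (min (min (Suc h) (Suc (length w)) + (r i - Suc s)) (Suc (length w)), r(0 := r i), 0, out)"
      by (rule Suc.hyps) (use Suc.hyps(2) s in simp_all)
    moreover have "min (min (Suc h) (Suc (length w)) + (r i - Suc s)) (Suc (length w)) = min (h + (r i - s)) (Suc (length w))"
      using s by auto
    ultimately show ?case using s by (intro bs.WhT[OF _ 1]) auto
  qed
  have 1: "exc w (Cmp 0 i) (h, r(0 := 0), m, out) (h, r(0 := 0), of_bool (0 < r i), out)"
    using bs.Cmp[where i = 0 and j = i and r = "r(0 := 0)" and w = w and B = "4 * npos w"] assms by simp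
  have 2: "exc w ?W (h, r(0 := 0), of_bool (0 < r i), out) (min (h + r i) (Suc (length w)), r(0 := r i), 0, out)"
    using loop[of 0 h] assms by simp
  show ?thesis unfolding advance_def
    by (rule bs.Seq[OF exc_zero[of r w 0 h m out] bs.Seq[OF 1 2]]) (rule assms)
qed

definition vars :: "sym list \<Rightarrow> nat list \<Rightarrow> (nat \<Rightarrow> nat) \<Rightarrow> bool" where
  "vars w \<rho> r \<longleftrightarrow> r 2 = 0 \<and> (\<forall>i<length \<rho>. r (3 + i) = \<rho> ! i \<and> \<rho> ! i \<le> npos w) \<and> \<rho> \<noteq> [] \<and> \<rho> ! 0 = npos w"

lemma vars_scratch: "vars w \<rho> r \<Longrightarrow> i < 2 \<Longrightarrow> vars w \<rho> (r(i := v))"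
  by (auto simp: vars_def)

lemma exc_advances:
  assumes "vars w \<rho> r" "\<forall>u\<in>set us. u < length \<rho>" "h \<le> Suc (length w)"
  shows "\<exists>r' m'. vars w \<rho> r' \<and> exc w (advances us) (h, r, m, out)
     (min (h + sum_list (map (\<lambda>u. \<rho> ! u) us)) (Suc (length w)), r', m', out)"
  using assms
proof (induction us arbitrary: h r m)
  case Nil
  then show ?case using exc_Skip[of w h r m out] by auto
next
  case (Cons u us)
  have r: "r 2 = 0" "r (3 + u) = \<rho> ! u" "r (3 + u) \<le> npos w" using Cons.prems by (auto simp: vars_def)
  let ?h = "min (h + \<rho> ! u) (Suc (length w))"
  have 1: "exc w (advance (3 + u)) (h, r, m, out) (?h, r(0 := \<rho> ! u), 0, out)"
    using exc_advance[of r "3 + u" w h m out] r Cons.prems by simp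
  have "vars w \<rho> (r(0 := \<rho> ! u))" using Cons.prems by (intro vars_scratch) auto
  moreover have "\<forall>u\<in>set us. u < length \<rho>" "?h \<le> Suc (length w)" using Cons.prems by auto
  ultimately obtain r' m' where 2: "vars w \<rho> r'"
    "exc w (advances us) (?h, r(0 := \<rho> ! u), 0, out)
       (min (?h + sum_list (map (\<lambda>u. \<rho> ! u) us)) (Suc (length w)), r', m', out)"
    using Cons.IH by blast
  have "min (?h + sum_list (map (\<lambda>u. \<rho> ! u) us)) (Suc (length w)) =
      min (h + sum_list (map (\<lambda>u. \<rho> ! u) (u # us))) (Suc (length w))" by auto
  then show ?case using bs.Seq[OF 1 2(2)] 2(1) by auto
qed

lemma exc_eqc: "exc w (eqc i j) (h, r, m, out) (h, r, of_bool (r i = r j), out)"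
proof -
  have 1: "exc w (Cmp i j) (h, r, m, out) (h, r, of_bool (r i < r j), out)" by (rule bs.Cmp)
  have "exc w (If (\<lambda>m _. m = 1) (Ctl (\<lambda>_ _. 0)) (Seq (Cmp j i) (Ctl (\<lambda>m _. 1 - m))))
     (h, r, of_bool (r i < r j), out) (h, r, of_bool (r i = r j), out)"
  proof (cases "r i < r j")
    case True
    then show ?thesis
      using bs.Ctl[of w "4 * npos w" "\<lambda>_ _. 0" h r 1 out] by (intro bs.IfT) auto
  next
    case False
    have "exc w (Ctl (\<lambda>m _. 1 - m)) (h, r, of_bool (r j < r i), out) (h, r, of_bool (r i = r j), out)"
      using bs.Ctl[of w "4 * npos w" "\<lambda>m _. 1 - m" h r "of_bool (r j < r i)" out] False
      by (cases "r j < r i") auto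
    then show ?thesis using False by (intro bs.IfF bs.Seq[OF bs.Cmp]) auto
  qed
  with 1 show ?thesis unfolding eqc_def by (rule bs.Seq)
qed

lemma exc_count_labs:
  assumes "r 2 = 0" "r i \<le> npos w" "2 < i" "h \<le> Suc (length w)"
  shows "\<exists>h' r'. h' \<le> Suc (length w) \<and> r' 1 = length (filter (\<lambda>i. read_in w i = Some TLab) [0..<r i]) \<and>
    (\<forall>j\<ge>2. r' j = r j) \<and> exc w (count_labs i) (h, r, m, out) (h', r', 0, out)"
proof -
  let ?c = "\<lambda>s. length (filter (\<lambda>i. read_in w i = Some TLab) [0..<s])"
  let ?B = "Seq (If (\<lambda>_ a. a = Some TLab) (Add 1 1 2 True) Skip) (Seq (Mv Rgt) (Seq (Add 0 0 2 True) (Cmp 0 i)))"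
  let ?W = "While (\<lambda>m _. m = 1) ?B"
  let ?h = "\<lambda>s. min s (Suc (length w))"
  let ?r = "\<lambda>s. r(1 := ?c s, 0 := s)"
  have cle: "?c s \<le> s" for s using length_filter_le[of _ "[0..<s]"] by simp
  have loop: "s \<le> r i \<Longrightarrow> exc w ?W (?h s, ?r s, of_bool (s < r i), out) (?h (r i), ?r (r i), 0, out)" for s
  proof (induction "r i - s" arbitrary: s)
    case 0
    then have "s = r i" by simp
    then show ?case
      by (intro exc_stop[where m = 0 and h = "?h s" and r = "?r s" and out = out]) (simp_all add: fun_eq_iff)
  next
    case (Suc n)
    then have s: "s < r i" by simp
    have hs: "?h s = s" using s assms(2) by simp
    have c: "?c (Suc s) = ?c s + of_bool (read_in w s = Some TLab)" by simp
    have 1: "exc w ?B (?h s, ?r s, of_bool (s < r i), out) (?h (Suc s), ?r (Suc s), of_bool (Suc s < r i), out)"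
    proof (intro bs.Seq)
      show "exc w (If (\<lambda>_ a. a = Some TLab) (Add 1 1 2 True) Skip) (?h s, ?r s, of_bool (s < r i), out)
          (s, r(1 := ?c (Suc s), 0 := s), of_bool (s < r i), out)"
      proof (cases "read_in w s = Some TLab")
        case True
        have "?c s < npos w" using cle[of s] s assms(2) by simp
        then have "exc w (Add 1 1 2 True) (s, ?r s, of_bool (s < r i), out)
           (s, (?r s)(1 := Suc (?c s)), of_bool (s < r i), out)"
          using exc_inc[of "?r s" 1 w s "of_bool (s < r i)" out] assms(1) by simp
        moreover have "(?r s)(1 := Suc (?c s)) = r(1 := ?c (Suc s), 0 := s)" using True by (auto simp: fun_upd_twist)
        ultimately show ?thesis using True hs by (intro bs.IfT) auto
      next
        case False
        then have "?r s = r(1 := ?c (Suc s), 0 := s)" by auto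
        then show ?thesis using False hs exc_Skip[of w s "?r s"] by (intro bs.IfF) auto
      qed
      show "exc w (Mv Rgt) (s, r(1 := ?c (Suc s), 0 := s), of_bool (s < r i), out)
         (?h (Suc s), r(1 := ?c (Suc s), 0 := s), of_bool (s < r i), out)" by (rule exc_right)
      show "exc w (Add 0 0 2 True) (?h (Suc s), r(1 := ?c (Suc s), 0 := s), of_bool (s < r i), out)
         (?h (Suc s), ?r (Suc s), of_bool (s < r i), out)"
        using exc_inc[of "r(1 := ?c (Suc s), 0 := s)" 0 w "?h (Suc s)" "of_bool (s < r i)" out] assms s by simp
      show "exc w (Cmp 0 i) (?h (Suc s), ?r (Suc s), of_bool (s < r i), out)
         (?h (Suc s), ?r (Suc s), of_bool (Suc s < r i), out)"
        using bs.Cmp[where i = 0 and j = i and r = "?r (Suc s)" and w = w and B = "4 * npos w"] assms by simp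
    qed
    have "exc w ?W (?h (Suc s), ?r (Suc s), of_bool (Suc s < r i), out) (?h (r i), ?r (r i), 0, out)"
      by (rule Suc.hyps) (use Suc.hyps(2) s in simp_all)
    then show ?case using s by (intro bs.WhT[OF _ 1]) auto
  qed
  have 1: "exc w (Cmp 0 i) (0, ?r 0, m, out) (0, ?r 0, of_bool (0 < r i), out)"
    using bs.Cmp[where i = 0 and j = i and r = "?r 0" and w = w and B = "4 * npos w"] assms by simp
  have 2: "exc w (Add 0 2 2 False) (0, r(1 := 0), m, out) (0, ?r 0, m, out)"
    using exc_zero[of "r(1 := 0)" w 0 0 m out] assms(1) by simp
  have 3: "exc w (Add 1 2 2 False) (0, r, m, out) (0, r(1 := 0), m, out)"
    using exc_zero[of r w 1 0 m out] assms(1) by simp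
  have 4: "exc w ?W (0, ?r 0, of_bool (0 < r i), out) (?h (r i), ?r (r i), 0, out)"
    using loop[of 0] by simp
  have "exc w (count_labs i) (h, r, m, out) (?h (r i), ?r (r i), 0, out)"
    unfolding count_labs_def by (rule bs.Seq[OF exc_rewind[OF assms(4)] bs.Seq[OF 3 bs.Seq[OF 2 bs.Seq[OF 1 4]]]])
  then show ?thesis by (intro exI[of _ "?h (r i)"] exI[of _ "?r (r i)"]) auto
qed

lemma satval_Cons: "satval b x (s # ss) = satval b (if x < b then x + x + of_bool (s = B1) else x) ss"
  by (simp add: satval_def)

lemma exc_read_num:
  assumes "r 2 = 0" "r 3 = npos w" "h \<le> Suc (length w)"
  shows "\<exists>h' r' m'. h' \<le> Suc (length w) \<and> r' 1 = satval (npos w) 0 (takeWhile is_bit (drop h w)) \<and>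
    (\<forall>j. j \<noteq> 1 \<longrightarrow> r' j = r j) \<and> exc w read_num (h, r, m, out) (h', r', m', out)"
proof -
  let ?B = "Seq (Cmp 1 3)
        (Seq (If (\<lambda>m a. m = 1 \<and> a = Some B1) (Add 1 1 1 True) (If (\<lambda>m a. m = 1) (Add 1 1 1 False) Skip))
           (Mv Rgt))"
  let ?P = "\<lambda>(_::nat) a. a = Some B0 \<or> a = Some B1"
  \<comment> \<open>Head position \<open>Suc h\<close> scans index \<open>h\<close>. The bound
    \<open>2 * npos w\<close> is kept because doubling happens only below \<open>npos w\<close>, and
    it lies within the budget \<open>4 * npos w\<close>.\<close>
  have loop: "h \<le> length w \<Longrightarrow> x < 2 * npos w \<Longrightarrow>
     \<exists>h' m'. h' \<le> Suc (length w) \<and> exc w (While ?P ?B) (Suc h, r(1 := x), m, out)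
       (h', r(1 := satval (npos w) x (takeWhile is_bit (drop h w))), m', out)" for h x m
  proof (induction "length w - h" arbitrary: h x m)
    case 0
    then have 1: "exc w (While ?P ?B) (Suc h, r(1 := x), m, out)
       (Suc h, r(1 := satval (npos w) x (takeWhile is_bit (drop h w))), m, out)"
      by (intro exc_stop[where m = m and h = "Suc h" and r = "r(1 := x)" and out = out])
        (simp_all add: read_in_def satval_def)
    show ?case by (rule exI, rule exI, rule conjI[OF _ 1]) (use 0 in simp)
  next
    case (Suc n)
    then have h: "h < length w" by simp
    have rd: "read_in w (Suc h) = Some (w ! h)" using h by (simp add: read_in_def)
    have dr: "drop h w = w ! h # drop (Suc h) w" using h by (rule Cons_nth_drop_Suc[symmetric])
    show ?case
    proof (cases "is_bit (w ! h)")
      case False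
      then have 1: "exc w (While ?P ?B) (Suc h, r(1 := x), m, out)
         (Suc h, r(1 := satval (npos w) x (takeWhile is_bit (drop h w))), m, out)"
        using rd dr by (intro exc_stop[where m = m and h = "Suc h" and r = "r(1 := x)" and out = out])
          (simp_all add: satval_def)
      show ?thesis by (rule exI, rule exI, rule conjI[OF _ 1]) (use h in simp)
    next
      case True
      define x' where "x' = (if x < npos w then x + x + of_bool (w ! h = B1) else x)"
      let ?m = "of_bool (x < npos w)"
      have x': "x' < 2 * npos w"
        using Suc.prems unfolding x'_def by (cases "w ! h = B1") auto
      have 1: "exc w (Cmp 1 3) (Suc h, r(1 := x), m, out) (Suc h, r(1 := x), ?m, out)"
        using bs.Cmp[where i = 1 and j = 3 and r = "r(1 := x)" and w = w and B = "4 * npos w"] assms by simp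
      have 2: "exc w (If (\<lambda>m a. m = 1 \<and> a = Some B1) (Add 1 1 1 True) (If (\<lambda>m a. m = 1) (Add 1 1 1 False) Skip))
          (Suc h, r(1 := x), ?m, out) (Suc h, r(1 := x'), ?m, out)"
      proof (cases "x < npos w \<and> w ! h = B1")
        case t: True
        then have "exc w (Add 1 1 1 True) (Suc h, r(1 := x), ?m, out) (Suc h, r(1 := x'), ?m, out)"
          using bs.Add[where r = "r(1 := x)" and j = 1 and l = 1 and b = True and B = "4 * npos w" and w = w and i = 1]
          by (simp add: x'_def)
        then show ?thesis using t rd by (intro bs.IfT) auto
      next
        case f: False
        have "exc w (If (\<lambda>m a. m = 1) (Add 1 1 1 False) Skip) (Suc h, r(1 := x), ?m, out) (Suc h, r(1 := x'), ?m, out)"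
        proof (cases "x < npos w")
          case t: True
          then have "exc w (Add 1 1 1 False) (Suc h, r(1 := x), ?m, out) (Suc h, r(1 := x'), ?m, out)"
            using bs.Add[where r = "r(1 := x)" and j = 1 and l = 1 and b = False and B = "4 * npos w" and w = w and i = 1] f
            by (simp add: x'_def)
          then show ?thesis using t by (intro bs.IfT) auto
        next
          case f: False
          then have "x' = x" by (simp add: x'_def)
          then show ?thesis using f by (simp only:) (rule bs.IfF[OF _ exc_Skip], simp)
        qed
        then show ?thesis by (rule bs.IfF[rotated]) (use f rd in auto)
      qed
      have 3: "exc w (Mv Rgt) (Suc h, r(1 := x'), ?m, out) (Suc (Suc h), r(1 := x'), ?m, out)"
        using exc_right[of w "Suc h" "r(1 := x')" ?m out] h by simp
      have body: "exc w ?B (Suc h, r(1 := x), m, out) (Suc (Suc h), r(1 := x'), ?m, out)"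
        by (rule bs.Seq[OF 1 bs.Seq[OF 2 3]])
      have *: "n = length w - Suc h" "Suc h \<le> length w" using Suc.hyps(2) h by auto
      obtain h' m' where h': "h' \<le> Suc (length w)" "exc w (While ?P ?B) (Suc (Suc h), r(1 := x'), ?m, out)
         (h', r(1 := satval (npos w) x' (takeWhile is_bit (drop (Suc h) w))), m', out)"
        using Suc.hyps(1)[OF * x'] by blast
      have "satval (npos w) x (takeWhile is_bit (drop h w)) = satval (npos w) x' (takeWhile is_bit (drop (Suc h) w))"
        using dr True by (simp add: satval_Cons x'_def)
      moreover have "?P m (read_in w (Suc h))" using rd True by simp
      ultimately have 4: "exc w (While ?P ?B) (Suc h, r(1 := x), m, out)
         (h', r(1 := satval (npos w) x (takeWhile is_bit (drop h w))), m', out)"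
        using bs.WhT[where P = ?P, OF _ body h'(2)] by (simp only:)
      show ?thesis by (rule exI, rule exI, rule conjI[OF h'(1) 4])
    qed
  qed
  let ?h = "min (Suc h) (Suc (length w))"
  let ?v = "satval (npos w) 0 (takeWhile is_bit (drop h w))"
  have 1: "exc w (Mv Rgt) (h, r, m, out) (?h, r, m, out)" by (rule exc_right)
  have 2: "exc w (Add 1 2 2 False) (?h, r, m, out) (?h, r(1 := 0), m, out)"
    by (rule exc_zero[of r]) (rule assms)
  have "drop (min h (length w)) w = drop h w" "?h = Suc (min h (length w))" by (auto simp: min_def)
  then obtain h' m' where 3: "h' \<le> Suc (length w)" "exc w (While ?P ?B) (?h, r(1 := 0), m, out) (h', r(1 := ?v), m', out)"
    using loop[of "min h (length w)" 0 m] by auto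
  have "exc w read_num (h, r, m, out) (h', r(1 := ?v), m', out)"
    unfolding read_num_def by (rule bs.Seq[OF 1 bs.Seq[OF 2 3(2)]])
  moreover have "(r(1 := ?v)) 1 = ?v" "\<forall>j. j \<noteq> 1 \<longrightarrow> (r(1 := ?v)) j = r j" by simp_all
  ultimately show ?thesis using 3(1) by blast
qed

lemma exc_run_dfa:
  assumes "h \<le> Suc (length w)"
  shows "\<exists>h'. h' \<le> Suc (length w) \<and> exc w (run_dfa \<delta>) (h, r, m, out) (h', r, foldl \<delta> 0 w, out)"
proof -
  let ?P = "\<lambda>(_::nat) (a::sym option). a \<noteq> None"
  let ?C = "Ctl (\<lambda>m a. case a of None \<Rightarrow> m | Some s \<Rightarrow> \<delta> m s)"
  let ?B = "Seq ?C (Mv Rgt)"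
  have loop: "h \<le> length w \<Longrightarrow>
     \<exists>h'. h' \<le> Suc (length w) \<and> exc w (While ?P ?B) (Suc h, r, q, out) (h', r, foldl \<delta> q (drop h w), out)" for h q
  proof (induction "length w - h" arbitrary: h q)
    case 0
    then have 1: "exc w (While ?P ?B) (Suc h, r, q, out) (Suc h, r, foldl \<delta> q (drop h w), out)"
      by (intro exc_stop[where m = q and h = "Suc h" and r = r and out = out]) (simp_all add: read_in_def)
    show ?case by (rule exI, rule conjI[OF _ 1]) (use 0 in simp)
  next
    case (Suc n)
    then have h: "h < length w" by simp
    have rd: "read_in w (Suc h) = Some (w ! h)" using h by (simp add: read_in_def)
    have dr: "drop h w = w ! h # drop (Suc h) w" using h by (rule Cons_nth_drop_Suc[symmetric])
    let ?q = "\<delta> q (w ! h)"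
    have "exc w ?C (Suc h, r, q, out) (Suc h, r, ?q, out)"
      using bs.Ctl[where w = w and h = "Suc h" and m = q and f = "\<lambda>m a. case a of None \<Rightarrow> m | Some s \<Rightarrow> \<delta> m s" and r = r and out = out and B = "4 * npos w"]
      rd by simp
    moreover have "exc w (Mv Rgt) (Suc h, r, ?q, out) (Suc (Suc h), r, ?q, out)"
      using exc_right[of w "Suc h" r ?q out] h by simp
    ultimately have body: "exc w ?B (Suc h, r, q, out) (Suc (Suc h), r, ?q, out)" by (rule bs.Seq)
    have *: "n = length w - Suc h" "Suc h \<le> length w" using Suc.hyps(2) h by auto
    obtain h' where h': "h' \<le> Suc (length w)" "exc w (While ?P ?B) (Suc (Suc h), r, ?q, out) (h', r, foldl \<delta> ?q (drop (Suc h) w), out)"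
      using Suc.hyps(1)[OF *] by blast
    have "?P q (read_in w (Suc h))" using rd by simp
    from bs.WhT[where P = ?P, OF this body h'(2)] h'(1) show ?case unfolding dr by auto
  qed
  have 1: "exc w (Mv Rgt) (0, r, m, out) (Suc 0, r, m, out)"
    using exc_right[of w 0 r m out] by simp
  have 2: "exc w (Ctl (\<lambda>_ _. 0)) (Suc 0, r, m, out) (Suc 0, r, 0, out)" by (rule bs.Ctl)
  obtain h' where 3: "h' \<le> Suc (length w)" "exc w (While ?P ?B) (Suc 0, r, 0, out) (h', r, foldl \<delta> 0 w, out)"
    using loop[of 0 0] by auto
  have "exc w (run_dfa \<delta>) (h, r, m, out) (h', r, foldl \<delta> 0 w, out)"
    unfolding run_dfa_def by (rule bs.Seq[OF exc_rewind[OF assms] bs.Seq[OF 1 bs.Seq[OF 2 3(2)]]])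
  with 3(1) show ?thesis by blast
qed

text \<open>A Hoare-style specification for every head position, every memory and every content of
  the scratch registers, so commands compose without regard to what ran before.\<close>

definition does :: "sym list \<Rightarrow> nat list \<Rightarrow> cmd \<Rightarrow> (nat \<Rightarrow> bool) \<Rightarrow> sym list \<Rightarrow> bool" where
  "does w \<rho> c P e \<longleftrightarrow> (\<forall>h r m out. h \<le> Suc (length w) \<longrightarrow> vars w \<rho> r \<longrightarrow>
     (\<exists>h' r' m'. h' \<le> Suc (length w) \<and> vars w \<rho> r' \<and> P m' \<and> exc w c (h, r, m, out) (h', r', m', out @ e)))"

lemma doesI:
  assumes "\<And>h r m out. h \<le> Suc (length w) \<Longrightarrow> vars w \<rho> r \<Longrightarrow>
     \<exists>h' r' m'. h' \<le> Suc (length w) \<and> vars w \<rho> r' \<and> P m' \<and> exc w c (h, r, m, out) (h', r', m', out @ e)"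
  shows "does w \<rho> c P e"
  using assms unfolding does_def by blast

lemma doesE:
  assumes "does w \<rho> c P e" "h \<le> Suc (length w)" "vars w \<rho> r"
  obtains h' r' m' where "h' \<le> Suc (length w)" "vars w \<rho> r'" "P m'" "exc w c (h, r, m, out) (h', r', m', out @ e)"
  using assms unfolding does_def by blast

lemma does_Seq:
  assumes "does w \<rho> c P e" "does w \<rho> d Q e'"
  shows "does w \<rho> (Seq c d) Q (e @ e')"
proof (rule doesI)
  fix h r m out assume a: "h \<le> Suc (length w)" "vars w \<rho> r"
  obtain h1 r1 m1 where 1: "h1 \<le> Suc (length w)" "vars w \<rho> r1" "exc w c (h, r, m, out) (h1, r1, m1, out @ e)"
    by (rule doesE[OF assms(1) a])
  obtain h2 r2 m2 where 2: "h2 \<le> Suc (length w)" "vars w \<rho> r2" "Q m2" "exc w d (h1, r1, m1, out @ e) (h2, r2, m2, (out @ e) @ e')"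
    by (rule doesE[OF assms(2) 1(1,2)])
  from bs.Seq[OF 1(3) 2(4)] 2 show "\<exists>h' r' m'. h' \<le> Suc (length w) \<and> vars w \<rho> r' \<and> Q m' \<and>
     exc w (Seq c d) (h, r, m, out) (h', r', m', out @ e @ e')" unfolding append_assoc by blast
qed

lemma does_If:
  assumes "does w \<rho> c (\<lambda>m. m = of_bool b) []" "b \<Longrightarrow> does w \<rho> d Q e" "\<not> b \<Longrightarrow> does w \<rho> d' Q e"
  shows "does w \<rho> (Seq c (If (\<lambda>m _. m = 1) d d')) Q e"
proof (rule doesI)
  fix h r m out assume a: "h \<le> Suc (length w)" "vars w \<rho> r"
  obtain h1 r1 m1 where 1: "h1 \<le> Suc (length w)" "vars w \<rho> r1" "m1 = of_bool b" "exc w c (h, r, m, out) (h1, r1, m1, out @ [])"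
    by (rule doesE[OF assms(1) a])
  have d: "does w \<rho> (if b then d else d') Q e" using assms(2,3) by simp
  obtain h2 r2 m2 where 2: "h2 \<le> Suc (length w)" "vars w \<rho> r2" "Q m2"
    "exc w (if b then d else d') (h1, r1, m1, out @ []) (h2, r2, m2, (out @ []) @ e)"
    by (rule doesE[OF d 1(1,2)])
  have "exc w (If (\<lambda>m _. m = 1) d d') (h1, r1, m1, out @ []) (h2, r2, m2, (out @ []) @ e)"
  proof (cases b)
    case True
    have "exc w d (h1, r1, m1, out @ []) (h2, r2, m2, (out @ []) @ e)" using 2(4) unfolding if_P[OF True] .
    then show ?thesis by (rule bs.IfT[rotated]) (simp add: 1(3) True)
  next
    case False
    have "exc w d' (h1, r1, m1, out @ []) (h2, r2, m2, (out @ []) @ e)" using 2(4) unfolding if_not_P[OF False] .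
    then show ?thesis by (rule bs.IfF[rotated]) (simp add: 1(3) False)
  qed
  from bs.Seq[OF 1(4) this] 2 show "\<exists>h' r' m'. h' \<le> Suc (length w) \<and> vars w \<rho> r' \<and> Q m' \<and>
     exc w (Seq c (If (\<lambda>m _. m = 1) d d')) (h, r, m, out) (h', r', m', out @ e)" unfolding append_Nil2 by blast
qed

lemma does_Ctl:
  assumes "does w \<rho> c P e" "\<And>m a. P m \<Longrightarrow> Q (f m a)"
  shows "does w \<rho> (Seq c (Ctl f)) Q e"
proof (rule doesI)
  fix h r m out assume a: "h \<le> Suc (length w)" "vars w \<rho> r"
  obtain h1 r1 m1 where 1: "h1 \<le> Suc (length w)" "vars w \<rho> r1" "P m1" "exc w c (h, r, m, out) (h1, r1, m1, out @ e)"
    by (rule doesE[OF assms(1) a])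
  from bs.Seq[OF 1(4) bs.Ctl[of _ _ f]] 1 assms(2) show "\<exists>h' r' m'. h' \<le> Suc (length w) \<and> vars w \<rho> r' \<and> Q m' \<and>
     exc w (Seq c (Ctl f)) (h, r, m, out) (h', r', m', out @ e)" by blast
qed

lemma vars_snoc: "vars w \<rho> r \<Longrightarrow> r (3 + length \<rho>) = v \<Longrightarrow> v \<le> npos w \<Longrightarrow> vars w (\<rho> @ [v]) r"
  by (auto simp: vars_def nth_append less_Suc_eq)

lemma vars_butlast: "vars w (\<rho> @ [v]) r \<Longrightarrow> \<rho> \<noteq> [] \<Longrightarrow> vars w \<rho> r \<and> r (3 + length \<rho>) = v"
  unfolding vars_def by (auto simp: nth_append less_Suc_eq)

lemma vars_upd: "vars w \<rho> r \<Longrightarrow> vars w \<rho> (r(3 + length \<rho> := v))"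
  by (auto simp: vars_def)

lemma exc_next:
  assumes "vars w (\<rho> @ [v]) r" "\<rho> \<noteq> []" "v < npos w"
  defines "d \<equiv> 3 + length \<rho>"
  shows "\<exists>r'. vars w \<rho> r' \<and> r' d = Suc v \<and>
    exc w (Seq (Add d d 2 True) (Cmp d 3)) (h, r, m, out) (h, r', of_bool (Suc v < npos w), out)"
proof -
  have i: "vars w \<rho> r" "r d = v" using vars_butlast[OF assms(1,2)] by (simp_all add: d_def)
  have r2: "r 2 = 0" and r3: "r 3 = npos w" using i assms(2) by (auto simp: vars_def)
  have 1: "exc w (Add d d 2 True) (h, r, m, out) (h, r(d := Suc v), m, out)"
    using exc_inc[of r d w h m out] r2 i assms(3) by simp
  have 2: "exc w (Cmp d 3) (h, r(d := Suc v), m, out) (h, r(d := Suc v), of_bool ((r(d := Suc v)) d < (r(d := Suc v)) 3), out)"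
    by (rule bs.Cmp)
  have 3: "(r(d := Suc v)) d = Suc v" "(r(d := Suc v)) 3 = npos w" using r3 assms(2) by (simp_all add: d_def)
  have "vars w \<rho> (r(d := Suc v))" unfolding d_def by (rule vars_upd) (rule i)
  with 3(1) bs.Seq[OF 1 2[unfolded 3]] show ?thesis by blast
qed

lemma does_test:
  "wft mb (length \<rho>) t \<Longrightarrow> \<rho> \<noteq> [] \<Longrightarrow> does w \<rho> (ct (length \<rho>) t) (\<lambda>m. m = of_bool (tsem w \<rho> t)) []"
proof (induction t arbitrary: \<rho>)
  case (Sy us P)
  show ?case
  proof (rule doesI)
    fix h r m out assume h: "h \<le> Suc (length w)" and i: "vars w \<rho> r"
    let ?s = "sum_list (map (\<lambda>u. \<rho> ! u) us)"
    have us: "\<forall>u\<in>set us. u < length \<rho>" using Sy by simp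
    obtain r' m' where 1: "vars w \<rho> r'" "exc w (advances us) (0, r, m, out) (min (0 + ?s) (Suc (length w)), r', m', out)"
      using exc_advances[OF i us, of 0] by blast
    \<comment> \<open>All positions from the right end marker on read \<open>None\<close>, so
      stopping the head there does not change the symbol read.\<close>
    have "read_in w (min (0 + ?s) (Suc (length w))) = read_in w ?s"
      by (cases "?s \<le> Suc (length w)") (simp_all add: read_in_def min_def del: sum_list_eq_0_iff)
    then have "exc w (Ctl (\<lambda>_ a. of_bool (P a))) (min (0 + ?s) (Suc (length w)), r', m', out)
        (min (0 + ?s) (Suc (length w)), r', of_bool (tsem w \<rho> (Sy us P)), out)"
      using bs.Ctl[of w "4 * npos w" "\<lambda>_ a. of_bool (P a)" "min (0 + ?s) (Suc (length w))" r' m' out] by (simp only: tsem.simps)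
    from bs.Seq[OF exc_rewind[OF h] bs.Seq[OF 1(2) this]]
    have 2: "exc w (ct (length \<rho>) (Sy us P)) (h, r, m, out)
        (min (0 + ?s) (Suc (length w)), r', of_bool (tsem w \<rho> (Sy us P)), out @ [])"
      unfolding ct.simps append_Nil2 .
    show "\<exists>h' r' m'. h' \<le> Suc (length w) \<and> vars w \<rho> r' \<and> m' = of_bool (tsem w \<rho> (Sy us P)) \<and>
       exc w (ct (length \<rho>) (Sy us P)) (h, r, m, out) (h', r', m', out @ [])"
      by (rule exI, rule exI, rule exI, rule conjI[OF _ conjI[OF 1(1) conjI[OF refl 2]]]) simp
  qed
next
  case (Lt u v)
  show ?case
  proof (rule doesI)
    fix h r m out assume h: "h \<le> Suc (length w)" and i: "vars w \<rho> r"
    have "r (3 + u) = \<rho> ! u" "r (3 + v) = \<rho> ! v" using i Lt by (auto simp: vars_def)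
    with bs.Cmp[of w "4 * npos w" "3 + u" "3 + v" h r m out]
    have "exc w (ct (length \<rho>) (Lt u v)) (h, r, m, out) (h, r, of_bool (tsem w \<rho> (Lt u v)), out @ [])"
      by (simp only: ct.simps tsem.simps append_Nil2)
    then show "\<exists>h' r' m'. h' \<le> Suc (length w) \<and> vars w \<rho> r' \<and> m' = of_bool (tsem w \<rho> (Lt u v)) \<and>
       exc w (ct (length \<rho>) (Lt u v)) (h, r, m, out) (h', r', m', out @ [])" using h i by blast
  qed
next
  case (Ct u v)
  show ?case
  proof (rule doesI)
    fix h r m out assume h: "h \<le> Suc (length w)" and i: "vars w \<rho> r"
    have r: "r 2 = 0" "r (3 + u) = \<rho> ! u" "r (3 + u) \<le> npos w" "r (3 + v) = \<rho> ! v" using i Ct by (auto simp: vars_def)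
    have three: "2 < 3 + u" by simp
    obtain h1 r1 where 1: "h1 \<le> Suc (length w)" "r1 1 = length (filter (\<lambda>i. read_in w i = Some TLab) [0..<r (3 + u)])"
      "\<forall>j\<ge>2. r1 j = r j" "exc w (count_labs (3 + u)) (h, r, m, out) (h1, r1, 0, out)"
      using exc_count_labs[OF r(1,3) three h, of m out] by blast
    have i1: "vars w \<rho> r1" using i 1(3) by (auto simp: vars_def)
    have "r1 1 = r1 (3 + v) \<longleftrightarrow> tsem w \<rho> (Ct u v)" using 1(2,3) r by simp
    with bs.Seq[OF 1(4) exc_eqc[of w 1 "3 + v"]]
    have "exc w (ct (length \<rho>) (Ct u v)) (h, r, m, out) (h1, r1, of_bool (tsem w \<rho> (Ct u v)), out @ [])"
      by (simp only: ct.simps append_Nil2)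
    then show "\<exists>h' r' m'. h' \<le> Suc (length w) \<and> vars w \<rho> r' \<and> m' = of_bool (tsem w \<rho> (Ct u v)) \<and>
       exc w (ct (length \<rho>) (Ct u v)) (h, r, m, out) (h', r', m', out @ [])" using 1(1) i1 by blast
  qed
next
  case (Vl u v)
  show ?case
  proof (rule doesI)
    fix h r m out assume h: "h \<le> Suc (length w)" and i: "vars w \<rho> r"
    have r: "r 2 = 0" "r (3 + u) = \<rho> ! u" "r (3 + u) \<le> npos w" "r (3 + v) = \<rho> ! v" using i Vl by (auto simp: vars_def)
    have r3: "r 3 = npos w" using i by (auto simp: vars_def)
    let ?h = "min (\<rho> ! u) (Suc (length w))"
    let ?r = "r(0 := \<rho> ! u)"
    have 1: "exc w (advance (3 + u)) (0, r, m, out) (?h, ?r, 0, out)"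
      using exc_advance[OF r(1,3), of 0 m out] r(2) by simp
    obtain h1 r1 m1 where 2: "h1 \<le> Suc (length w)" "r1 1 = satval (npos w) 0 (takeWhile is_bit (drop ?h w))"
      "\<forall>j. j \<noteq> 1 \<longrightarrow> r1 j = ?r j" "exc w read_num (?h, ?r, 0, out) (h1, r1, m1, out)"
      using exc_read_num[of ?r w ?h 0 out] r r3 by auto
    have i1: "vars w \<rho> r1" using i 2(3) by (auto simp: vars_def)
    have "drop ?h w = drop (\<rho> ! u) w" by (auto simp: min_def)
    then have "r1 1 = r1 (3 + v) \<longleftrightarrow> tsem w \<rho> (Vl u v)" using 2(2,3) r by simp
    with bs.Seq[OF exc_rewind[OF h] bs.Seq[OF 1 bs.Seq[OF 2(4) exc_eqc[of w 1 "3 + v"]]]]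
    have "exc w (ct (length \<rho>) (Vl u v)) (h, r, m, out) (h1, r1, of_bool (tsem w \<rho> (Vl u v)), out @ [])"
      by (simp only: ct.simps append_Nil2)
    then show "\<exists>h' r' m'. h' \<le> Suc (length w) \<and> vars w \<rho> r' \<and> m' = of_bool (tsem w \<rho> (Vl u v)) \<and>
       exc w (ct (length \<rho>) (Vl u v)) (h, r, m, out) (h', r', m', out @ [])" using 2(1) i1 by blast
  qed
next
  case (Df \<delta> acc)
  show ?case
  proof (rule doesI)
    fix h r m out assume h: "h \<le> Suc (length w)" and i: "vars w \<rho> r"
    obtain h1 where 1: "h1 \<le> Suc (length w)" "exc w (run_dfa \<delta>) (h, r, m, out) (h1, r, foldl \<delta> 0 w, out)"
      using exc_run_dfa[OF h] by blast
    from bs.Seq[OF 1(2) bs.Ctl[of _ _ "\<lambda>m _. of_bool (acc m)"]]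
    have "exc w (ct (length \<rho>) (Df \<delta> acc)) (h, r, m, out) (h1, r, of_bool (tsem w \<rho> (Df \<delta> acc)), out @ [])"
      by (simp only: ct.simps tsem.simps append_Nil2)
    then show "\<exists>h' r' m'. h' \<le> Suc (length w) \<and> vars w \<rho> r' \<and> m' = of_bool (tsem w \<rho> (Df \<delta> acc)) \<and>
       exc w (ct (length \<rho>) (Df \<delta> acc)) (h, r, m, out) (h', r', m', out @ [])" using 1(1) i by blast
  qed
next
  case (Nt t)
  then have "does w \<rho> (ct (length \<rho>) t) (\<lambda>m. m = of_bool (tsem w \<rho> t)) []" by simp
  then show ?case unfolding ct.simps by (rule does_Ctl) simp
next
  case (An t u)
  then have t: "does w \<rho> (ct (length \<rho>) t) (\<lambda>m. m = of_bool (tsem w \<rho> t)) []"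
    and u: "does w \<rho> (ct (length \<rho>) u) (\<lambda>m. m = of_bool (tsem w \<rho> u)) []" by simp_all
  show ?case
  proof (rule doesI)
    fix h r m out assume a: "h \<le> Suc (length w)" "vars w \<rho> r"
    obtain h1 r1 m1 where 1: "h1 \<le> Suc (length w)" "vars w \<rho> r1" "m1 = of_bool (tsem w \<rho> t)"
      "exc w (ct (length \<rho>) t) (h, r, m, out) (h1, r1, m1, out @ [])"
      by (rule doesE[OF t a])
    show "\<exists>h' r' m'. h' \<le> Suc (length w) \<and> vars w \<rho> r' \<and> m' = of_bool (tsem w \<rho> (An t u)) \<and>
       exc w (ct (length \<rho>) (An t u)) (h, r, m, out) (h', r', m', out @ [])"
    proof (cases "tsem w \<rho> t")
      case True
      obtain h2 r2 m2 where 2: "h2 \<le> Suc (length w)" "vars w \<rho> r2" "m2 = of_bool (tsem w \<rho> u)"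
        "exc w (ct (length \<rho>) u) (h1, r1, m1, out @ []) (h2, r2, m2, (out @ []) @ [])"
        by (rule doesE[OF u 1(1,2)])
      have "exc w (If (\<lambda>m _. m = 1) (ct (length \<rho>) u) Skip) (h1, r1, m1, out @ []) (h2, r2, m2, (out @ []) @ [])"
        by (rule bs.IfT[OF _ 2(4)]) (simp add: 1(3) True)
      from bs.Seq[OF 1(4) this] 2(1-3) True show ?thesis by (intro exI[of _ h2] exI[of _ r2] exI[of _ m2]) simp
    next
      case False
      have "exc w (If (\<lambda>m _. m = 1) (ct (length \<rho>) u) Skip) (h1, r1, m1, out @ []) (h1, r1, m1, out @ [])"
        by (rule bs.IfF[OF _ exc_Skip]) (simp add: 1(3) False)
      from bs.Seq[OF 1(4) this] 1 False show ?thesis by (intro exI[of _ h1] exI[of _ r1] exI[of _ m1]) simp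
    qed
  qed
next
  case (Exi t)
  let ?d = "3 + length \<rho>"
  let ?B = "Seq (ct (Suc (length \<rho>)) t)
        (If (\<lambda>m _. m = 1) (Ctl (\<lambda>_ _. 2)) (Seq (Add ?d ?d 2 True) (Cmp ?d 3)))"
  let ?W = "While (\<lambda>m _. m = 1) ?B"
  have t: "does w (\<rho> @ [v]) (ct (Suc (length \<rho>)) t) (\<lambda>m. m = of_bool (tsem w (\<rho> @ [v]) t)) []" for v
    using Exi.IH[of "\<rho> @ [v]"] Exi.prems by simp
  let ?R = "\<lambda>v. if \<exists>v'\<ge>v. v' < npos w \<and> tsem w (\<rho> @ [v']) t then 2 else 0 :: nat"
  have loop: "v \<le> npos w \<Longrightarrow> h \<le> Suc (length w) \<Longrightarrow> vars w \<rho> r \<Longrightarrow> r ?d = v \<Longrightarrow>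
     \<exists>h' r'. h' \<le> Suc (length w) \<and> vars w \<rho> r' \<and> exc w ?W (h, r, of_bool (v < npos w), out) (h', r', ?R v, out)" for v h r out
  proof (induction "npos w - v" arbitrary: v h r)
    case 0
    then have "exc w ?W (h, r, of_bool (v < npos w), out) (h, r, ?R v, out)"
      by (intro exc_stop[where m = 0 and h = h and r = r and out = out]) auto
    then show ?case using 0 by blast
  next
    case (Suc n)
    then have v: "v < npos w" by simp
    have i: "vars w (\<rho> @ [v]) r" using vars_snoc Suc.prems v by auto
    obtain h1 r1 m1 where 1: "h1 \<le> Suc (length w)" "vars w (\<rho> @ [v]) r1" "m1 = of_bool (tsem w (\<rho> @ [v]) t)"
      "exc w (ct (Suc (length \<rho>)) t) (h, r, of_bool (v < npos w), out) (h1, r1, m1, out @ [])"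
      by (rule doesE[OF t Suc.prems(2) i])
    have i1: "vars w \<rho> r1" using vars_butlast[OF 1(2) Exi.prems(2)] by simp
    have e1: "exc w (ct (Suc (length \<rho>)) t) (h, r, of_bool (v < npos w), out) (h1, r1, m1, out)"
      using 1(4) unfolding append_Nil2 .
    have start: "of_bool (v < npos w) = (1::nat)" using v by simp
    show ?case
    proof (cases "tsem w (\<rho> @ [v]) t")
      case True
      have "exc w (If (\<lambda>m _. m = 1) (Ctl (\<lambda>_ _. 2)) (Seq (Add ?d ?d 2 True) (Cmp ?d 3))) (h1, r1, m1, out) (h1, r1, 2, out)"
        by (rule bs.IfT[OF _ bs.Ctl]) (simp add: 1(3) True)
      from bs.Seq[OF e1 this] have b: "exc w ?B (h, r, of_bool (v < npos w), out) (h1, r1, 2, out)" .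
      have w: "exc w ?W (h1, r1, 2, out) (h1, r1, 2, out)"
        by (rule exc_stop[OF _ refl refl]) simp
      have "exc w ?W (h, r, of_bool (v < npos w), out) (h1, r1, 2, out)"
        by (rule bs.WhT[OF _ b w]) (use v in simp)
      moreover have "?R v = 2" using True v by auto
      ultimately show ?thesis using 1(1) i1 by (simp only:) blast
    next
      case False
      obtain r2 where 2: "vars w \<rho> r2" "r2 ?d = Suc v"
        "exc w (Seq (Add ?d ?d 2 True) (Cmp ?d 3)) (h1, r1, m1, out) (h1, r2, of_bool (Suc v < npos w), out)"
        using exc_next[OF 1(2) Exi.prems(2) v] by blast
      have "exc w (If (\<lambda>m _. m = 1) (Ctl (\<lambda>_ _. 2)) (Seq (Add ?d ?d 2 True) (Cmp ?d 3))) (h1, r1, m1, out)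
         (h1, r2, of_bool (Suc v < npos w), out)"
        by (rule bs.IfF[OF _ 2(3)]) (simp add: 1(3) False)
      from bs.Seq[OF e1 this] have b: "exc w ?B (h, r, of_bool (v < npos w), out) (h1, r2, of_bool (Suc v < npos w), out)" .
      have "n = npos w - Suc v" "Suc v \<le> npos w" using Suc.hyps(2) v by auto
      from Suc.hyps(1)[OF this 1(1) 2(1,2)] obtain h3 r3 where 3: "h3 \<le> Suc (length w)" "vars w \<rho> r3"
        "exc w ?W (h1, r2, of_bool (Suc v < npos w), out) (h3, r3, ?R (Suc v), out)" by blast
      have "exc w ?W (h, r, of_bool (v < npos w), out) (h3, r3, ?R (Suc v), out)"
        by (rule bs.WhT[OF _ b 3(3)]) (use v in simp)
      \<comment> \<open>The value \<open>v\<close> has just failed as a witness.\<close>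
      moreover have "?R (Suc v) = ?R v"
      proof -
        have "(\<exists>v'\<ge>Suc v. v' < npos w \<and> tsem w (\<rho> @ [v']) t) \<longleftrightarrow> (\<exists>v'\<ge>v. v' < npos w \<and> tsem w (\<rho> @ [v']) t)"
          using False by (metis Suc_le_eq le_eq_less_or_eq less_imp_le)
        then show ?thesis by (simp only:)
      qed
      ultimately show ?thesis using 3(1,2) by (simp only:) blast
    qed
  qed
  show ?case
  proof (rule doesI)
    fix h r m out assume h: "h \<le> Suc (length w)" and i: "vars w \<rho> r"
    let ?r = "r(?d := 0)"
    have r2: "r 2 = 0" using i by (simp add: vars_def)
    have 1: "exc w (Add ?d 2 2 False) (h, r, m, out) (h, ?r, m, out)" by (rule exc_zero) (rule r2)
    have 2: "exc w (Ctl (\<lambda>_ _. 1)) (h, ?r, m, out) (h, ?r, of_bool (0 < npos w), out)"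
      using bs.Ctl[of w "4 * npos w" "\<lambda>_ _. 1" h ?r m out] by simp
    obtain h3 r3 where 3: "h3 \<le> Suc (length w)" "vars w \<rho> r3"
      "exc w ?W (h, ?r, of_bool (0 < npos w), out) (h3, r3, ?R 0, out)"
      using loop[OF _ h vars_upd[OF i, of 0], of 0 out] by auto
    have "(?R 0 = 2) = tsem w \<rho> (Exi t)" by simp
    then have 4: "exc w (Ctl (\<lambda>m _. of_bool (m = 2))) (h3, r3, ?R 0, out) (h3, r3, of_bool (tsem w \<rho> (Exi t)), out)"
      using bs.Ctl[of w "4 * npos w" "\<lambda>m _. of_bool (m = 2)" h3 r3 "?R 0" out] by (simp only:)
    from bs.Seq[OF 1 bs.Seq[OF 2 bs.Seq[OF 3(3) 4]]]
    have "exc w (ct (length \<rho>) (Exi t)) (h, r, m, out) (h3, r3, of_bool (tsem w \<rho> (Exi t)), out @ [])"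
      unfolding ct.simps append_Nil2 .
    then show "\<exists>h' r' m'. h' \<le> Suc (length w) \<and> vars w \<rho> r' \<and> m' = of_bool (tsem w \<rho> (Exi t)) \<and>
       exc w (ct (length \<rho>) (Exi t)) (h, r, m, out) (h', r', m', out @ [])" using 3(1,2) by blast
  qed
qed

lemma exc_emits: "exc w (emits xs) (h, r, m, out) (h, r, m, out @ xs)"
proof (induction xs arbitrary: out)
  case Nil
  then show ?case using exc_Skip by simp
next
  case (Cons x xs)
  from bs.Seq[OF bs.Emt Cons] show ?case unfolding emits.simps append_assoc append_Cons append_Nil .
qed

lemma does_prg:
  "wfprg mb (length \<rho>) p \<Longrightarrow> \<rho> \<noteq> [] \<Longrightarrow> does w \<rho> (cp (length \<rho>) p) (\<lambda>_. True) (psem w \<rho> p)"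
proof (induction p arbitrary: \<rho>)
  case (PEmit xs)
  show ?case unfolding cp.simps psem.simps by (rule doesI) (use exc_emits in blast)
next
  case (PSeq p q)
  then show ?case by (auto intro: does_Seq)
next
  case (PIf t p q)
  then show ?case using does_test[of mb \<rho> t w] unfolding cp.simps by (intro does_If[where b = "tsem w \<rho> t"]) auto
next
  case (PFor p)
  let ?d = "3 + length \<rho>"
  let ?N = "Seq (Add ?d ?d 2 True) (Cmp ?d 3)"
  let ?B = "Seq (cp (Suc (length \<rho>)) p) ?N"
  let ?W = "While (\<lambda>m _. m = 1) ?B"
  let ?e = "\<lambda>v. psem w (\<rho> @ [v]) p"
  have p: "does w (\<rho> @ [v]) (cp (Suc (length \<rho>)) p) (\<lambda>_. True) (?e v)" for v
    using PFor.IH[of "\<rho> @ [v]"] PFor.prems by simp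
  have loop: "v \<le> npos w \<Longrightarrow> h \<le> Suc (length w) \<Longrightarrow> vars w \<rho> r \<Longrightarrow> r ?d = v \<Longrightarrow>
     \<exists>h' r'. h' \<le> Suc (length w) \<and> vars w \<rho> r' \<and>
       exc w ?W (h, r, of_bool (v < npos w), out) (h', r', 0, out @ concat (map ?e [v..<npos w]))" for v h r out
  proof (induction "npos w - v" arbitrary: v h r out)
    case 0
    then have "exc w ?W (h, r, of_bool (v < npos w), out) (h, r, 0, out @ concat (map ?e [v..<npos w]))"
      by (intro exc_stop[where m = 0 and h = h and r = r and out = out]) auto
    then show ?case using 0 by blast
  next
    case (Suc n)
    then have v: "v < npos w" by simp
    have i: "vars w (\<rho> @ [v]) r" using vars_snoc Suc.prems v by auto
    obtain h1 r1 m1 where 1: "h1 \<le> Suc (length w)" "vars w (\<rho> @ [v]) r1"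
      "exc w (cp (Suc (length \<rho>)) p) (h, r, of_bool (v < npos w), out) (h1, r1, m1, out @ ?e v)"
      by (rule doesE[OF p Suc.prems(2) i])
    obtain r2 where 2: "vars w \<rho> r2" "r2 ?d = Suc v"
      "exc w ?N (h1, r1, m1, out @ ?e v) (h1, r2, of_bool (Suc v < npos w), out @ ?e v)"
      using exc_next[OF 1(2) PFor.prems(2) v] by blast
    have b: "exc w ?B (h, r, of_bool (v < npos w), out) (h1, r2, of_bool (Suc v < npos w), out @ ?e v)"
      by (rule bs.Seq[OF 1(3) 2(3)])
    have "n = npos w - Suc v" "Suc v \<le> npos w" using Suc.hyps(2) v by auto
    from Suc.hyps(1)[OF this 1(1) 2(1,2)] obtain h3 r3 where 3: "h3 \<le> Suc (length w)" "vars w \<rho> r3"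
      "exc w ?W (h1, r2, of_bool (Suc v < npos w), out @ ?e v) (h3, r3, 0, (out @ ?e v) @ concat (map ?e [Suc v..<npos w]))" by blast
    have "exc w ?W (h, r, of_bool (v < npos w), out) (h3, r3, 0, (out @ ?e v) @ concat (map ?e [Suc v..<npos w]))"
      by (rule bs.WhT[OF _ b 3(3)]) (use v in simp)
    moreover have "(out @ ?e v) @ concat (map ?e [Suc v..<npos w]) = out @ concat (map ?e [v..<npos w])"
      using upt_conv_Cons[OF v] by simp
    ultimately show ?case using 3(1,2) by (simp only:) blast
  qed
  show ?case
  proof (rule doesI)
    fix h r m out assume h: "h \<le> Suc (length w)" and i: "vars w \<rho> r"
    let ?r = "r(?d := 0)"
    have r2: "r 2 = 0" using i by (simp add: vars_def)
    have 1: "exc w (Add ?d 2 2 False) (h, r, m, out) (h, ?r, m, out)" by (rule exc_zero) (rule r2)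
    have 2: "exc w (Ctl (\<lambda>_ _. 1)) (h, ?r, m, out) (h, ?r, of_bool (0 < npos w), out)"
      using bs.Ctl[of w "4 * npos w" "\<lambda>_ _. 1" h ?r m out] by simp
    obtain h3 r3 where 3: "h3 \<le> Suc (length w)" "vars w \<rho> r3"
      "exc w ?W (h, ?r, of_bool (0 < npos w), out) (h3, r3, 0, out @ concat (map ?e [0..<npos w]))"
      using loop[OF _ h vars_upd[OF i, of 0], of 0 out] by auto
    from bs.Seq[OF 1 bs.Seq[OF 2 3(3)]]
    have "exc w (cp (length \<rho>) (PFor p)) (h, r, m, out) (h3, r3, 0, out @ psem w \<rho> (PFor p))"
      unfolding cp.simps psem.simps .
    then show "\<exists>h' r' m'. h' \<le> Suc (length w) \<and> vars w \<rho> r' \<and> True \<and>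
       exc w (cp (length \<rho>) (PFor p)) (h, r, m, out) (h', r', m', out @ psem w \<rho> (PFor p))" using 3(1,2) by blast
  qed
qed

lemma wfc_mono: "wfc R mb c \<Longrightarrow> R \<le> R' \<Longrightarrow> wfc R' mb c"
  by (induction c) auto

lemma wfc_advances: "\<forall>u\<in>set us. u < d \<Longrightarrow> wfc (3 + d) mb (advances us)"
  by (induction us) (auto simp: advance_def Skip_def)

lemma wfc_ct: "wft mb d t \<Longrightarrow> 3 \<le> mb \<Longrightarrow> 0 < d \<Longrightarrow> \<exists>R. wfc R mb (ct d t)"
proof (induction t arbitrary: d)
  case (Sy us P)
  then show ?case by (intro exI[of _ "3 + d"]) (auto simp: rewind_def wfc_advances)
next
  case (Df \<delta> acc)
  then show ?case by (intro exI[of _ 3]) (auto simp: run_dfa_def rewind_def split: option.split)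
next
  case (An t u)
  then obtain R R' where "wfc R mb (ct d t)" "wfc R' mb (ct d u)" by fastforce
  then show ?case by (intro exI[of _ "max R R'"]) (auto simp: Skip_def intro: wfc_mono)
next
  case (Exi t)
  then obtain R where "wfc R mb (ct (Suc d) t)" by auto
  then show ?case using Exi.prems by (intro exI[of _ "max R (4 + d)"]) (auto intro: wfc_mono)
next
  case (Ct u v)
  then show ?case by (intro exI[of _ "3 + d"]) (auto simp: count_labs_def rewind_def eqc_def Skip_def)
next
  case (Vl u v)
  then show ?case by (intro exI[of _ "3 + d"]) (auto simp: read_num_def rewind_def advance_def eqc_def Skip_def)
next
  case (Lt u v)
  then show ?case by (intro exI[of _ "3 + d"]) auto
next
  case (Nt t)
  then obtain R where "wfc R mb (ct d t)" by auto
  then show ?case using Nt.prems by (intro exI[of _ R]) auto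
qed

lemma wfc_emits: "wfc R mb (emits xs)"
  by (induction xs) (auto simp: Skip_def)

lemma wfc_cp: "wfprg mb d p \<Longrightarrow> 3 \<le> mb \<Longrightarrow> 0 < d \<Longrightarrow> \<exists>R. wfc R mb (cp d p)"
proof (induction p arbitrary: d)
  case (PEmit xs)
  then show ?case using wfc_emits by auto
next
  case (PSeq p q)
  then obtain R R' where "wfc R mb (cp d p)" "wfc R' mb (cp d q)" by fastforce
  then show ?case by (intro exI[of _ "max R R'"]) (auto intro: wfc_mono)
next
  case (PIf t p q)
  then obtain R R' R'' where "wfc R mb (cp d p)" "wfc R' mb (cp d q)" "wfc R'' mb (ct d t)" using wfc_ct by auto metis
  then show ?case by (intro exI[of _ "max R (max R' R'')"]) (auto intro: wfc_mono)
next
  case (PFor p)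
  then obtain R where "wfc R mb (cp (Suc d) p)" by auto
  then show ?case using PFor.prems by (intro exI[of _ "max R (4 + d)"]) (auto intro: wfc_mono)
qed

text \<open>Register 3, that is variable 0, is first filled with the number of head positions: two
  increments for the end markers and one for each input symbol.\<close>

definition main_cmd :: "prg \<Rightarrow> cmd" where
  "main_cmd p = Seq (Seq (Add 3 3 2 True) (Seq (Add 3 3 2 True) (Seq (Mv Rgt)
     (While (\<lambda>_ a. a \<noteq> None) (Seq (Add 3 3 2 True) (Mv Rgt)))))) (cp 1 p)"

theorem logspace_prg:
  assumes "wfprg mb 1 p" "3 \<le> mb"
  shows "\<exists>M. logspace_computes M (\<lambda>w. psem w [npos w] p)"
proof -
  obtain R0 where "wfc R0 mb (cp 1 p)" using wfc_cp[OF assms] by auto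
  then have "wfc (R0 + 4) mb (cp 1 p)" by (rule wfc_mono) simp
  then have wf: "wfc (R0 + 4) mb (main_cmd p)" by (simp add: main_cmd_def)
  have run: "\<exists>h r m. exc w (main_cmd p) (0, (\<lambda>_. 0), 0, []) (h, r, m, psem w [npos w] p)" for w
  proof -
    let ?r = "\<lambda>v. (\<lambda>_. 0 :: nat)(3 := v)"
    let ?B = "Seq (Add 3 3 2 True) (Mv Rgt)"
    let ?P = "\<lambda>(_::nat) (a::sym option). a \<noteq> None"
    have inc: "v < npos w \<Longrightarrow> exc w (Add 3 3 2 True) (h, ?r v, 0, []) (h, ?r (Suc v), 0, [])" for v h
      using exc_inc[of "?r v" 3 w h 0 "[]"] by simp
    have loop: "h \<le> length w \<Longrightarrow> exc w (While ?P ?B) (Suc h, ?r (2 + h), 0, []) (Suc (length w), ?r (npos w), 0, [])" for h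
    proof (induction "length w - h" arbitrary: h)
      case 0
      then have "h = length w" by simp
      then show ?case by (intro exc_stop[where m = 0 and h = "Suc h" and r = "?r (2 + h)" and out = "[]"])
          (simp_all add: read_in_def fun_eq_iff)
    next
      case (Suc n)
      then have h: "h < length w" by simp
      have 1: "exc w (Add 3 3 2 True) (Suc h, ?r (2 + h), 0, []) (Suc h, ?r (2 + Suc h), 0, [])"
        using inc[of "2 + h"] h by simp
      have 2: "exc w (Mv Rgt) (Suc h, ?r (2 + Suc h), 0, []) (Suc (Suc h), ?r (2 + Suc h), 0, [])"
        using exc_right[of w "Suc h"] h by simp
      have "n = length w - Suc h" "Suc h \<le> length w" using Suc.hyps(2) h by auto
      note 3 = Suc.hyps(1)[OF this]
      show ?case by (rule bs.WhT[OF _ bs.Seq[OF 1 2] 3]) (use h in \<open>simp add: read_in_def\<close>)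
    qed
    have z: "?r 0 = (\<lambda>_. 0)" by auto
    have 1: "exc w (Add 3 3 2 True) (0, (\<lambda>_. 0), 0, []) (0, ?r 1, 0, [])"
      using inc[of 0 0] unfolding z by simp
    have 2: "exc w (Add 3 3 2 True) (0, ?r 1, 0, []) (0, ?r (2 + 0), 0, [])"
      using inc[of 1 0] by (simp add: numeral_2_eq_2)
    have 3: "exc w (Mv Rgt) (0, ?r (2 + 0), 0, []) (Suc 0, ?r (2 + 0), 0, [])"
      using exc_right[of w 0] by simp
    have i: "vars w [npos w] (?r (npos w))" by (simp add: vars_def)
    have "does w [npos w] (cp 1 p) (\<lambda>_. True) (psem w [npos w] p)"
      using does_prg[of mb "[npos w]" p w] assms by simp
    from doesE[OF this order.refl i] obtain h r m where
      4: "exc w (cp 1 p) (Suc (length w), ?r (npos w), 0, []) (h, r, m, [] @ psem w [npos w] p)" by blast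
    from bs.Seq[OF bs.Seq[OF 1 bs.Seq[OF 2 bs.Seq[OF 3 loop[of 0]]]] 4] show ?thesis
      unfolding main_cmd_def append_Nil by blast
  qed
  have "2 \<le> mb" using assms(2) by simp
  from logspace_cmd[OF wf this run] show ?thesis .
qed

section \<open>The formula\<close>

declare bin.simps [simp del]

definition shift :: "nat \<Rightarrow> trace \<Rightarrow> trace" where
  "shift k t = (\<lambda>n. t (n + k))"

lemma suffix_team_shift: "suffix_team k T = shift k ` T"
  by (simp add: suffix_team_def shift_def [abs_def])

lemma shift_apply [simp]: "shift k t n = t (n + k)"
  by (simp add: shift_def)

definition Top :: fml where "Top = Neg (Conj (Prop 0) (Neg (Prop 0)))"

definition bigC :: "fml list \<Rightarrow> fml" where "bigC xs = foldr Conj xs Top"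

text \<open>G is not in the fragment. Since \<open>Sim\<close> is Boolean complement, this is
  exactly G on teams, at the price of one level of temporal depth.\<close>

definition Always :: "fml \<Rightarrow> fml" where "Always \<phi> = Sim (Fut (Sim \<phi>))"

lemma tsat_Top [simp]: "tsat T Top"
  by (simp add: Top_def)

lemma tsat_bigC [simp]: "tsat T (bigC xs) \<longleftrightarrow> (\<forall>x\<in>set xs. tsat T x)"
  by (induction xs) (auto simp: bigC_def)

lemma tsat_Always [simp]: "tsat T (Always \<phi>) \<longleftrightarrow> (\<forall>k. tsat (shift k ` T) \<phi>)"
  by (simp add: Always_def suffix_team_shift)

text \<open>The binary numeral of this number is \<open>i + 2\<close> ones. The offset 2 is the
  smallest that keeps the values clear of the auxiliary propositions 0, 1 and 2.\<close>

definition sn :: "nat \<Rightarrow> nat" where "sn i = 2 ^ (i + 2) - 1"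

lemma sn_inj: "sn i = sn j \<longleftrightarrow> i = j"
proof
  assume a: "sn i = sn j"
  have "(2::nat) ^ (i + 2) \<ge> 1" "(2::nat) ^ (j + 2) \<ge> 1" by simp_all
  with a have "(2::nat) ^ (i + 2) = 2 ^ (j + 2)" unfolding sn_def by linarith
  then show "i = j" by simp
qed simp

lemma sn_ge: "3 \<le> sn i"
proof -
  have "(4::nat) \<le> 2 ^ (i + 2)" by simp
  then show ?thesis unfolding sn_def by linarith
qed

lemma sn_neq: "sn i \<noteq> 0" "sn i \<noteq> 1" "sn i \<noteq> 2" "sn i \<noteq> Suc 0" "0 \<noteq> sn i" "1 \<noteq> sn i" "2 \<noteq> sn i" "Suc 0 \<noteq> sn i"
  using sn_ge[of i] by linarith+

abbreviation sp :: "nat \<Rightarrow> fml" where "sp i \<equiv> Prop (sn i)"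

text \<open>Proposition 0 marks the path traces, proposition 1 the single marked position of a
  marker trace and proposition 2 all later positions of that marker trace; \<^term>\<open>sn i\<close> says that the
  current state is i.\<close>

definition frame :: "fml list" where
  "frame = [Neg (Conj (Prop 0) (Neg (Nxt (Prop 0)))), Neg (Conj (Prop 0) (Prop 1)),
     Neg (Conj (Prop 1) (Neg (Nxt (Prop 2)))), Neg (Conj (Prop 2) (Neg (Nxt (Prop 2)))),
     Neg (Conj (Prop 2) (Prop 1))]"

definition excl :: "nat \<Rightarrow> fml list" where
  "excl m = concat (map (\<lambda>i. concat (map (\<lambda>j. if i < j then [Neg (Conj (sp i) (sp j))] else []) [0..<m])) [0..<m])"

text \<open>\<open>Neg\<close> is universal over the traces of the team, so its Boolean complement
  asks for the existence of a trace.\<close>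

definition marks :: "nat \<Rightarrow> fml list" where
  "marks m = map (\<lambda>i. Sim (Neg (Conj (Prop 1) (sp i)))) [0..<m]"

definition constr :: "nat \<Rightarrow> fml" where
  "constr m = Always (bigC (frame @ excl m @ marks m))"

text \<open>A Boolean disjunction. \<open>Disj\<close> would split the team, so it is written with
  \<open>Sim\<close> and \<open>Conj\<close>; \<open>tsat_agree\<close> gives the intended
  reading.\<close>

definition agree :: "nat \<Rightarrow> fml" where
  "agree m = Sim (Conj (Sim (Neg (Prop 1)))
     (bigC (map (\<lambda>i. Sim (Conj (Sim (Neg (Conj (Prop 1) (sp i)))) (Neg (Conj (Prop 0) (Neg (sp i)))))) [0..<m])))"

text \<open>The outer splits discard marker traces only, so what remains is an arbitrary set S of them together
  with all path traces; the inner disjunction then keeps S and a nonempty set of path traces that, at every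
  position marked by S, are in a state which S carries there.\<close>

definition full :: "nat \<Rightarrow> fml" where
  "full m = Sim (Disj (Neg (Prop 0)) (Sim
     (Disj (Neg (Neg (Prop 0))) (Conj (Sim (Neg (Prop 0))) (Always (agree m))))))"

text \<open>For want of G: at no time are all edges refuted. In \<open>wrap\<close> the formula
  occurs only under \<open>Neg\<close>, hence is evaluated on single traces.\<close>

definition pathf :: "nat \<Rightarrow> (nat \<times> nat) list \<Rightarrow> fml" where
  "pathf r es = Conj (sp r) (Neg (Fut (bigC (map (\<lambda>(a, b). Neg (Conj (sp a) (Nxt (sp b)))) es))))"

text \<open>The final split is forced: one part contains only traces violating \<open>pathf\<close>,
  the other only traces satisfying it, so \<open>\<phi>\<close> is evaluated on exactly the
  latter.\<close>

definition wrap :: "nat \<Rightarrow> nat \<Rightarrow> (nat \<times> nat) list \<Rightarrow> fml \<Rightarrow> fml" where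
  "wrap m r es \<phi> = Conj (constr m) (Conj (full m)
     (Disj (Neg (pathf r es)) (Conj (Neg (Neg (pathf r es))) \<phi>)))"

primrec subst :: "(nat \<Rightarrow> fml) \<Rightarrow> fml \<Rightarrow> fml" where
  "subst f (Prop p) = f p"
| "subst f (Neg \<phi>) = Neg (subst f \<phi>)"
| "subst f (Conj \<phi> \<psi>) = Conj (subst f \<phi>) (subst f \<psi>)"
| "subst f (Disj \<phi> \<psi>) = Disj (subst f \<phi>) (subst f \<psi>)"
| "subst f (Nxt \<phi>) = Nxt (subst f \<phi>)"
| "subst f (Fut \<phi>) = Fut (subst f \<phi>)"
| "subst f (Glob \<phi>) = Glob (subst f \<phi>)"
| "subst f (Until \<phi> \<psi>) = Until (subst f \<phi>) (subst f \<psi>)"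
| "subst f (Rel \<phi> \<psi>) = Rel (subst f \<phi>) (subst f \<psi>)"
| "subst f (Sim \<phi>) = Sim (subst f \<phi>)"

text \<open>A proposition x of the given formula becomes: the current state is none of those without label x.\<close>

definition labf :: "nat \<Rightarrow> (nat \<Rightarrow> nat set) \<Rightarrow> nat \<Rightarrow> fml" where
  "labf m lab x = bigC (map (\<lambda>i. Neg (sp i)) (filter (\<lambda>i. x \<notin> lab i) [0..<m]))"

section \<open>Semantics: projecting traces over state propositions to traces over labels\<close>

definition visits :: "nat \<Rightarrow> trace \<Rightarrow> (nat \<Rightarrow> nat) \<Rightarrow> bool" where
  "visits m t \<pi> \<longleftrightarrow> (\<forall>k. \<pi> k < m \<and> (\<forall>i<m. sn i \<in> t k \<longleftrightarrow> i = \<pi> k))"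

definition proj :: "nat \<Rightarrow> (nat \<Rightarrow> nat set) \<Rightarrow> trace \<Rightarrow> trace" where
  "proj m lab t = (\<lambda>k. lab (THE i. i < m \<and> sn i \<in> t k))"

lemma proj_visits: "visits m t \<pi> \<Longrightarrow> proj m lab t = (\<lambda>k. lab (\<pi> k))"
proof
  fix k assume "visits m t \<pi>"
  then have "(THE i. i < m \<and> sn i \<in> t k) = \<pi> k" by (intro the_equality) (auto simp: visits_def)
  then show "proj m lab t k = lab (\<pi> k)" by (simp add: proj_def)
qed

lemma visits_shift: "visits m t \<pi> \<Longrightarrow> visits m (shift k t) (\<lambda>n. \<pi> (n + k))"
  by (simp add: visits_def)

lemma proj_shift: "proj m lab (shift k t) = shift k (proj m lab t)"
  by (rule ext) (simp add: proj_def)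

text \<open>\<open>labf\<close> merely excludes states and is therefore right only for traces that
  are in exactly one state at each time. This property passes to subteams and suffixes, so the
  induction can carry it.\<close>

lemma tsat_subst:
  assumes "\<forall>t\<in>T. \<exists>\<pi>. visits m t \<pi>"
  shows "tsat T (subst (labf m lab) \<phi>) \<longleftrightarrow> tsat (proj m lab ` T) \<phi>"
  using assms
proof (induction \<phi> arbitrary: T)
  case (Prop x)
  have "(\<forall>i\<in>{i. i < m \<and> x \<notin> lab i}. sn i \<notin> t 0) \<longleftrightarrow> x \<in> proj m lab t 0" if t: "t \<in> T" for t
  proof -
    obtain \<pi> where "visits m t \<pi>" using t Prop by blast
    then show ?thesis using proj_visits[of m t \<pi> lab] by (auto simp: visits_def)
  qed
  then show ?case by (auto simp: labf_def)
next
  case (Neg \<phi>)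
  have "tsat {t} (subst (labf m lab) \<phi>) \<longleftrightarrow> tsat {proj m lab t} \<phi>" if "t \<in> T" for t
    using Neg.IH[of "{t}"] Neg.prems that by simp
  then show ?case by simp
next
  case (Disj \<phi> \<psi>)
  let ?p = "proj m lab"
  show ?case
  proof
    assume "tsat T (subst (labf m lab) (Disj \<phi> \<psi>))"
    then obtain S U where "T = S \<union> U" "tsat S (subst (labf m lab) \<phi>)" "tsat U (subst (labf m lab) \<psi>)" by auto
    moreover from this have "?p ` T = ?p ` S \<union> ?p ` U" by blast
    ultimately show "tsat (?p ` T) (Disj \<phi> \<psi>)" using Disj by auto
  next
    assume "tsat (?p ` T) (Disj \<phi> \<psi>)"
    then obtain S U where SU: "?p ` T = S \<union> U" "tsat S \<phi>" "tsat U \<psi>" by auto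
    \<comment> \<open>Projection may identify traces, so the parts of the image are pulled back to
      full preimages in \<open>T\<close>.\<close>
    let ?S = "{t \<in> T. ?p t \<in> S}" let ?U = "{t \<in> T. ?p t \<in> U}"
    have "S \<subseteq> ?p ` T" "U \<subseteq> ?p ` T" using SU(1) by auto
    then have "?p ` ?S = S" "?p ` ?U = U" by auto
    moreover have "T = ?S \<union> ?U"
    proof
      show "T \<subseteq> ?S \<union> ?U" using SU(1) by auto
    qed auto
    moreover have "\<forall>t\<in>?S. \<exists>\<pi>. visits m t \<pi>" "\<forall>t\<in>?U. \<exists>\<pi>. visits m t \<pi>" using Disj.prems by auto
    ultimately have "tsat ?S (subst (labf m lab) \<phi>)" "tsat ?U (subst (labf m lab) \<psi>)"
      using Disj.IH SU by simp_all
    then show "tsat T (subst (labf m lab) (Disj \<phi> \<psi>))" using \<open>T = ?S \<union> ?U\<close>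
      unfolding subst.simps tsat.simps by blast
  qed
next
  case (Conj \<phi> \<psi>)
  then show ?case by simp
next
  case (Sim \<phi>)
  then show ?case by simp
next
  case (Nxt \<phi>)
  have "\<forall>t\<in>shift k ` T. \<exists>\<pi>. visits m t \<pi>" for k using Nxt.prems visits_shift by blast
  then show ?case using Nxt.IH by (simp add: suffix_team_shift image_image proj_shift)
next
  case (Fut \<phi>)
  have "\<forall>t\<in>shift k ` T. \<exists>\<pi>. visits m t \<pi>" for k using Fut.prems visits_shift by blast
  then show ?case using Fut.IH by (simp add: suffix_team_shift image_image proj_shift)
next
  case (Glob \<phi>)
  have "\<forall>t\<in>shift k ` T. \<exists>\<pi>. visits m t \<pi>" for k using Glob.prems visits_shift by blast
  then show ?case using Glob.IH by (simp add: suffix_team_shift image_image proj_shift)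
next
  case (Until \<phi> \<psi>)
  have "\<forall>t\<in>shift k ` T. \<exists>\<pi>. visits m t \<pi>" for k using Until.prems visits_shift by blast
  then show ?case using Until.IH by (simp add: suffix_team_shift image_image proj_shift)
next
  case (Rel \<phi> \<psi>)
  have "\<forall>t\<in>shift k ` T. \<exists>\<pi>. visits m t \<pi>" for k using Rel.prems visits_shift by blast
  then show ?case using Rel.IH by (simp add: suffix_team_shift image_image proj_shift)
qed

lemma in_excl: "x \<in> set (excl m) \<longleftrightarrow> (\<exists>i j. i < j \<and> j < m \<and> x = Neg (Conj (sp i) (sp j)))"
  by (auto simp: excl_def sn_inj split: if_splits)

lemma tsat_constr: "tsat T (constr m) \<longleftrightarrow>
   (\<forall>t\<in>T. \<forall>k. (0 \<in> t k \<longrightarrow> 0 \<in> t (Suc k)) \<and> \<not> (0 \<in> t k \<and> 1 \<in> t k) \<and> (1 \<in> t k \<longrightarrow> 2 \<in> t (Suc k)) \<and>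
      (2 \<in> t k \<longrightarrow> 2 \<in> t (Suc k)) \<and> \<not> (2 \<in> t k \<and> 1 \<in> t k)) \<and>
   (\<forall>t\<in>T. \<forall>k i j. i < j \<longrightarrow> j < m \<longrightarrow> \<not> (sn i \<in> t k \<and> sn j \<in> t k)) \<and>
   (\<forall>k. \<forall>i<m. \<exists>t\<in>T. 1 \<in> t k \<and> sn i \<in> t k)" (is "_ \<longleftrightarrow> ?A \<and> ?B \<and> ?C")
proof -
  have "(\<forall>k. \<forall>x\<in>set frame. tsat (shift k ` T) x) \<longleftrightarrow> ?A"
    unfolding frame_def by (auto simp: suffix_team_shift)
  moreover have "(\<forall>k. \<forall>x\<in>set (excl m). tsat (shift k ` T) x) \<longleftrightarrow> ?B"
  proof -
    have "(\<forall>k. \<forall>x\<in>set (excl m). tsat (shift k ` T) x) \<longleftrightarrow>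
        (\<forall>k i j. i < j \<longrightarrow> j < m \<longrightarrow> tsat (shift k ` T) (Neg (Conj (sp i) (sp j))))"
    proof (intro iffI allI impI ballI)
      fix k i j assume "\<forall>k. \<forall>x\<in>set (excl m). tsat (shift k ` T) x" "i < j" "j < m"
      then show "tsat (shift k ` T) (Neg (Conj (sp i) (sp j)))" using in_excl by blast
    next
      fix k x assume "\<forall>k i j. i < j \<longrightarrow> j < m \<longrightarrow> tsat (shift k ` T) (Neg (Conj (sp i) (sp j)))" "x \<in> set (excl m)"
      then show "tsat (shift k ` T) x" unfolding in_excl by blast
    qed
    also have "\<dots> \<longleftrightarrow> ?B" by auto
    finally show ?thesis .
  qed
  moreover have "(\<forall>k. \<forall>x\<in>set (marks m). tsat (shift k ` T) x) \<longleftrightarrow> ?C"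
    unfolding marks_def by auto
  moreover have "tsat T (constr m) \<longleftrightarrow> (\<forall>k. \<forall>x\<in>set frame. tsat (shift k ` T) x) \<and>
      (\<forall>k. \<forall>x\<in>set (excl m). tsat (shift k ` T) x) \<and> (\<forall>k. \<forall>x\<in>set (marks m). tsat (shift k ` T) x)"
    unfolding constr_def by auto
  ultimately show ?thesis by (simp only:)
qed

lemma tsat_agree: "tsat T (agree m) \<longleftrightarrow> (\<forall>t\<in>T. 1 \<notin> t 0) \<or>
    (\<exists>i<m. (\<exists>t\<in>T. 1 \<in> t 0 \<and> sn i \<in> t 0) \<and> (\<forall>t\<in>T. 0 \<in> t 0 \<longrightarrow> sn i \<in> t 0))"
  unfolding agree_def by auto

lemma tsat_pathf: "tsat {t} (pathf r es) \<longleftrightarrow>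
    sn r \<in> t 0 \<and> (\<forall>k. \<exists>(a, b)\<in>set es. sn a \<in> t k \<and> sn b \<in> t (Suc k))"
  unfolding pathf_def by (auto simp: suffix_team_shift split: prod.splits)

text \<open>The outer split may discard the markers that contradict \<open>\<sigma>\<close> at their
  mark. Every surviving marker then carries \<open>\<sigma>\<close>, and \<open>agree\<close> forces
  the path traces kept by the inner split, of which there is at least one, to follow it.\<close>

lemma full_realizes:
  assumes c: "tsat T (constr m)" and f: "tsat T (full m)" and \<sigma>: "\<And>k. \<sigma> k < m"
  shows "\<exists>u\<in>T. \<forall>k. sn (\<sigma> k) \<in> u k"
proof -
  note A = c[unfolded tsat_constr, THEN conjunct1, THEN bspec, THEN spec]
  have C1: "0 \<in> t (Suc k)" if "t \<in> T" "0 \<in> t k" for t k using A[OF that(1), of k] that(2) by simp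
  have C2: "1 \<notin> t k" if "t \<in> T" "0 \<in> t k" for t k using A[OF that(1), of k] that(2) by simp
  have C3: "2 \<in> t (Suc k)" if "t \<in> T" "1 \<in> t k \<or> 2 \<in> t k" for t k using A[OF that(1), of k] that(2) by auto
  have C4: "1 \<notin> t k" if "t \<in> T" "2 \<in> t k" for t k using A[OF that(1), of k] that(2) by simp
  have C5: "i = j" if "t \<in> T" "i < m" "j < m" "sn i \<in> t k" "sn j \<in> t k" for t k i j
    using c[unfolded tsat_constr, THEN conjunct2, THEN conjunct1] that by (metis linorder_neqE_nat)
  have C6: "\<exists>t\<in>T. 1 \<in> t k \<and> sn i \<in> t k" if "i < m" for k i
    using c[unfolded tsat_constr, THEN conjunct2, THEN conjunct2] that by blast
  define R0 where "R0 = {t \<in> T. 0 \<notin> t 0 \<and> (\<exists>k. 1 \<in> t k \<and> sn (\<sigma> k) \<notin> t k)}"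
  define Q where "Q = T - R0"
  have "T = R0 \<union> Q" "tsat R0 (Neg (Prop 0))" by (auto simp: R0_def Q_def)
  with f have "tsat Q (Disj (Neg (Neg (Prop 0))) (Conj (Sim (Neg (Prop 0))) (Always (agree m))))"
    unfolding full_def tsat.simps(4,10) by blast
  then obtain D R where DR: "Q = D \<union> R" "tsat D (Neg (Neg (Prop 0)))" "\<not> tsat R (Neg (Prop 0))"
    "\<And>k. tsat (shift k ` R) (agree m)" by auto
  obtain u where u: "u \<in> R" "0 \<in> u 0" using DR(3) by auto
  have D0: "0 \<in> t 0" if "t \<in> D" for t using DR(2) that by auto
  have QT: "Q \<subseteq> T" by (auto simp: Q_def)
  have dcont: "0 \<in> t k" if "t \<in> T" "0 \<in> t 0" for t k
    by (induction k) (use that C1 in blast)+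
  have acont: "2 \<in> t (Suc n + k)" if "t \<in> T" "1 \<in> t n" for t n k
    by (induction k) (use that C3 in auto)
  \<comment> \<open>After a mark proposition 2 holds forever, and it excludes proposition 1.\<close>
  have once: "n = n'" if t: "t \<in> T" and n: "1 \<in> t n" "1 \<in> t n'" for t n n'
  proof (rule ccontr)
    have *: False if "a < b" "1 \<in> t a" "1 \<in> t b" for a b
    proof -
      have "2 \<in> t b" using acont[OF t that(2), of "b - Suc a"] that(1) by simp
      then show False using C4[OF t] that(3) by blast
    qed
    assume "n \<noteq> n'"
    then show False using *[of n n'] *[of n' n] n by (cases "n < n'") auto
  qed
  have "sn (\<sigma> k) \<in> u k" for k
  proof -
    obtain t where t: "t \<in> T" "1 \<in> t k" "sn (\<sigma> k) \<in> t k" using C6[OF \<sigma>] by blast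
    have t0: "0 \<notin> t 0" using dcont[OF t(1)] C2[OF t(1)] t(2) by blast
    \<comment> \<open>The only mark of \<open>t\<close> is at \<open>k\<close>, where it meets
      \<open>\<sigma>\<close>, so \<open>t\<close> survives; it is not a path trace and hence cannot
      fall into \<open>D\<close>.\<close>
    have "t \<notin> R0" using once[OF t(1) t(2)] t(3) by (auto simp: R0_def)
    then have "t \<in> R" using t DR(1) D0 t0 by (auto simp: Q_def)
    then have ne: "\<not> (\<forall>t\<in>shift k ` R. 1 \<notin> t 0)" using t by auto
    obtain i where i: "i < m" "\<exists>s\<in>shift k ` R. 1 \<in> s 0 \<and> sn i \<in> s 0" "\<forall>s\<in>shift k ` R. 0 \<in> s 0 \<longrightarrow> sn i \<in> s 0"
      using DR(4)[of k] ne unfolding tsat_agree by blast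
    then obtain s where s: "s \<in> R" "1 \<in> s k" "sn i \<in> s k" by auto
    have sT: "s \<in> T" "s \<in> Q" using s DR(1) QT by auto
    have "0 \<notin> s 0" using dcont[OF sT(1)] C2[OF sT(1)] s(2) by blast
    \<comment> \<open>The state \<open>i\<close> named by \<open>agree\<close> is carried by a
      surviving marker, so it can only be \<open>\<sigma> k\<close>.\<close>
    then have "sn (\<sigma> k) \<in> s k" using sT s by (auto simp: Q_def R0_def)
    then have "i = \<sigma> k" using C5[OF sT(1) i(1) \<sigma> s(3)] by blast
    moreover have "0 \<in> u k" using dcont u DR(1) QT by blast
    ultimately show ?thesis using i(3) u(1) by auto
  qed
  then show ?thesis using u(1) DR(1) QT by blast
qed

text \<open>Stated for every team satisfying \<open>constr\<close> and \<open>full\<close>, so that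
  it serves both directions of the equivalence. A marker trace that happens to satisfy
  \<open>pathf\<close> also lies in \<open>U\<close>; this is harmless, as its projection is again a
  trace of \<open>K\<close>.\<close>

lemma path_traces:
  assumes K: "wf_kripke K" and es: "set es = set (kE K)"
    and c: "tsat T (constr (kn K))" and f: "tsat T (full (kn K))"
  defines "U \<equiv> {t \<in> T. tsat {t} (pathf (kr K) es)}"
  shows "\<forall>t\<in>U. \<exists>\<pi>. visits (kn K) t \<pi>"
    and "proj (kn K) (\<lambda>i. set (kL K ! i)) ` U = team_of K"
proof -
  let ?m = "kn K" let ?p = "proj (kn K) (\<lambda>i. set (kL K ! i))"
  have bound: "a < ?m \<and> b < ?m" if "(a, b) \<in> set es" for a b
    using K that es unfolding wf_kripke_def by auto
  have uniq: "i = j" if "t \<in> T" "i < ?m" "j < ?m" "sn i \<in> t k" "sn j \<in> t k" for t i j k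
    using c[unfolded tsat_constr, THEN conjunct2, THEN conjunct1] that by (metis linorder_neqE_nat)
  have fwd: "\<exists>\<pi>. visits ?m t \<pi> \<and> is_path K \<pi>" if t: "t \<in> U" for t
  proof -
    have tT: "t \<in> T" and p: "sn (kr K) \<in> t 0"
      "\<And>k. \<exists>(a, b)\<in>set es. sn a \<in> t k \<and> sn b \<in> t (Suc k)"
      using t by (auto simp: U_def tsat_pathf)
    define \<pi> where "\<pi> k = (SOME i. i < ?m \<and> sn i \<in> t k)" for k
    have \<pi>: "\<pi> k < ?m \<and> sn (\<pi> k) \<in> t k" for k
    proof -
      \<comment> \<open>The source of the edge taken at time \<open>k\<close> is such a
        state.\<close>
      have "\<exists>i. i < ?m \<and> sn i \<in> t k" using p(2)[of k] bound by blast
      then show ?thesis unfolding \<pi>_def by (rule someI_ex)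
    qed
    have \<pi>eq: "\<pi> k = i" if "i < ?m" "sn i \<in> t k" for i k
      using uniq[OF tT _ that(1) _ that(2)] \<pi> by blast
    have "visits ?m t \<pi>" unfolding visits_def using \<pi> \<pi>eq by blast
    moreover have "is_path K \<pi>" unfolding is_path_def
    proof (intro conjI allI)
      show "\<pi> 0 = kr K" using \<pi>eq p(1) K by (simp add: wf_kripke_def)
      fix k
      obtain a b where ab: "(a, b) \<in> set es" "sn a \<in> t k" "sn b \<in> t (Suc k)" using p(2)[of k] by blast
      then have "\<pi> k = a" "\<pi> (Suc k) = b" using \<pi>eq bound[OF ab(1)] by auto
      then show "(\<pi> k, \<pi> (Suc k)) \<in> set (kE K)" using ab(1) es by simp
    qed
    ultimately show ?thesis by blast
  qed
  then show "\<forall>t\<in>U. \<exists>\<pi>. visits ?m t \<pi>" by blast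
  show "?p ` U = team_of K"
  proof
    show "?p ` U \<subseteq> team_of K"
    proof
      fix s assume "s \<in> ?p ` U"
      then obtain t where t: "t \<in> U" "s = ?p t" by blast
      with fwd obtain \<pi> where "visits ?m t \<pi>" "is_path K \<pi>" by blast
      then show "s \<in> team_of K" using t proj_visits by (auto simp: team_of_def)
    qed
    show "team_of K \<subseteq> ?p ` U"
    proof
      fix s assume "s \<in> team_of K"
      then obtain \<pi> where \<pi>: "is_path K \<pi>" "s = (\<lambda>i. set (kL K ! \<pi> i))" by (auto simp: team_of_def)
      have lt: "\<pi> k < ?m" for k using \<pi>(1) bound es by (auto simp: is_path_def)
      obtain u where u: "u \<in> T" "\<And>k. sn (\<pi> k) \<in> u k" using full_realizes[OF c f, of \<pi>] lt by blast
      have "visits ?m u \<pi>" unfolding visits_def using lt u uniq[OF u(1)] by blast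
      moreover have "u \<in> U" using u \<pi>(1) es unfolding U_def tsat_pathf is_path_def
        by (auto intro!: bexI) (metis (mono_tags) case_prodI u(2))
      moreover have "s = ?p u" using proj_visits[OF \<open>visits ?m u \<pi>\<close>] \<pi>(2) by simp
      ultimately show "s \<in> ?p ` U" by blast
    qed
  qed
qed

section \<open>The intended model\<close>

definition trD :: "(nat \<Rightarrow> nat) \<Rightarrow> trace" where
  "trD \<sigma> k = {sn (\<sigma> k), 0}"

definition trM :: "(nat \<Rightarrow> nat) \<Rightarrow> nat \<Rightarrow> trace" where
  "trM \<sigma> n k = insert (sn (\<sigma> k)) (if k = n then {1} else if n < k then {2} else {})"

text \<open>All sequences of states occur, not only the paths: \<open>full\<close> demands them all,
  and the restriction to paths is left to \<open>wrap\<close>.\<close>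

definition model :: "nat \<Rightarrow> team" where
  "model m = {trD \<sigma> | \<sigma>. \<forall>k. \<sigma> k < m} \<union> {trM \<sigma> n | \<sigma> n. \<forall>k. \<sigma> k < m}"

lemma trD_simps [simp]: "0 \<in> trD \<sigma> k" "Suc 0 \<notin> trD \<sigma> k" "2 \<notin> trD \<sigma> k" "sn i \<in> trD \<sigma> k \<longleftrightarrow> i = \<sigma> k"
  by (auto simp: trD_def sn_neq sn_inj)

lemma trM_simps [simp]: "0 \<notin> trM \<sigma> n k" "Suc 0 \<in> trM \<sigma> n k \<longleftrightarrow> k = n" "2 \<in> trM \<sigma> n k \<longleftrightarrow> n < k"
    "sn i \<in> trM \<sigma> n k \<longleftrightarrow> i = \<sigma> k"
  by (auto simp: trM_def sn_neq sn_inj)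

lemma model_constr: "tsat (model m) (constr m)"
  unfolding tsat_constr
proof (intro conjI allI ballI impI)
  fix k i assume "i < m"
  then have "trM (\<lambda>_. i) k \<in> model m" by (auto simp: model_def)
  then show "\<exists>t\<in>model m. 1 \<in> t k \<and> sn i \<in> t k" by (intro bexI[of _ "trM (\<lambda>_. i) k"]) auto
qed (auto simp: model_def)

text \<open>Several states may be marked at one position among the surviving traces, but
  \<open>agree\<close> asks for one only. Choose one for each position and keep just the path trace
  that follows the choice.\<close>

lemma model_full:
  assumes "0 < m"
  shows "tsat (model m) (full m)"
proof -
  have "tsat Q (Disj (Neg (Neg (Prop 0))) (Conj (Sim (Neg (Prop 0))) (Always (agree m))))"
    if split: "model m = R0 \<union> Q" "tsat R0 (Neg (Prop 0))" for R0 Q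
  proof -
    \<comment> \<open>Where no surviving trace is marked, the value 0 is a state since
      \<open>0 < m\<close>.\<close>
    define \<sigma> where "\<sigma> k = (if \<exists>i<m. \<exists>t\<in>Q. 1 \<in> t k \<and> sn i \<in> t k
       then (SOME i. i < m \<and> (\<exists>t\<in>Q. 1 \<in> t k \<and> sn i \<in> t k)) else 0)" for k
    have \<sigma>: "\<sigma> k < m \<and> ((\<exists>i<m. \<exists>t\<in>Q. 1 \<in> t k \<and> sn i \<in> t k) \<longrightarrow> (\<exists>t\<in>Q. 1 \<in> t k \<and> sn (\<sigma> k) \<in> t k))" for k
    proof (cases "\<exists>i<m. \<exists>t\<in>Q. 1 \<in> t k \<and> sn i \<in> t k")
      case True
      then have "\<sigma> k = (SOME i. i < m \<and> (\<exists>t\<in>Q. 1 \<in> t k \<and> sn i \<in> t k))" by (simp add: \<sigma>_def)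
      with someI_ex[OF True] show ?thesis by simp
    next
      case False
      then have "\<sigma> k = 0" unfolding \<sigma>_def by (rule if_not_P)
      with assms have "\<sigma> k < m" by simp
      with False show ?thesis by blast
    qed
    let ?u = "trD \<sigma>"
    have "?u \<in> model m" using \<sigma> by (auto simp: model_def)
    moreover have "?u \<notin> R0" using split(2) by auto
    ultimately have u: "?u \<in> Q" using split(1) by blast
    \<comment> \<open>The two parts of a split may overlap: the chosen path trace lies in
      both.\<close>
    let ?D = "{t \<in> Q. 0 \<in> t 0}" let ?R = "insert ?u {t \<in> Q. 0 \<notin> t 0}"
    have "Q = ?D \<union> ?R" using u by auto
    moreover have "tsat ?D (Neg (Neg (Prop 0)))" by auto
    moreover have "tsat ?R (Sim (Neg (Prop 0)))" by auto
    moreover have "tsat (shift k ` ?R) (agree m)" for k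
    proof (cases "\<exists>t\<in>?R. 1 \<in> t k")
      case False
      then show ?thesis unfolding tsat_agree by auto
    next
      case True
      then obtain t where t: "t \<in> Q" "0 \<notin> t 0" "1 \<in> t k" by auto
      then have "t \<in> model m" using split by blast
      then obtain \<tau> n where "t = trM \<tau> n" "\<forall>k. \<tau> k < m" using t by (auto simp: model_def)
      then have "\<exists>i<m. \<exists>t\<in>Q. 1 \<in> t k \<and> sn i \<in> t k" using t by (auto intro!: exI[of _ "\<tau> k"] bexI[of _ t])
      then obtain s where s: "s \<in> Q" "1 \<in> s k" "sn (\<sigma> k) \<in> s k" using \<sigma> by blast
      have "s \<in> model m" using s split by blast
      then have "0 \<notin> s 0" using s by (auto simp: model_def)
      then have sR: "s \<in> ?R" using s by blast
      have other: "sn (\<sigma> k) \<in> t k" if "t \<in> ?R" "0 \<in> t k" for t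
      proof (cases "t = ?u")
        case False
        then have "t \<in> model m" "0 \<notin> t 0" using that split by auto
        then have False using that by (auto simp: model_def)
        then show ?thesis ..
      qed simp
      have "(\<exists>t\<in>shift k ` ?R. 1 \<in> t 0 \<and> sn (\<sigma> k) \<in> t 0)" using sR s by (intro bexI[of _ "shift k s"]) auto
      moreover have "\<forall>t\<in>shift k ` ?R. 0 \<in> t 0 \<longrightarrow> sn (\<sigma> k) \<in> t 0" using other by auto
      ultimately show ?thesis unfolding tsat_agree using \<sigma> by blast
    qed
    ultimately show ?thesis unfolding tsat.simps(3,4) tsat_Always by blast
  qed
  then show ?thesis unfolding full_def tsat.simps(4,10) by blast
qed

text \<open>Only the set of listed edges matters, because the program prints them in its own order
  and not in the order of \<open>kE K\<close>.\<close>

theorem wrap_satisfiable: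
  assumes K: "wf_kripke K" and es: "set es = set (kE K)"
  shows "(\<exists>T. tsat T (wrap (kn K) (kr K) es (subst (labf (kn K) (\<lambda>i. set (kL K ! i))) \<phi>))) \<longleftrightarrow> tsat (team_of K) \<phi>"
    (is "(\<exists>T. tsat T (wrap _ _ _ ?\<psi>)) \<longleftrightarrow> _")
proof
  let ?P = "pathf (kr K) es"
  assume "\<exists>T. tsat T (wrap (kn K) (kr K) es ?\<psi>)"
  then obtain T V U where T: "tsat T (constr (kn K))" "tsat T (full (kn K))" "T = V \<union> U"
    "tsat V (Neg ?P)" "tsat U (Neg (Neg ?P))" "tsat U ?\<psi>"
    unfolding wrap_def by auto
  then have U: "U = {t \<in> T. tsat {t} ?P}" by auto
  show "tsat (team_of K) \<phi>"
    using path_traces[OF K es T(1,2)] tsat_subst[of U] T(6) unfolding U[symmetric] by simp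
next
  let ?P = "pathf (kr K) es" let ?T = "model (kn K)"
  assume sat: "tsat (team_of K) \<phi>"
  have c: "tsat ?T (constr (kn K))" by (rule model_constr)
  have f: "tsat ?T (full (kn K))" using K by (intro model_full) (simp add: wf_kripke_def)
  let ?U = "{t \<in> ?T. tsat {t} ?P}" let ?V = "{t \<in> ?T. \<not> tsat {t} ?P}"
  have "tsat ?U ?\<psi>" using path_traces[OF K es c f] tsat_subst[of ?U] sat by simp
  moreover have "?T = ?V \<union> ?U" by blast
  moreover have "tsat ?V (Neg ?P)" "tsat ?U (Neg (Neg ?P))" by auto
  ultimately have "tsat ?T (Disj (Neg ?P) (Conj (Neg (Neg ?P)) ?\<psi>))"
    unfolding tsat.simps(3,4) by blast
  then show "\<exists>T. tsat T (wrap (kn K) (kr K) es ?\<psi>)"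
    unfolding wrap_def using c f by (auto intro!: exI[of _ ?T] simp del: tsat.simps(4))
qed

section \<open>Temporal depth, operators and numerals of the formula\<close>

lemma tdepth_bigC: "tdepth (bigC xs) \<le> n \<longleftrightarrow> (\<forall>x\<in>set xs. tdepth x \<le> n)"
  by (induction xs) (auto simp: bigC_def Top_def)

lemma only_FX_bigC: "only_FX (bigC xs) \<longleftrightarrow> (\<forall>x\<in>set xs. only_FX x)"
  by (induction xs) (auto simp: bigC_def Top_def)

lemma tdepth_subst_labf: "tdepth (subst (labf m lab) \<phi>) = tdepth \<phi>"
proof -
  have "tdepth (labf m lab x) \<le> 0" for x unfolding labf_def tdepth_bigC by auto
  then show ?thesis by (induction \<phi>) auto
qed

lemma only_FX_subst_labf: "only_FX (subst (labf m lab) \<phi>) = only_FX \<phi>"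
proof -
  have "only_FX (labf m lab x)" for x unfolding labf_def only_FX_bigC by auto
  then show ?thesis by (induction \<phi>) auto
qed

text \<open>Depth 2 comes from \<open>constr\<close> and \<open>pathf\<close>, where
  \<open>Nxt\<close> stands below \<open>Fut\<close>; \<open>full\<close> has depth 1. The
  substituted Boolean combinations add no depth, hence an equivalence.\<close>

lemma wrap_LTL_FX:
  assumes "2 \<le> k"
  shows "wrap m r es (subst (labf m lab) \<phi>) \<in> LTL_FX k \<longleftrightarrow> \<phi> \<in> LTL_FX k"
proof -
  have x: "x \<in> set (excl m) \<Longrightarrow> tdepth x \<le> n \<and> only_FX x" for x n by (auto simp: in_excl)
  have "tdepth (bigC (frame @ excl m @ marks m)) \<le> 1 \<and> only_FX (bigC (frame @ excl m @ marks m))"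
    unfolding tdepth_bigC only_FX_bigC using x by (auto simp: frame_def marks_def)
  then have c: "tdepth (constr m) \<le> 2 \<and> only_FX (constr m)" by (simp add: constr_def Always_def)
  have "tdepth (agree m) \<le> 0 \<and> only_FX (agree m)"
    unfolding agree_def by (auto simp: only_FX_bigC tdepth_bigC[where n = 0, simplified])
  then have f: "tdepth (full m) \<le> 2 \<and> only_FX (full m)" by (simp add: full_def Always_def)
  have "tdepth (bigC (map (\<lambda>(a, b). Neg (Conj (sp a) (Nxt (sp b)))) es)) \<le> 1 \<and>
      only_FX (bigC (map (\<lambda>(a, b). Neg (Conj (sp a) (Nxt (sp b)))) es))"
    unfolding tdepth_bigC only_FX_bigC by auto
  then have p: "tdepth (pathf r es) \<le> 2 \<and> only_FX (pathf r es)" by (simp add: pathf_def)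
  show ?thesis using c f p assms by (auto simp: LTL_FX_def wrap_def tdepth_subst_labf only_FX_subst_labf)
qed

lemma bin_sn: "bin (sn i) = replicate (i + 2) B1"
proof (induction i)
  case 0
  have "bin 1 = [B1]" by (subst bin.simps) simp
  moreover have "bin 3 = bin 1 @ [B1]" by (subst bin.simps) simp
  ultimately have "bin 3 = [B1, B1]" by simp
  moreover have "sn 0 = 3" by (simp add: sn_def)
  ultimately show ?case by (simp add: numeral_2_eq_2)
next
  case (Suc i)
  have p: "(2::nat) ^ (i + 2) \<ge> 1" by simp
  have "(2::nat) ^ (Suc i + 2) = 2 * 2 ^ (i + 2)" by simp
  then have s: "sn (Suc i) = 2 * sn i + 1" unfolding sn_def using p by linarith
  have "bin (sn (Suc i)) = bin (sn i) @ [B1]"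
    using sn_ge[of i] by (subst bin.simps) (simp add: s)
  then show ?case using Suc by (simp add: replicate_append_same)
qed

lemma enc_sp: "enc_fml (sp i) = TP # replicate (i + 2) B1 @ [Sep]"
  by (simp add: enc_nat_def bin_sn)

lemma enc_bigC: "enc_fml (bigC xs) = concat (map (\<lambda>x. TConj # enc_fml x) xs) @ enc_fml Top"
  by (induction xs) (simp_all add: bigC_def)

section \<open>Unique readability\<close>

lemma set_bin: "set (bin n) \<subseteq> {B0, B1}"
proof (induction n rule: less_induct)
  case (less n)
  then show ?case by (subst bin.simps) auto
qed

lemma bin_bits: "x \<in> set (bin n) \<Longrightarrow> is_bit x"
  using set_bin by blast

lemma bin_neq_Nil: "bin n \<noteq> []"
  by (subst bin.simps) auto

lemma bin_snoc: "1 \<le> n \<Longrightarrow> bin (2 * n + of_bool b) = bin n @ [if b then B1 else B0]"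
  by (subst bin.simps) auto

lemma bin_cases: obtains "n < 2" "bin n = [if n = 0 then B0 else B1]"
  | k b where "1 \<le> k" "n = 2 * k + of_bool b" "bin n = bin k @ [if b then B1 else B0]" "k < n"
proof (cases "n < 2")
  case True
  then have "bin n = [if n = 0 then B0 else B1]" by (subst bin.simps) simp
  with True show ?thesis by (rule that(1))
next
  case False
  then have d: "1 \<le> n div 2" "n div 2 < n" by auto
  have n: "n = 2 * (n div 2) + of_bool (odd n)" by (simp add: mult.commute flip: mod_2_eq_odd)
  have "bin n = bin (n div 2) @ [if odd n then B1 else B0]" using False by (subst bin.simps) simp
  from that(2)[OF d(1) n this d(2)] show ?thesis .
qed

text \<open>Saturation freezes only values that are at least \<open>b\<close>. The second half
  carries this through the induction and rules out that a large numeral is mistaken for a small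
  number.\<close>

lemma satval_bin:
  "(a < b \<longrightarrow> satval b 0 (bin a) = a) \<and> (b \<le> a \<longrightarrow> b \<le> satval b 0 (bin a))"
proof (induction a rule: less_induct)
  case (less a)
  show ?case
  proof (cases rule: bin_cases[of a])
    case 1
    then show ?thesis by (cases "a = 0") (auto simp: satval_def)
  next
    case (2 k e)
    then have "satval b 0 (bin a) = (if satval b 0 (bin k) < b then satval b 0 (bin k) + satval b 0 (bin k) + of_bool e else satval b 0 (bin k))"
      by (simp add: satval_def)
    then show ?thesis using less[OF 2(4)] 2(2) by (cases "k < b") auto
  qed
qed

lemma satval_bin_eq: "c < b \<Longrightarrow> satval b 0 (bin a) = c \<longleftrightarrow> a = c"
  using satval_bin[of a b] by (cases "a < b") auto

text \<open>\<open>satval\<close> with threshold \<open>Suc c\<close> acts as a decoder for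
  \<open>c\<close>.\<close>

lemma bin_inj: "bin a = bin c \<longleftrightarrow> a = c"
  using satval_bin_eq[of c "Suc c" a] satval_bin_eq[of c "Suc c" c] by auto

lemma ex_bin: "\<forall>x\<in>set bl. is_bit x \<Longrightarrow> \<exists>n\<ge>1. bin n = B1 # bl"
proof (induction bl rule: rev_induct)
  case Nil
  have "bin 1 = [B1]" by (subst bin.simps) simp
  then show ?case by auto
next
  case (snoc x bl)
  then obtain n where "1 \<le> n" "bin n = B1 # bl" by auto
  then show ?case using bin_snoc[of n "x = B1"] snoc.prems by (intro exI[of _ "2 * n + of_bool (x = B1)"]) auto
qed

lemma takeWhile_bin [simp]: "takeWhile is_bit (bin n @ Sep # ys) = bin n"
  using bin_bits by (subst takeWhile_append2) auto

lemma dropWhile_bin [simp]: "dropWhile is_bit (bin n @ Sep # ys) = Sep # ys"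
  using bin_bits by (subst dropWhile_append2) auto

lemma bin_Sep_eq: "bin p @ Sep # xs = bin q @ Sep # ys \<longleftrightarrow> p = q \<and> xs = ys"
proof
  assume a: "bin p @ Sep # xs = bin q @ Sep # ys"
  then have "bin p = bin q" using takeWhile_bin by metis
  with a show "p = q \<and> xs = ys" by (simp add: bin_inj)
qed simp

lemma enc_fml_prefix_free: "enc_fml \<phi> @ xs = enc_fml \<psi> @ ys \<Longrightarrow> \<phi> = \<psi> \<and> xs = ys"
proof (induction \<phi> arbitrary: \<psi> xs ys)
  case (Prop p)
  then show ?case by (cases \<psi>) (auto simp: enc_nat_def bin_Sep_eq)
next
  case (Neg \<phi>)
  from Neg.prems obtain a where \<psi>: "\<psi> = Neg a" by (cases \<psi>) auto
  then show ?case using Neg.IH[of xs a ys] Neg.prems by simp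
next
  case (Conj \<phi>1 \<phi>2)
  from Conj.prems obtain a b where \<psi>: "\<psi> = Conj a b" by (cases \<psi>) auto
  then show ?case using Conj.IH(1)[of "enc_fml \<phi>2 @ xs" a "enc_fml b @ ys"] Conj.IH(2)[of xs b ys] Conj.prems by simp
next
  case (Disj \<phi>1 \<phi>2)
  from Disj.prems obtain a b where \<psi>: "\<psi> = Disj a b" by (cases \<psi>) auto
  then show ?case using Disj.IH(1)[of "enc_fml \<phi>2 @ xs" a "enc_fml b @ ys"] Disj.IH(2)[of xs b ys] Disj.prems by simp
next
  case (Nxt \<phi>)
  from Nxt.prems obtain a where \<psi>: "\<psi> = Nxt a" by (cases \<psi>) auto
  then show ?case using Nxt.IH[of xs a ys] Nxt.prems by simp
next
  case (Fut \<phi>)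
  from Fut.prems obtain a where \<psi>: "\<psi> = Fut a" by (cases \<psi>) auto
  then show ?case using Fut.IH[of xs a ys] Fut.prems by simp
next
  case (Glob \<phi>)
  from Glob.prems obtain a where \<psi>: "\<psi> = Glob a" by (cases \<psi>) auto
  then show ?case using Glob.IH[of xs a ys] Glob.prems by simp
next
  case (Until \<phi>1 \<phi>2)
  from Until.prems obtain a b where \<psi>: "\<psi> = Until a b" by (cases \<psi>) auto
  then show ?case using Until.IH(1)[of "enc_fml \<phi>2 @ xs" a "enc_fml b @ ys"] Until.IH(2)[of xs b ys] Until.prems by simp
next
  case (Rel \<phi>1 \<phi>2)
  from Rel.prems obtain a b where \<psi>: "\<psi> = Rel a b" by (cases \<psi>) auto
  then show ?case using Rel.IH(1)[of "enc_fml \<phi>2 @ xs" a "enc_fml b @ ys"] Rel.IH(2)[of xs b ys] Rel.prems by simp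
next
  case (Sim \<phi>)
  from Sim.prems obtain a where \<psi>: "\<psi> = Sim a" by (cases \<psi>) auto
  then show ?case using Sim.IH[of xs a ys] Sim.prems by simp
qed

lemma enc_fml_neq_Nil [simp]: "enc_fml \<phi> \<noteq> []"
  by (cases \<phi>) auto

section \<open>Token sequences and parsing\<close>

abbreviation ops :: "sym list" where
  "ops \<equiv> [TNeg, TConj, TDisj, TNxt, TFut, TGlob, TUntil, TRel, TSim]"

datatype tok = Op sym | Var nat

primrec tok_ok :: "tok \<Rightarrow> bool" where
  "tok_ok (Op s) \<longleftrightarrow> s \<in> set ops"
| "tok_ok (Var x) \<longleftrightarrow> True"

primrec enc_tok :: "tok \<Rightarrow> sym list" where
  "enc_tok (Op s) = [s]"
| "enc_tok (Var x) = TP # enc_nat x"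

definition enc_toks :: "tok list \<Rightarrow> sym list" where
  "enc_toks ts = concat (map enc_tok ts)"

lemma enc_toks_simps [simp]: "enc_toks [] = []" "enc_toks (t # ts) = enc_tok t @ enc_toks ts"
  "enc_toks (ts @ us) = enc_toks ts @ enc_toks us"
  by (simp_all add: enc_toks_def)

primrec ftoks :: "fml \<Rightarrow> tok list" where
  "ftoks (Prop p) = [Var p]"
| "ftoks (Neg \<phi>) = Op TNeg # ftoks \<phi>"
| "ftoks (Conj \<phi> \<psi>) = Op TConj # ftoks \<phi> @ ftoks \<psi>"
| "ftoks (Disj \<phi> \<psi>) = Op TDisj # ftoks \<phi> @ ftoks \<psi>"
| "ftoks (Nxt \<phi>) = Op TNxt # ftoks \<phi>"
| "ftoks (Fut \<phi>) = Op TFut # ftoks \<phi>"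
| "ftoks (Glob \<phi>) = Op TGlob # ftoks \<phi>"
| "ftoks (Until \<phi> \<psi>) = Op TUntil # ftoks \<phi> @ ftoks \<psi>"
| "ftoks (Rel \<phi> \<psi>) = Op TRel # ftoks \<phi> @ ftoks \<psi>"
| "ftoks (Sim \<phi>) = Op TSim # ftoks \<phi>"

lemma enc_ftoks: "enc_toks (ftoks \<phi>) = enc_fml \<phi>"
  by (induction \<phi>) auto

lemma ftoks_ok: "\<forall>t\<in>set (ftoks \<phi>). tok_ok t"
  by (induction \<phi>) auto

text \<open>In prefix notation, reading from the left either completes a formula or runs out of
  arguments, and then further formulas complete it. The summand \<open>ftoks \<psi>\<close>
  guarantees that something nonempty is still missing.\<close>

lemma parse_toks:
  assumes "\<forall>t\<in>set ts. tok_ok t"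
  shows "(\<exists>\<phi> rest. ts = ftoks \<phi> @ rest) \<or> (\<exists>\<phi> \<psi> us. ts @ ftoks \<psi> @ us = ftoks \<phi>)"
  using assms
proof (induction "length ts" arbitrary: ts rule: less_induct)
  case less
  show ?case
  proof (cases ts)
    case Nil
    then have "ts @ ftoks (Prop 0) @ [] = ftoks (Prop 0)" by simp
    then show ?thesis by blast
  next
    case (Cons t ts')
    show ?thesis
    proof (cases t)
      case (Var x)
      then have "ts = ftoks (Prop x) @ ts'" using Cons by simp
      then show ?thesis by blast
    next
      case (Op s)
      have IH1: "(\<exists>\<phi> rest. ts' = ftoks \<phi> @ rest) \<or> (\<exists>\<phi> \<psi> us. ts' @ ftoks \<psi> @ us = ftoks \<phi>)"
        using less.hyps[of ts'] less.prems Cons by simp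
      have un: ?thesis if "\<And>\<phi>. ftoks (f \<phi>) = Op s # ftoks \<phi>" for f
        using IH1
      proof (elim disjE exE)
        fix \<phi> rest assume "ts' = ftoks \<phi> @ rest"
        then have "ts = ftoks (f \<phi>) @ rest" using Cons Op that by simp
        then show ?thesis by blast
      next
        fix \<phi> \<psi> us assume "ts' @ ftoks \<psi> @ us = ftoks \<phi>"
        then have "ts @ ftoks \<psi> @ us = ftoks (f \<phi>)" using Cons Op that by simp
        then show ?thesis by blast
      qed
      have bi: ?thesis if f: "\<And>\<phi> \<psi>. ftoks (f \<phi> \<psi>) = Op s # ftoks \<phi> @ ftoks \<psi>" for f
        using IH1
      proof (elim disjE exE)
        fix \<phi> rest assume r: "ts' = ftoks \<phi> @ rest"
        have "(\<exists>\<phi> rest'. rest = ftoks \<phi> @ rest') \<or> (\<exists>\<phi> \<psi> us. rest @ ftoks \<psi> @ us = ftoks \<phi>)"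
          using less.hyps[of rest] less.prems Cons r by simp
        then show ?thesis
        proof (elim disjE exE)
          fix \<phi>' rest' assume "rest = ftoks \<phi>' @ rest'"
          then have "ts = ftoks (f \<phi> \<phi>') @ rest'" using Cons Op f r by simp
          then show ?thesis by blast
        next
          fix \<phi>' \<psi> us assume "rest @ ftoks \<psi> @ us = ftoks \<phi>'"
          then have "ts @ ftoks \<psi> @ us = ftoks (f \<phi> \<phi>')" using Cons Op f r by simp
          then show ?thesis by blast
        qed
      next
        fix \<phi> \<psi> us assume "ts' @ ftoks \<psi> @ us = ftoks \<phi>"
        \<comment> \<open>The second argument, not yet begun, is supplied by a dummy
          proposition.\<close>
        then have "ts @ ftoks \<psi> @ (us @ ftoks (Prop 0)) = ftoks (f \<phi> (Prop 0))" using Cons Op f by simp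
        then show ?thesis by blast
      qed
      have "s \<in> set ops" using less.prems Cons Op by simp
      then consider "s = TNeg" | "s = TConj" | "s = TDisj" | "s = TNxt" | "s = TFut" | "s = TGlob" | "s = TUntil"
        | "s = TRel" | "s = TSim" by auto
      then show ?thesis
      proof cases
        case 1 then show ?thesis using un[of Neg] by simp
      next
        case 2 then show ?thesis using bi[of Conj] by simp
      next
        case 3 then show ?thesis using bi[of Disj] by simp
      next
        case 4 then show ?thesis using un[of Nxt] by simp
      next
        case 5 then show ?thesis using un[of Fut] by simp
      next
        case 6 then show ?thesis using un[of Glob] by simp
      next
        case 7 then show ?thesis using bi[of Until] by simp
      next
        case 8 then show ?thesis using bi[of Rel] by simp
      next
        case 9 then show ?thesis using un[of Sim] by simp
      qed
    qed
  qed
qed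

primrec subst_tok :: "(nat \<Rightarrow> fml) \<Rightarrow> tok \<Rightarrow> sym list" where
  "subst_tok g (Op s) = [s]"
| "subst_tok g (Var x) = enc_fml (g x)"

definition subst_toks :: "(nat \<Rightarrow> fml) \<Rightarrow> tok list \<Rightarrow> sym list" where
  "subst_toks g ts = concat (map (subst_tok g) ts)"

lemma subst_toks_append: "subst_toks g (ts @ us) = subst_toks g ts @ subst_toks g us"
  by (simp add: subst_toks_def)

lemma subst_ftoks: "subst_toks g (ftoks \<phi>) = enc_fml (subst g \<phi>)"
  by (induction \<phi>) (auto simp: subst_toks_def)

lemma subst_toks_Nil: "subst_toks g ts = [] \<longleftrightarrow> ts = []"
proof -
  have "subst_tok g t \<noteq> []" for t by (cases t) auto
  then show ?thesis by (auto simp: subst_toks_def)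
qed

text \<open>Since encodings are prefix-free, a formula encoding neither continues after a formula
  nor is a proper prefix of one. The parse is made on the tokens before substitution, where each
  proposition is still a single token.\<close>

lemma subst_toks_is_fml:
  assumes "\<forall>t\<in>set ts. tok_ok t" "subst_toks g ts = enc_fml \<chi>"
  shows "\<exists>\<phi>. ts = ftoks \<phi> \<and> \<chi> = subst g \<phi>"
proof -
  from parse_toks[OF assms(1)] consider \<phi> rest where "ts = ftoks \<phi> @ rest"
    | \<phi> \<psi> us where "ts @ ftoks \<psi> @ us = ftoks \<phi>" by blast
  then show ?thesis
  proof cases
    case 1
    then have "enc_fml (subst g \<phi>) @ subst_toks g rest = enc_fml \<chi> @ []"
      using assms(2) by (simp add: subst_toks_append subst_ftoks)
    then show ?thesis using enc_fml_prefix_free 1 subst_toks_Nil by (metis append_Nil2)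
  next
    case 2
    then have "subst_toks g (ts @ ftoks \<psi> @ us) = enc_fml (subst g \<phi>)" by (simp add: subst_ftoks)
    then have "enc_fml \<chi> @ (enc_fml (subst g \<psi>) @ subst_toks g us) = enc_fml (subst g \<phi>) @ []"
      using assms(2) by (simp add: subst_toks_append subst_ftoks)
    then have "enc_fml (subst g \<psi>) @ subst_toks g us = []" using enc_fml_prefix_free by blast
    then show ?thesis by simp
  qed
qed

text \<open>In prefix notation the substituted formula is the last argument, so the output is this
  word followed by whatever is copied from the input.\<close>

definition wrap_prefix :: "nat \<Rightarrow> nat \<Rightarrow> (nat \<times> nat) list \<Rightarrow> sym list" where
  "wrap_prefix m r es = TConj # enc_fml (constr m) @ TConj # enc_fml (full m) @
     TDisj # enc_fml (Neg (pathf r es)) @ TConj # enc_fml (Neg (Neg (pathf r es)))"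

lemma enc_wrap: "enc_fml (wrap m r es \<phi>) = wrap_prefix m r es @ enc_fml \<phi>"
  by (simp add: wrap_def wrap_prefix_def)

lemma wrap_prefix_eq:
  assumes "wrap_prefix m r es @ xs = enc_fml \<chi>"
  shows "\<exists>\<psi>. \<chi> = wrap m r es \<psi> \<and> xs = enc_fml \<psi>"
proof -
  let ?c = "constr m" let ?f = "full m" let ?n = "Neg (pathf r es)"
  have 0: "TConj # enc_fml ?c @ TConj # enc_fml ?f @ TDisj # enc_fml ?n @ TConj # enc_fml (Neg ?n) @ xs = enc_fml \<chi>"
    using assms by (simp add: wrap_prefix_def)
  obtain a b where \<chi>: "\<chi> = Conj a b" using 0 by (cases \<chi>) auto
  have 1: "a = ?c" "enc_fml b = TConj # enc_fml ?f @ TDisj # enc_fml ?n @ TConj # enc_fml (Neg ?n) @ xs"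
    using enc_fml_prefix_free[of ?c "TConj # enc_fml ?f @ TDisj # enc_fml ?n @ TConj # enc_fml (Neg ?n) @ xs" a "enc_fml b"] 0 \<chi>
    by auto
  obtain a' b' where b: "b = Conj a' b'" using 1(2) by (cases b) auto
  have 2: "a' = ?f" "enc_fml b' = TDisj # enc_fml ?n @ TConj # enc_fml (Neg ?n) @ xs"
    using enc_fml_prefix_free[of ?f "TDisj # enc_fml ?n @ TConj # enc_fml (Neg ?n) @ xs" a' "enc_fml b'"] 1 b
    by auto
  obtain a'' b'' where b': "b' = Disj a'' b''" using 2(2) by (cases b') auto
  have 3: "a'' = ?n" "enc_fml b'' = TConj # enc_fml (Neg ?n) @ xs"
    using enc_fml_prefix_free[of ?n "TConj # enc_fml (Neg ?n) @ xs" a'' "enc_fml b''"] 2 b'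
    by auto
  obtain a3 b3 where b'': "b'' = Conj a3 b3" using 3(2) by (cases b'') auto
  have 4: "a3 = Neg ?n" "enc_fml b3 = xs"
    using enc_fml_prefix_free[of "Neg ?n" xs a3 "enc_fml b3"] 3 b'' by auto
  show ?thesis using \<chi> b b' b'' 1 2 3 4 by (intro exI[of _ b3]) (simp add: wrap_def)
qed

section \<open>The automaton for well-formed inputs\<close>

text \<open>Numerals are read alike everywhere; the context remembers what comes after the
  separator: state count, the two ends of an edge, label entry, root, proposition. A numeral
  starting with 0 has its own state because \<open>bin\<close> produces no leading zeros.\<close>

datatype ctx = CK | CA | CB | CL | CR | CP
datatype dst = Start | Num0 ctx | NumZ ctx | NumN ctx | SE | SL | SH | SF | Dead

definition after :: "ctx \<Rightarrow> dst" where
  "after c = (case c of CK \<Rightarrow> SE | CA \<Rightarrow> Num0 CB | CB \<Rightarrow> SE | CL \<Rightarrow> SL | CR \<Rightarrow> SH | CP \<Rightarrow> SF)"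

definition dd :: "dst \<Rightarrow> sym \<Rightarrow> dst" where
  "dd q s = (case q of
     Start \<Rightarrow> if s = TState then Num0 CK else Dead
   | Num0 c \<Rightarrow> if s = B0 then NumZ c else if s = B1 then NumN c else Dead
   | NumZ c \<Rightarrow> if s = Sep then after c else Dead
   | NumN c \<Rightarrow> if is_bit s then NumN c else if s = Sep then after c else Dead
   | SE \<Rightarrow> if s = TEdge then Num0 CA else if s = TLab then SL else if s = TRoot then Num0 CR else Dead
   | SL \<Rightarrow> if s = B0 then NumZ CL else if s = B1 then NumN CL else if s = TLab then SL
           else if s = TRoot then Num0 CR else Dead
   | SH \<Rightarrow> if s = THash then SF else Dead
   | SF \<Rightarrow> if s = TP then Num0 CP else if s \<in> set ops then SF else Dead
   | Dead \<Rightarrow> Dead)"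

lemma dd_simps:
  "dd Start s = (if s = TState then Num0 CK else Dead)"
  "dd (Num0 c) s = (if s = B0 then NumZ c else if s = B1 then NumN c else Dead)"
  "dd (NumZ c) s = (if s = Sep then after c else Dead)"
  "dd (NumN c) s = (if is_bit s then NumN c else if s = Sep then after c else Dead)"
  "dd SE s = (if s = TEdge then Num0 CA else if s = TLab then SL else if s = TRoot then Num0 CR else Dead)"
  "dd SL s = (if s = B0 then NumZ CL else if s = B1 then NumN CL else if s = TLab then SL
     else if s = TRoot then Num0 CR else Dead)"
  "dd SH s = (if s = THash then SF else Dead)"
  "dd SF s = (if s = TP then Num0 CP else if s \<in> set ops then SF else Dead)"
  "dd Dead s = Dead"
  by (simp_all add: dd_def)

lemma finite_dst: "finite (UNIV :: dst set)"
proof -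
  have "c \<in> {CK, CA, CB, CL, CR, CP}" for c by (cases c) auto
  then have "(UNIV :: ctx set) \<subseteq> {CK, CA, CB, CL, CR, CP}" by blast
  then have c: "finite (UNIV :: ctx set)" by (rule finite_subset) simp
  have "q \<in> {Start, SE, SL, SH, SF, Dead} \<union> range Num0 \<union> range NumZ \<union> range NumN" for q
    by (cases q) auto
  then have "(UNIV :: dst set) \<subseteq> {Start, SE, SL, SH, SF, Dead} \<union> range Num0 \<union> range NumZ \<union> range NumN"
    by blast
  then show ?thesis by (rule finite_subset) (simp add: c)
qed

abbreviation runs :: "dst \<Rightarrow> sym list \<Rightarrow> bool" where "runs q xs \<equiv> foldl dd q xs = SF"

lemma runs_Dead: "\<not> runs Dead xs"
  by (induction xs) (auto simp: dd_simps)

lemma runs_NumN_bits: "\<forall>x\<in>set bl. is_bit x \<Longrightarrow> foldl dd (NumN c) (bl @ xs) = foldl dd (NumN c) xs"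
  by (induction bl) (auto simp: dd_simps)

lemma foldl_enc_nat: "foldl dd (Num0 c) (enc_nat n @ xs) = foldl dd (after c) xs"
proof (cases rule: bin_cases[of n])
  case 1
  then show ?thesis by (auto simp: enc_nat_def dd_simps)
next
  case (2 k b)
  have "\<exists>bl. bin n = B1 # bl" if "1 \<le> n" for n
    using that
  proof (induction n rule: less_induct)
    case (less n)
    show ?case
    proof (cases rule: bin_cases[of n])
      case 1
      then show ?thesis using less.prems by auto
    next
      case (2 k b)
      then show ?thesis using less.IH[of k] by auto
    qed
  qed
  then obtain bl where bl: "bin n = B1 # bl" using 2 by fastforce
  then have "\<forall>x\<in>set bl. is_bit x" using bin_bits[of _ n] by auto
  then show ?thesis using bl runs_NumN_bits[of bl c "Sep # xs"] by (simp add: enc_nat_def dd_simps)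
qed

lemma runs_NumN: "runs (NumN c) xs \<Longrightarrow> \<exists>bl ys. xs = bl @ Sep # ys \<and> (\<forall>x\<in>set bl. is_bit x) \<and> runs (after c) ys"
proof (induction xs)
  case Nil
  then show ?case by simp
next
  case (Cons x xs)
  show ?case
  proof (cases "is_bit x")
    case True
    then have "runs (NumN c) xs" using Cons.prems by (simp add: dd_simps)
    then obtain bl ys where "xs = bl @ Sep # ys" "\<forall>x\<in>set bl. is_bit x" "runs (after c) ys" using Cons.IH by blast
    then show ?thesis using True by (intro exI[of _ "x # bl"] exI[of _ ys]) auto
  next
    case False
    then have "x = Sep \<and> runs (after c) xs" using Cons.prems runs_Dead by (auto simp: dd_simps split: if_splits)
    then show ?thesis by (intro exI[of _ "[]"] exI[of _ xs]) auto
  qed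
qed

lemma runs_number: "runs (NumN c) xs \<Longrightarrow> \<exists>n ys. B1 # xs = enc_nat n @ ys \<and> runs (after c) ys"
proof -
  assume "runs (NumN c) xs"
  then obtain bl ys where b: "xs = bl @ Sep # ys" "\<forall>x\<in>set bl. is_bit x" "runs (after c) ys"
    using runs_NumN by blast
  obtain n where "bin n = B1 # bl" using ex_bin[OF b(2)] by blast
  with b show ?thesis by (intro exI[of _ n] exI[of _ ys]) (simp add: enc_nat_def)
qed

lemma runs_NumZ: "runs (NumZ c) xs \<Longrightarrow> \<exists>n ys. B0 # xs = enc_nat n @ ys \<and> runs (after c) ys"
proof -
  assume a: "runs (NumZ c) xs"
  then obtain ys where "xs = Sep # ys" "runs (after c) ys"
    using runs_Dead by (cases xs) (auto simp: dd_simps split: if_splits)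
  moreover have "bin 0 = [B0]" by (subst bin.simps) simp
  ultimately show ?thesis by (intro exI[of _ 0] exI[of _ ys]) (simp add: enc_nat_def)
qed

lemma runs_Num0: "runs (Num0 c) xs \<Longrightarrow> \<exists>n ys. xs = enc_nat n @ ys \<and> runs (after c) ys"
proof -
  assume a: "runs (Num0 c) xs"
  then obtain x ys where xs: "xs = x # ys" by (cases xs) auto
  show ?thesis
  proof (cases "is_bit x")
    case True
    then show ?thesis using a runs_number[of c ys] runs_NumZ[of c ys] unfolding xs by (auto simp: dd_simps)
  next
    case False
    then show ?thesis using a runs_Dead unfolding xs by (simp add: dd_simps)
  qed
qed

lemma runs_SF: "runs SF xs \<Longrightarrow> \<exists>ts. xs = enc_toks ts \<and> (\<forall>t\<in>set ts. tok_ok t)"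
proof (induction "length xs" arbitrary: xs rule: less_induct)
  case less
  show ?case
  proof (cases xs)
    case Nil
    then show ?thesis by (intro exI[of _ "[]"]) simp
  next
    case (Cons x ys)
    show ?thesis
    proof (cases "x = TP")
      case True
      then have "runs (Num0 CP) ys" using less.prems Cons by (simp add: dd_simps)
      then obtain n zs where n: "ys = enc_nat n @ zs" "runs SF zs" using runs_Num0[of CP ys] by (auto simp: after_def)
      then obtain ts where "zs = enc_toks ts" "\<forall>t\<in>set ts. tok_ok t" using less.hyps[of zs] Cons by auto
      then show ?thesis using n True Cons by (intro exI[of _ "Var n # ts"]) simp
    next
      case False
      then have "x \<in> set ops" "runs SF ys" using less.prems Cons runs_Dead by (auto simp: dd_simps split: if_splits)
      then obtain ts where "ys = enc_toks ts" "\<forall>t\<in>set ts. tok_ok t" using less.hyps[of ys] Cons by auto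
      then show ?thesis using \<open>x \<in> set ops\<close> Cons by (intro exI[of _ "Op x # ts"]) simp
    qed
  qed
qed

abbreviation enc_edges :: "(nat \<times> nat) list \<Rightarrow> sym list" where
  "enc_edges es \<equiv> concat (map (\<lambda>(a, b). TEdge # enc_nat a @ enc_nat b) es)"
abbreviation enc_lab :: "nat list \<Rightarrow> sym list" where
  "enc_lab ps \<equiv> concat (map enc_nat ps)"
abbreviation enc_labs :: "nat list list \<Rightarrow> sym list" where
  "enc_labs L \<equiv> concat (map (\<lambda>ps. TLab # concat (map enc_nat ps)) L)"

lemma runs_SL: "runs SL xs \<Longrightarrow> \<exists>ps L r ys. xs = enc_lab ps @ enc_labs L @ TRoot # enc_nat r @ ys \<and> runs SH ys"
proof (induction "length xs" arbitrary: xs rule: less_induct)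
  case less
  obtain x ys where xs: "xs = x # ys" using less.prems by (cases xs) auto
  have num: ?case if n: "xs = enc_nat n @ zs" "runs SL zs" for n zs
  proof -
    have "length zs < length xs" using n by (simp add: enc_nat_def)
    then obtain ps L r us where "zs = enc_lab ps @ enc_labs L @ TRoot # enc_nat r @ us" "runs SH us"
      using less.hyps n(2) by blast
    then have "xs = enc_lab (n # ps) @ enc_labs L @ TRoot # enc_nat r @ us \<and> runs SH us" using n(1) by simp
    then show ?thesis by blast
  qed
  consider "x = B0" | "x = B1" | "x = TLab" | "x = TRoot"
    using less.prems xs runs_Dead by (auto simp: dd_simps split: if_splits)
  then show ?case
  proof cases
    case 1
    then have "runs (NumZ CL) ys" using less.prems xs by (simp add: dd_simps)
    then show ?thesis using runs_NumZ[of CL ys] num 1 xs by (auto simp: after_def)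
  next
    case 2
    then have "runs (NumN CL) ys" using less.prems xs by (simp add: dd_simps)
    then show ?thesis using runs_number[of CL ys] num 2 xs by (auto simp: after_def)
  next
    case 3
    then have "runs SL ys" using less.prems xs by (simp add: dd_simps)
    then obtain ps L r us where "ys = enc_lab ps @ enc_labs L @ TRoot # enc_nat r @ us" "runs SH us"
      using less.hyps[of ys] xs by auto
    then have "xs = enc_lab [] @ enc_labs (ps # L) @ TRoot # enc_nat r @ us \<and> runs SH us" using 3 xs by simp
    then show ?thesis by blast
  next
    case 4
    then have "runs (Num0 CR) ys" using less.prems xs by (simp add: dd_simps)
    then obtain r us where "ys = enc_nat r @ us" "runs SH us" using runs_Num0[of CR ys] by (auto simp: after_def)
    then have "xs = enc_lab [] @ enc_labs [] @ TRoot # enc_nat r @ us \<and> runs SH us" using 4 xs by simp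
    then show ?thesis by blast
  qed
qed

lemma runs_SE: "runs SE xs \<Longrightarrow> \<exists>es L r ys. xs = enc_edges es @ enc_labs L @ TRoot # enc_nat r @ ys \<and> runs SH ys"
proof (induction "length xs" arbitrary: xs rule: less_induct)
  case less
  obtain x ys where xs: "xs = x # ys" using less.prems by (cases xs) auto
  consider "x = TEdge" | "x = TLab" | "x = TRoot"
    using less.prems xs runs_Dead by (auto simp: dd_simps split: if_splits)
  then show ?case
  proof cases
    case 1
    then have "runs (Num0 CA) ys" using less.prems xs by (simp add: dd_simps)
    then obtain a us where a: "ys = enc_nat a @ us" "runs (Num0 CB) us" using runs_Num0[of CA ys] by (auto simp: after_def)
    then obtain b vs where b: "us = enc_nat b @ vs" "runs SE vs" using runs_Num0[of CB us] by (auto simp: after_def)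
    have "length vs < length xs" using xs a b by simp
    then obtain es L r zs where "vs = enc_edges es @ enc_labs L @ TRoot # enc_nat r @ zs" "runs SH zs"
      using less.hyps b(2) by blast
    then have "xs = enc_edges ((a, b) # es) @ enc_labs L @ TRoot # enc_nat r @ zs \<and> runs SH zs" using 1 xs a b by simp
    then show ?thesis by blast
  next
    case 2
    then have "runs SL ys" using less.prems xs by (simp add: dd_simps)
    then obtain ps L r us where "ys = enc_lab ps @ enc_labs L @ TRoot # enc_nat r @ us" "runs SH us"
      using runs_SL by blast
    then have "xs = enc_edges [] @ enc_labs (ps # L) @ TRoot # enc_nat r @ us \<and> runs SH us" using 2 xs by simp
    then show ?thesis by blast
  next
    case 3
    then have "runs (Num0 CR) ys" using less.prems xs by (simp add: dd_simps)
    then obtain r us where "ys = enc_nat r @ us" "runs SH us" using runs_Num0[of CR ys] by (auto simp: after_def)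
    then have "xs = enc_edges [] @ enc_labs [] @ TRoot # enc_nat r @ us \<and> runs SH us" using 3 xs by simp
    then show ?thesis by blast
  qed
qed

text \<open>The automaton checks the lexical shape only: \<open>K\<close> need not be well formed,
  and the tokens need not form a formula.\<close>

lemma runs_Start:
  assumes "runs Start w"
  shows "\<exists>(K::kripke) ts. w = enc_kripke K @ THash # enc_toks ts \<and> (\<forall>t\<in>set ts. tok_ok t)"
proof -
  obtain xs where "w = TState # xs" "runs (Num0 CK) xs"
    using assms runs_Dead by (cases w) (auto simp: dd_simps split: if_splits)
  moreover then obtain n ys where "xs = enc_nat n @ ys" "runs SE ys"
    using runs_Num0[of CK xs] by (auto simp: after_def)
  moreover then obtain es L r zs where "ys = enc_edges es @ enc_labs L @ TRoot # enc_nat r @ zs" "runs SH zs"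
    using runs_SE by blast
  moreover then obtain us where "zs = THash # us" "runs SF us"
    using runs_Dead by (cases zs) (auto simp: dd_simps split: if_splits)
  moreover then obtain ts where "us = enc_toks ts" "\<forall>t\<in>set ts. tok_ok t" using runs_SF by blast
  ultimately have "w = enc_kripke \<lparr>kn = n, kE = es, kL = L, kr = r\<rparr> @ THash # enc_toks ts \<and> (\<forall>t\<in>set ts. tok_ok t)"
    by (simp add: enc_kripke_def)
  then show ?thesis by blast
qed

lemma foldl_edges: "foldl dd SE (enc_edges es @ xs) = foldl dd SE xs"
proof (induction es)
  case (Cons e es)
  obtain a b where "e = (a, b)" by (cases e)
  then show ?case using Cons foldl_enc_nat[of CA a "enc_nat b @ enc_edges es @ xs"]
      foldl_enc_nat[of CB b "enc_edges es @ xs"] by (simp add: dd_simps after_def)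
qed simp

lemma foldl_lab: "foldl dd SL (enc_lab ps @ xs) = foldl dd SL xs"
proof (induction ps)
  case (Cons p ps)
  have "foldl dd SL (enc_nat p @ ys) = foldl dd (Num0 CL) (enc_nat p @ ys)" for ys
  proof -
    obtain x bl where "bin p = x # bl" using bin_neq_Nil by (cases "bin p") auto
    moreover from this have "is_bit x" using bin_bits[of x p] by simp
    ultimately show ?thesis by (auto simp: enc_nat_def dd_simps)
  qed
  then show ?case using Cons foldl_enc_nat[of CL p "enc_lab ps @ xs"] by (simp add: after_def)
qed simp

text \<open>The state reached depends on whether there is any label list, but \<open>SE\<close> and
  \<open>SL\<close> react alike to \<open>TRoot\<close>.\<close>

lemma foldl_labs: "q = SE \<or> q = SL \<Longrightarrow> \<exists>q'. (q' = SE \<or> q' = SL) \<and> foldl dd q (enc_labs L @ xs) = foldl dd q' xs"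
proof (induction L arbitrary: q)
  case Nil
  then show ?case by (intro exI[of _ q]) auto
next
  case (Cons ps L)
  have "dd q TLab = SL" using Cons.prems by (auto simp: dd_simps)
  then show ?case using Cons.IH[of SL] foldl_lab[of ps "enc_labs L @ xs"] by simp
qed

lemma foldl_toks: "\<forall>t\<in>set ts. tok_ok t \<Longrightarrow> foldl dd SF (enc_toks ts) = SF"
proof (induction ts)
  case (Cons t ts)
  then show ?case using foldl_enc_nat[of CP _ "enc_toks ts"] by (cases t) (auto simp: dd_simps after_def)
qed simp

lemma runs_encoding:
  fixes K :: kripke
  assumes "\<forall>t\<in>set ts. tok_ok t"
  shows "runs Start (enc_kripke K @ THash # enc_toks ts)"
proof -
  let ?r = "TRoot # enc_nat (kr K) @ THash # enc_toks ts"
  obtain q where q: "q = SE \<or> q = SL" "foldl dd SE (enc_labs (kL K) @ ?r) = foldl dd q ?r"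
    using foldl_labs[of SE] by blast
  have "dd q TRoot = Num0 CR" using q by (auto simp: dd_simps)
  then have "foldl dd q ?r = SF"
    using foldl_enc_nat[of CR "kr K" "THash # enc_toks ts"] foldl_toks[OF assms]
    by (simp add: after_def) (simp add: dd_simps)
  moreover have "foldl dd Start (enc_kripke K @ THash # enc_toks ts) = foldl dd SE (enc_labs (kL K) @ ?r)"
    using foldl_enc_nat[of CK "kn K" "enc_edges (kE K) @ enc_labs (kL K) @ ?r"] foldl_edges[of "kE K" "enc_labs (kL K) @ ?r"]
    by (simp add: enc_kripke_def after_def) (simp add: dd_simps)
  ultimately show ?thesis using q by simp
qed

section \<open>Head positions and suffixes of the input\<close>

lemma read_in_drop: "read_in w (u + Suc j) = (if j < length (drop u w) then Some (drop u w ! j) else None)"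
  by (auto simp: read_in_def)

primrec occ :: "sym \<Rightarrow> (sym list \<Rightarrow> bool) \<Rightarrow> sym list \<Rightarrow> bool" where
  "occ s Q [] \<longleftrightarrow> False"
| "occ s Q (x # xs) \<longleftrightarrow> x = s \<and> Q xs \<or> occ s Q xs"

lemma occ_skip: "s \<notin> set xs \<Longrightarrow> occ s Q (xs @ ys) \<longleftrightarrow> occ s Q ys"
  by (induction xs) auto

lemma occ_none: "s \<notin> set xs \<Longrightarrow> \<not> occ s Q xs"
  by (induction xs) auto

lemma occ_nth: "occ s Q w \<longleftrightarrow> (\<exists>j<length w. w ! j = s \<and> Q (drop (Suc j) w))"
proof (induction w)
  case (Cons x xs)
  have "(\<exists>j<length (x # xs). (x # xs) ! j = s \<and> Q (drop (Suc j) (x # xs))) \<longleftrightarrow>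
     x = s \<and> Q xs \<or> (\<exists>j<length xs. xs ! j = s \<and> Q (drop (Suc j) xs))"
    by (simp add: Ex_less_Suc2)
  then show ?case using Cons by simp
qed simp

text \<open>Head position \<open>u\<close> scans index \<open>u - 1\<close>, so
  \<open>drop u w\<close> is the text to the right of the head. Quantifiers over positions thus
  become recursions over suffixes.\<close>

lemma read_occ: "(\<exists>u<npos w. read_in w u = Some s \<and> Q (drop u w)) \<longleftrightarrow> occ s Q w"
proof
  assume "\<exists>u<npos w. read_in w u = Some s \<and> Q (drop u w)"
  then obtain u where u: "read_in w u = Some s" "Q (drop u w)" by blast
  then have "0 < u" "u \<le> length w" "w ! (u - 1) = s" by (auto simp: read_in_def split: if_splits)
  with u show "occ s Q w" unfolding occ_nth by (intro exI[of _ "u - 1"]) simp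
next
  assume "occ s Q w"
  then obtain j where "j < length w" "w ! j = s" "Q (drop (Suc j) w)" unfolding occ_nth by blast
  then show "\<exists>u<npos w. read_in w u = Some s \<and> Q (drop u w)"
    by (intro exI[of _ "Suc j"]) (simp add: read_in_def)
qed

definition labs :: "sym list \<Rightarrow> nat" where "labs xs = length (filter (\<lambda>x. x = TLab) xs)"

lemma labs_simps [simp]: "labs [] = 0" "labs (x # xs) = of_bool (x = TLab) + labs xs" "labs (xs @ ys) = labs xs + labs ys"
  by (simp_all add: labs_def)

lemma labs_none: "TLab \<notin> set xs \<Longrightarrow> labs xs = 0"
  by (induction xs) auto

lemma count_read: "j \<le> length w \<Longrightarrow> length (filter (\<lambda>i. read_in w i = Some TLab) [0..<Suc j]) = labs (take j w)"
proof (induction j)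
  case 0
  then show ?case by (simp add: read_in_def)
next
  case (Suc j)
  then have "read_in w (Suc j) = Some (w ! j)" "take (Suc j) w = take j w @ [w ! j]"
    by (simp_all add: read_in_def take_Suc_conv_app_nth)
  moreover have "[0..<Suc (Suc j)] = [0..<Suc j] @ [Suc j]" by simp
  ultimately show ?case using Suc by (simp del: upt_Suc)
qed

lemma count_read_all: "length (filter (\<lambda>i. read_in w i = Some TLab) [0..<npos w]) = labs w"
proof -
  have "[0..<npos w] = [0..<Suc (length w)] @ [Suc (length w)]" by simp
  moreover have "read_in w (Suc (length w)) = None" by (simp add: read_in_def)
  ultimately show ?thesis using count_read[of "length w" w] by (simp del: upt_Suc)
qed

text \<open>The label list of state \<open>i\<close> is the one whose \<open>TLab\<close> has
  exactly \<open>i\<close> others before it.\<close>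

primrec occl :: "nat \<Rightarrow> (sym list \<Rightarrow> bool) \<Rightarrow> sym list \<Rightarrow> bool" where
  "occl i Q [] \<longleftrightarrow> False"
| "occl i Q (x # xs) \<longleftrightarrow> (if x = TLab then (case i of 0 \<Rightarrow> Q xs | Suc i' \<Rightarrow> occl i' Q xs) else occl i Q xs)"

lemma occl_skip: "TLab \<notin> set xs \<Longrightarrow> occl i Q (xs @ ys) \<longleftrightarrow> occl i Q ys"
  by (induction xs) auto

lemma occl_nth: "occl i Q w \<longleftrightarrow> (\<exists>j<length w. w ! j = TLab \<and> labs (take j w) = i \<and> Q (drop (Suc j) w))"
proof (induction w arbitrary: i)
  case (Cons x xs)
  have "(\<exists>j<length (x # xs). (x # xs) ! j = TLab \<and> labs (take j (x # xs)) = i \<and> Q (drop (Suc j) (x # xs))) \<longleftrightarrow>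
     x = TLab \<and> i = 0 \<and> Q xs \<or> (\<exists>j<length xs. xs ! j = TLab \<and> of_bool (x = TLab) + labs (take j xs) = i \<and> Q (drop (Suc j) xs))"
    by (simp add: Ex_less_Suc2)
  then show ?case using Cons by (auto split: nat.splits)
qed simp

lemma read_occl: "(\<exists>u<npos w. read_in w u = Some TLab \<and>
   length (filter (\<lambda>i. read_in w i = Some TLab) [0..<u]) = i \<and> Q (drop u w)) \<longleftrightarrow> occl i Q w" (is "?L = _")
proof
  assume ?L
  then obtain u where u: "read_in w u = Some TLab" "length (filter (\<lambda>i. read_in w i = Some TLab) [0..<u]) = i" "Q (drop u w)"
    by blast
  then obtain j where j: "u = Suc j" "j < length w" "w ! j = TLab"
    by (cases u) (auto simp: read_in_def split: if_splits)
  with u count_read[of j w] show "occl i Q w" unfolding occl_nth j(1) by (intro exI[of _ "j"] conjI) simp_all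
next
  assume "occl i Q w"
  then obtain j where j: "j < length w" "w ! j = TLab" "labs (take j w) = i" "Q (drop (Suc j) w)" unfolding occl_nth by blast
  have "read_in w (Suc j) = Some TLab" using j by (simp add: read_in_def)
  then show ?L using j count_read[of j w] by (intro exI[of _ "Suc j"] conjI) simp_all
qed

lemma dropWhile_Sep:
  "(\<exists>j<length ys. ys ! j = Sep \<and> (\<forall>i<j. is_bit (ys ! i)) \<and> P (drop (Suc j) ys)) \<longleftrightarrow>
   (\<exists>rest. dropWhile is_bit ys = Sep # rest \<and> P rest)"
proof (induction ys)
  case (Cons y ys)
  have "(\<exists>j<length (y # ys). (y # ys) ! j = Sep \<and> (\<forall>i<j. is_bit ((y # ys) ! i)) \<and> P (drop (Suc j) (y # ys))) \<longleftrightarrow>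
      y = Sep \<and> P ys \<or> is_bit y \<and> (\<exists>j<length ys. ys ! j = Sep \<and> (\<forall>i<j. is_bit (ys ! i)) \<and> P (drop (Suc j) ys))"
    by (simp add: Ex_less_Suc2 All_less_Suc2) blast
  then show ?case unfolding Cons.IH by auto
qed simp

text \<open>Meant for the two numerals of an edge: \<open>s\<close> is the separator closing the
  first one, so the second one starts right after \<open>s\<close>.\<close>

lemma read_adj:
  assumes "e < npos w"
  shows "(\<exists>s<npos w. e < s \<and> read_in w s = Some Sep \<and>
      (\<forall>z<npos w. e < z \<longrightarrow> z < s \<longrightarrow> read_in w z = Some B0 \<or> read_in w z = Some B1) \<and> P (drop s w)) \<longleftrightarrow>
    (\<exists>rest. dropWhile is_bit (drop e w) = Sep # rest \<and> P rest)" (is "?L = _")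
proof -
  let ?ys = "drop e w"
  have "?L \<longleftrightarrow> (\<exists>j<length ?ys. ?ys ! j = Sep \<and> (\<forall>i<j. is_bit (?ys ! i)) \<and> P (drop (Suc j) ?ys))"
  proof
    assume ?L
    then obtain s where s: "e < s" "read_in w s = Some Sep" "P (drop s w)"
      "\<And>z. z < npos w \<Longrightarrow> e < z \<Longrightarrow> z < s \<Longrightarrow> read_in w z = Some B0 \<or> read_in w z = Some B1" "s < npos w" by blast
    define j where "j = s - Suc e"
    have sj: "s = e + Suc j" using s(1) by (simp add: j_def)
    have j: "j < length ?ys" "?ys ! j = Sep" using s(2) unfolding sj read_in_drop by (auto split: if_splits)
    have "is_bit (?ys ! i)" if "i < j" for i
    proof -
      have "read_in w (e + Suc i) = Some B0 \<or> read_in w (e + Suc i) = Some B1"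
        using s(4)[of "e + Suc i"] s(5) that unfolding sj by simp
      then show ?thesis unfolding read_in_drop by (auto split: if_splits)
    qed
    moreover have "drop (Suc j) ?ys = drop s w" by (simp add: sj add.commute)
    ultimately show "\<exists>j<length ?ys. ?ys ! j = Sep \<and> (\<forall>i<j. is_bit (?ys ! i)) \<and> P (drop (Suc j) ?ys)"
      using j s(3) by (intro exI[of _ j]) simp
  next
    assume "\<exists>j<length ?ys. ?ys ! j = Sep \<and> (\<forall>i<j. is_bit (?ys ! i)) \<and> P (drop (Suc j) ?ys)"
    then obtain j where j: "j < length ?ys" "?ys ! j = Sep" "\<And>i. i < j \<Longrightarrow> is_bit (?ys ! i)" "P (drop (Suc j) ?ys)" by blast
    have bits: "read_in w z = Some B0 \<or> read_in w z = Some B1" if z: "e < z" "z < e + Suc j" for z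
    proof -
      define i where "i = z - Suc e"
      have zi: "z = e + Suc i" "i < j" using z by (auto simp: i_def)
      have "i < length ?ys" using zi(2) j(1) by simp
      then show ?thesis unfolding zi(1) read_in_drop using j(3)[OF zi(2)] by auto
    qed
    have "drop (Suc j) ?ys = drop (e + Suc j) w" by (simp add: add.commute)
    moreover have "read_in w (e + Suc j) = Some Sep" unfolding read_in_drop using j by simp
    moreover have "e + Suc j < npos w" using j(1) by simp
    ultimately show ?L using j(4) bits by (intro exI[of _ "e + Suc j"]) simp
  qed
  then show ?thesis unfolding dropWhile_Sep .
qed

definition bit_at :: "sym list \<Rightarrow> nat \<Rightarrow> bool" where
  "bit_at xs j \<longleftrightarrow> j < length xs \<and> is_bit (xs ! j)"

text \<open>Equality of numerals in first-order form: a common length, and agreement at every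
  smaller offset.\<close>

lemma takeWhile_eq_iff:
  "takeWhile is_bit a = takeWhile is_bit b \<longleftrightarrow>
    (\<exists>l. \<not> bit_at a l \<and> \<not> bit_at b l \<and> (\<forall>e<l. bit_at a e \<and> bit_at b e \<and> a ! e = b ! e))"
proof
  assume eq: "takeWhile is_bit a = takeWhile is_bit b"
  define l where "l = length (takeWhile is_bit a)"
  have l': "l = length (takeWhile is_bit b)" using eq by (simp add: l_def)
  have na: "\<not> bit_at a l" unfolding l_def bit_at_def using nth_length_takeWhile[of is_bit a] by blast
  have nb: "\<not> bit_at b l" unfolding l' bit_at_def using nth_length_takeWhile[of is_bit b] by blast
  have "bit_at a e \<and> bit_at b e \<and> a ! e = b ! e" if e: "e < l" for e
  proof -
    have "takeWhile is_bit a ! e = a ! e" "takeWhile is_bit b ! e = b ! e"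
      using e takeWhile_nth[of e is_bit a] takeWhile_nth[of e is_bit b] l' by (simp_all add: l_def)
    moreover have "is_bit (takeWhile is_bit a ! e)"
      by (rule set_takeWhileD[of _ is_bit a, THEN conjunct2], rule nth_mem) (use e in \<open>simp add: l_def\<close>)
    moreover have "is_bit (takeWhile is_bit b ! e)"
      by (rule set_takeWhileD[of _ is_bit b, THEN conjunct2], rule nth_mem) (use e in \<open>simp add: l'\<close>)
    moreover have "e < length a" "e < length b"
      using e length_takeWhile_le[of is_bit a] length_takeWhile_le[of is_bit b] l' unfolding l_def by linarith+
    ultimately show ?thesis unfolding bit_at_def eq by simp
  qed
  with na nb show "\<exists>l. \<not> bit_at a l \<and> \<not> bit_at b l \<and> (\<forall>e<l. bit_at a e \<and> bit_at b e \<and> a ! e = b ! e)" by blast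
next
  assume "\<exists>l. \<not> bit_at a l \<and> \<not> bit_at b l \<and> (\<forall>e<l. bit_at a e \<and> bit_at b e \<and> a ! e = b ! e)"
  then obtain l where l: "\<not> bit_at a l" "\<not> bit_at b l" "\<And>e. e < l \<Longrightarrow> bit_at a e \<and> bit_at b e \<and> a ! e = b ! e" by blast
  have *: "takeWhile is_bit x = take l x" if "\<not> bit_at x l" "\<And>e. e < l \<Longrightarrow> bit_at x e" for x
  proof (rule takeWhile_eq_take_P_nth)
    fix i assume "i < l" then show "is_bit (x ! i)" using that(2) by (simp add: bit_at_def)
  next
    assume "l < length x" then show "\<not> is_bit (x ! l)" using that(1) by (simp add: bit_at_def)
  qed
  have len: "l \<le> length a" "l \<le> length b"
    using l(3)[of "l - 1"] by (cases l; simp add: bit_at_def)+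
  have "take l a = take l b" by (rule nth_equalityI) (use len l(3) in auto)
  moreover have "takeWhile is_bit a = take l a" by (rule *[OF l(1)]) (use l(3) in blast)
  moreover have "takeWhile is_bit b = take l b" by (rule *[OF l(2)]) (use l(3) in blast)
  ultimately show "takeWhile is_bit a = takeWhile is_bit b" by simp
qed

text \<open>A positional substitute for membership in a label list: the numeral starts the list or
  follows a separator. After the last separator the empty word would qualify too, hence the
  condition \<open>t \<noteq> []\<close> in the lemmas.\<close>

definition in_block :: "sym list \<Rightarrow> sym list \<Rightarrow> bool" where
  "in_block t ys \<longleftrightarrow> (\<exists>ps rest. ys = ps @ rest \<and> (\<forall>x\<in>set ps. is_bit x \<or> x = Sep) \<and>
     (ps = [] \<or> last ps = Sep) \<and> takeWhile is_bit rest = t)"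

lemma in_block_stop: "\<not> is_bit c \<Longrightarrow> c \<noteq> Sep \<Longrightarrow> t \<noteq> [] \<Longrightarrow> \<not> in_block t (c # ys)"
  unfolding in_block_def by (auto simp: Cons_eq_append_conv)

lemma in_block_number:
  "in_block t (bin p @ Sep # ys) \<longleftrightarrow> t = bin p \<or> in_block t ys"
proof
  assume "in_block t (bin p @ Sep # ys)"
  then obtain ps rest where a: "bin p @ Sep # ys = ps @ rest" "\<forall>x\<in>set ps. is_bit x \<or> x = Sep"
     "ps = [] \<or> last ps = Sep" "takeWhile is_bit rest = t" unfolding in_block_def by blast
  show "t = bin p \<or> in_block t ys"
  proof (cases "ps = []")
    case True
    then show ?thesis using a by auto
  next
    case False
    \<comment> \<open>The cut lies behind the first numeral or inside it. The second is impossible,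
      and so is a cut right behind the numeral, because the part before the cut has to end with a
      separator.\<close>
    from a(1) consider us where "ps = bin p @ us" "us @ rest = Sep # ys" | us where "bin p = ps @ us" "us @ Sep # ys = rest"
      unfolding append_eq_append_conv2 by auto
    then show ?thesis
    proof cases
      case 1
      show ?thesis
      proof (cases us)
        case Nil
        then have "last ps \<in> set (bin p)" using 1 False by simp
        then have "is_bit (last ps)" by (rule bin_bits)
        then show ?thesis using a(3) False by simp
      next
        case (Cons u vs)
        then have "ys = vs @ rest" using 1 by simp
        moreover have "\<forall>x\<in>set vs. is_bit x \<or> x = Sep" using a(2) 1 Cons by auto
        moreover have "vs = [] \<or> last vs = Sep" using a(3) False 1 Cons by (auto split: if_splits)
        ultimately show ?thesis using a(4) unfolding in_block_def by blast
      qed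
    next
      case 2
      then have "last ps \<in> set (bin p)" using False by auto
      then have "is_bit (last ps)" by (rule bin_bits)
      then show ?thesis using a(3) False by simp
    qed
  qed
next
  assume "t = bin p \<or> in_block t ys"
  then show "in_block t (bin p @ Sep # ys)"
  proof
    assume "t = bin p"
    then show ?thesis unfolding in_block_def by (intro exI[of _ "[]"] exI[of _ "bin p @ Sep # ys"]) simp
  next
    assume "in_block t ys"
    then obtain ps rest where "ys = ps @ rest" "\<forall>x\<in>set ps. is_bit x \<or> x = Sep"
     "ps = [] \<or> last ps = Sep" "takeWhile is_bit rest = t" unfolding in_block_def by blast
    then show ?thesis unfolding in_block_def using bin_bits
      by (intro exI[of _ "bin p @ Sep # ps"] exI[of _ rest]) auto
  qed
qed

lemma in_block_lab: "\<not> is_bit c \<Longrightarrow> c \<noteq> Sep \<Longrightarrow> t \<noteq> [] \<Longrightarrow>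
    in_block t (enc_lab ps @ c # ys) \<longleftrightarrow> (\<exists>p\<in>set ps. t = bin p)"
  by (induction ps) (simp_all add: in_block_stop enc_nat_def in_block_number)

section \<open>Reading the encoding of a Kripke structure\<close>

lemma enc_nat_syms: "x \<notin> {B0, B1, Sep} \<Longrightarrow> x \<notin> set (enc_nat n)"
  using set_bin[of n] by (auto simp: enc_nat_def)

lemma enc_edges_syms: "x \<notin> {B0, B1, Sep, TEdge} \<Longrightarrow> x \<notin> set (enc_edges es)"
  using enc_nat_syms by auto

lemma enc_lab_syms: "x \<notin> {B0, B1, Sep} \<Longrightarrow> x \<notin> set (enc_lab ps)"
  using enc_nat_syms by auto

lemma enc_labs_syms: "x \<notin> {B0, B1, Sep, TLab} \<Longrightarrow> x \<notin> set (enc_labs L)"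
  using enc_nat_syms by auto

lemma enc_toks_syms: "\<forall>t\<in>set ts. tok_ok t \<Longrightarrow> x \<in> {TState, TEdge, TLab, TRoot, THash} \<Longrightarrow> x \<notin> set (enc_toks ts)"
proof (induction ts)
  case (Cons t ts)
  have "x \<notin> set (enc_tok t)"
  proof (cases t)
    case (Op s)
    then show ?thesis using Cons.prems by auto
  next
    case (Var n)
    then show ?thesis using enc_nat_syms[of x n] Cons.prems by auto
  qed
  then show ?case using Cons by simp
qed simp

text \<open>Covers every word accepted by the automaton. \<open>K\<close> is not assumed well
  formed, since the tests that decide this are themselves evaluated here.\<close>

locale input =
  fixes K :: kripke and ts :: "tok list" and w :: "sym list"
  assumes w: "w = enc_kripke K @ THash # enc_toks ts" and ts: "\<forall>t\<in>set ts. tok_ok t"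
begin

lemma w_split: "w = TState # enc_nat (kn K) @ enc_edges (kE K) @ enc_labs (kL K) @ TRoot # enc_nat (kr K) @ THash # enc_toks ts"
  by (simp add: w enc_kripke_def)

lemma occ_TState: "occ TState (\<lambda>ys. P (takeWhile is_bit ys)) w \<longleftrightarrow> P (bin (kn K))"
proof -
  have "TState \<notin> set (enc_nat (kn K) @ enc_edges (kE K) @ enc_labs (kL K) @ TRoot # enc_nat (kr K) @ THash # enc_toks ts)"
    using enc_nat_syms[of TState] enc_edges_syms[of TState] enc_labs_syms[of TState] enc_toks_syms[OF ts, of TState] by auto
  from occ_none[OF this] show ?thesis unfolding w_split by (simp add: enc_nat_def)
qed

lemma occ_TRoot: "occ TRoot (\<lambda>ys. P (takeWhile is_bit ys)) w \<longleftrightarrow> P (bin (kr K))"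
proof -
  have 1: "TRoot \<notin> set (TState # enc_nat (kn K) @ enc_edges (kE K) @ enc_labs (kL K))"
    using enc_nat_syms[of TRoot] enc_edges_syms[of TRoot] enc_labs_syms[of TRoot] by auto
  have 2: "TRoot \<notin> set (enc_nat (kr K) @ THash # enc_toks ts)"
    using enc_nat_syms[of TRoot] enc_toks_syms[OF ts, of TRoot] by auto
  have "w = (TState # enc_nat (kn K) @ enc_edges (kE K) @ enc_labs (kL K)) @ TRoot # enc_nat (kr K) @ THash # enc_toks ts"
    by (simp add: w_split)
  with occ_skip[OF 1] occ_none[OF 2] show ?thesis by (simp add: enc_nat_def)
qed

lemma labs_w: "labs w = length (kL K)"
proof -
  have "labs (enc_labs L) = length L" for L
    using labs_none[OF enc_lab_syms[of TLab]] by (induction L) auto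
  then show ?thesis unfolding w_split
    using labs_none[OF enc_nat_syms[of TLab]] labs_none[OF enc_edges_syms[of TLab]] labs_none[OF enc_toks_syms[OF ts, of TLab]]
    by simp
qed

lemma occ_TEdge:
  "occ TEdge (\<lambda>ys. \<exists>rest. dropWhile is_bit ys = Sep # rest \<and> P (takeWhile is_bit ys) (takeWhile is_bit rest)) w \<longleftrightarrow>
    (\<exists>(a, b)\<in>set (kE K). P (bin a) (bin b))" (is "occ TEdge ?Q w \<longleftrightarrow> _")
proof -
  have n: "occ TEdge ?Q (enc_nat n @ xs) = occ TEdge ?Q xs" for n xs
    using enc_nat_syms[of TEdge] by (intro occ_skip) auto
  have "TEdge \<notin> set (enc_labs (kL K) @ TRoot # enc_nat (kr K) @ THash # enc_toks ts)"
    using enc_nat_syms[of TEdge] enc_labs_syms[of TEdge] enc_toks_syms[OF ts, of TEdge] by auto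
  from occ_none[OF this] have "occ TEdge ?Q (enc_edges es @ enc_labs (kL K) @ TRoot # enc_nat (kr K) @ THash # enc_toks ts)
      \<longleftrightarrow> (\<exists>(a, b)\<in>set es. P (bin a) (bin b))" for es
  proof (induction es)
    case (Cons e es)
    obtain a b where e: "e = (a, b)" by (cases e)
    have "?Q (enc_nat a @ enc_nat b @ ys) \<longleftrightarrow> P (bin a) (bin b)" for ys
      by (simp add: enc_nat_def)
    then show ?case using Cons n e by simp
  qed simp
  then show ?thesis unfolding w_split by (simp add: n)
qed

lemma occl_w:
  assumes "t \<noteq> []"
  shows "occl i (in_block t) w \<longleftrightarrow> i < length (kL K) \<and> (\<exists>p\<in>set (kL K ! i). t = bin p)"
proof -
  let ?r = "TRoot # enc_nat (kr K) @ THash # enc_toks ts"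
  have r: "occl i Q ?r \<longleftrightarrow> False" for i Q
  proof -
    have "TLab \<notin> set ?r" using enc_nat_syms[of TLab] enc_toks_syms[OF ts, of TLab] by auto
    from occl_skip[OF this, of i Q "[]"] show ?thesis by simp
  qed
  have l: "occl i (in_block t) (enc_labs L @ ?r) \<longleftrightarrow> i < length L \<and> (\<exists>p\<in>set (L ! i). t = bin p)" for L
  proof (induction L arbitrary: i)
    case Nil
    then show ?case using r by simp
  next
    case (Cons ps L)
    have "\<exists>c ys. enc_labs L @ ?r = c # ys \<and> \<not> is_bit c \<and> c \<noteq> Sep" by (cases L) auto
    then have "in_block t (enc_lab ps @ enc_labs L @ ?r) \<longleftrightarrow> (\<exists>p\<in>set ps. t = bin p)"
      using in_block_lab[OF _ _ assms, of _ ps] by metis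
    moreover have "occl j Q (enc_lab ps @ enc_labs L @ ?r) = occl j Q (enc_labs L @ ?r)" for j Q
      using enc_lab_syms[of TLab] by (intro occl_skip) auto
    ultimately show ?case using Cons.IH by (cases i) simp_all
  qed
  have "TLab \<notin> set (TState # enc_nat (kn K) @ enc_edges (kE K))"
    using enc_nat_syms[of TLab] enc_edges_syms[of TLab] by auto
  from occl_skip[OF this] have "occl i (in_block t) w \<longleftrightarrow> occl i (in_block t) (enc_labs (kL K) @ ?r)"
    unfolding w_split by simp
  with l show ?thesis by simp
qed

end

section \<open>The reduction\<close>

abbreviation bitsym :: "sym option \<Rightarrow> bool" where "bitsym a \<equiv> a = Some B0 \<or> a = Some B1"
abbreviation tok_at :: "sym list \<Rightarrow> nat \<Rightarrow> sym list" where "tok_at w u \<equiv> takeWhile is_bit (drop u w)"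
abbreviation isS :: "nat \<Rightarrow> sym \<Rightarrow> tst" where "isS u s \<equiv> Sy [u] (\<lambda>a. a = Some s)"

text \<open>The parameter d of the following tests is the number of variables in scope.\<close>

definition adj :: "nat \<Rightarrow> nat \<Rightarrow> nat \<Rightarrow> tst" where
  "adj d e s = An (Lt e s) (An (isS s Sep) (Nt (Exi (An (Lt e d) (An (Lt d s) (Nt (Sy [d] bitsym)))))))"

definition edge :: "nat \<Rightarrow> nat \<Rightarrow> nat \<Rightarrow> tst" where
  "edge d a b = Exi (Exi (An (isS d TEdge) (An (adj (d + 2) d (d + 1)) (An (Vl d a) (Vl (d + 1) b)))))"

definition edges_ok :: "nat \<Rightarrow> nat \<Rightarrow> tst" where
  "edges_ok d m = Nt (Exi (Exi (An (isS d TEdge) (An (adj (d + 2) d (d + 1))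
     (Nt (An (Exi (An (Lt (d + 2) m) (Vl d (d + 2)))) (Exi (An (Lt (d + 2) m) (Vl (d + 1) (d + 2))))))))))"

definition serial :: "nat \<Rightarrow> nat \<Rightarrow> tst" where
  "serial d m = Nt (Exi (An (Lt d m) (Nt (Exi (An (Lt (d + 1) m) (edge (d + 2) d (d + 1)))))))"

definition kn_ok :: "nat \<Rightarrow> nat \<Rightarrow> tst" where
  "kn_ok d m = Exi (An (isS d TState) (Vl d m))"

definition rootT :: "nat \<Rightarrow> nat \<Rightarrow> tst" where
  "rootT d r = Exi (An (isS d TRoot) (Vl d r))"

definition root_ok :: "nat \<Rightarrow> nat \<Rightarrow> tst" where
  "root_ok d m = Exi (An (Lt d m) (rootT (d + 1) d))"

definition same :: "nat \<Rightarrow> nat \<Rightarrow> nat \<Rightarrow> tst" where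
  "same v y e = Nt (An (Nt (An (Sy [v, e] (\<lambda>a. a = Some B0)) (Sy [y, e] (\<lambda>a. a = Some B0))))
     (Nt (An (Sy [v, e] (\<lambda>a. a = Some B1)) (Sy [y, e] (\<lambda>a. a = Some B1)))))"

text \<open>Proposition numbers may be exponential in the input length, so the saturating
  \<open>Vl\<close> cannot tell them apart. Offsets must be positive, which the inner
  \<open>Exi (Lt ...)\<close> expresses, because the numeral starts one position to the right of the
  given one.\<close>

definition tokeq :: "nat \<Rightarrow> nat \<Rightarrow> nat \<Rightarrow> tst" where
  "tokeq d v y = Exi (An (Exi (Lt (d + 1) d)) (An (Nt (Sy [v, d] bitsym)) (An (Nt (Sy [y, d] bitsym))
     (Nt (Exi (An (Exi (Lt (d + 2) (d + 1))) (An (Lt (d + 1) d) (Nt (same v y (d + 1))))))))))"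

text \<open>Here \<open>v\<close> is the \<open>TLab\<close> position itself or a later separator of
  the same list; the numeral meant is the one right after \<open>v\<close>.\<close>

definition labtok :: "nat \<Rightarrow> nat \<Rightarrow> nat \<Rightarrow> tst" where
  "labtok d i v = Exi (An (isS d TLab) (An (Ct d i) (An (Nt (Lt v d)) (An (Nt (An (Lt d v) (Nt (isS v Sep))))
     (Nt (Exi (An (Lt d (d + 1)) (An (Nt (Lt v (d + 1))) (Nt (Sy [d + 1] (\<lambda>a. bitsym a \<or> a = Some Sep)))))))))))"

definition has :: "nat \<Rightarrow> nat \<Rightarrow> nat \<Rightarrow> tst" where
  "has d i y = Exi (An (labtok (d + 1) i d) (tokeq (d + 1) d y))"

definition adjs :: "sym list \<Rightarrow> nat \<Rightarrow> nat \<Rightarrow> bool" where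
  "adjs w e s \<longleftrightarrow> e < s \<and> read_in w s = Some Sep \<and> (\<forall>z<npos w. e < z \<longrightarrow> z < s \<longrightarrow> bitsym (read_in w z))"

lemma tsem_adj: "length \<rho> = d \<Longrightarrow> e < d \<Longrightarrow> s < d \<Longrightarrow> tsem w \<rho> (adj d e s) \<longleftrightarrow> adjs w (\<rho> ! e) (\<rho> ! s)"
  by (auto simp: adj_def adjs_def nth_append)

lemma tsem_same: "tsem w \<rho> (same v y e) \<longleftrightarrow> bitsym (read_in w (\<rho> ! v + \<rho> ! e)) \<and>
    bitsym (read_in w (\<rho> ! y + \<rho> ! e)) \<and> read_in w (\<rho> ! v + \<rho> ! e) = read_in w (\<rho> ! y + \<rho> ! e)"
  by (auto simp: same_def)

lemma bitsym_at: "bitsym (read_in w (v + Suc j)) \<longleftrightarrow> bit_at (drop v w) j"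
  unfolding read_in_drop bit_at_def by (cases "j < length (drop v w)") simp_all

lemma tsem_tokeq:
  assumes d: "length \<rho> = d" "v < d" "y < d"
  shows "tsem w \<rho> (tokeq d v y) \<longleftrightarrow> tok_at w (\<rho> ! v) = tok_at w (\<rho> ! y)"
proof -
  let ?v = "\<rho> ! v" let ?y = "\<rho> ! y"
  let ?a = "drop ?v w" let ?b = "drop ?y w"
  have i: "(\<rho> @ [l]) ! d = l" "(\<rho> @ [l]) ! v = ?v" "(\<rho> @ [l]) ! y = ?y"
    "((\<rho> @ [l]) @ [e]) ! (d + 1) = e" "((\<rho> @ [l]) @ [e]) ! d = l" "((\<rho> @ [l]) @ [e]) ! v = ?v" "((\<rho> @ [l]) @ [e]) ! y = ?y"
    "(((\<rho> @ [l]) @ [e]) @ [z]) ! (d + 2) = z" "(((\<rho> @ [l]) @ [e]) @ [z]) ! (d + 1) = e" for l e z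
    using d by (simp_all add: nth_append)
  have z: "(\<exists>z<npos w. z < l) \<longleftrightarrow> 0 < l" for l by auto
  have "tsem w \<rho> (tokeq d v y) \<longleftrightarrow> (\<exists>l<npos w. 0 < l \<and> \<not> bitsym (read_in w (?v + l)) \<and> \<not> bitsym (read_in w (?y + l)) \<and>
     \<not> (\<exists>e<npos w. 0 < e \<and> e < l \<and> \<not> (bitsym (read_in w (?v + e)) \<and> bitsym (read_in w (?y + e)) \<and>
        read_in w (?v + e) = read_in w (?y + e))))"
    unfolding tokeq_def tsem.simps tsem_same i z list.map sum_list.Cons sum_list.Nil add_0_right ..
  also have "\<dots> \<longleftrightarrow> (\<exists>l. \<not> bit_at ?a l \<and> \<not> bit_at ?b l \<and> (\<forall>e<l. bit_at ?a e \<and> bit_at ?b e \<and> ?a ! e = ?b ! e))" (is "?L \<longleftrightarrow> ?R")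
  proof
    assume ?L
    then obtain l where l: "l < npos w" "0 < l" "\<not> bitsym (read_in w (?v + l))" "\<not> bitsym (read_in w (?y + l))"
      "\<And>e. e < npos w \<Longrightarrow> 0 < e \<Longrightarrow> e < l \<Longrightarrow> bitsym (read_in w (?v + e)) \<and> bitsym (read_in w (?y + e)) \<and>
        read_in w (?v + e) = read_in w (?y + e)" by blast
    obtain l' where l': "l = Suc l'" using l(2) by (cases l) auto
    have "bit_at ?a e \<and> bit_at ?b e \<and> ?a ! e = ?b ! e" if e: "e < l'" for e
    proof -
      have *: "bitsym (read_in w (?v + Suc e)) \<and> bitsym (read_in w (?y + Suc e)) \<and>
        read_in w (?v + Suc e) = read_in w (?y + Suc e)" using l(5)[of "Suc e"] l(1) e l' by simp
      then have b: "bit_at ?a e" "bit_at ?b e" unfolding bitsym_at by simp_all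
      then have "e < length ?a" "e < length ?b" unfolding bit_at_def by simp_all
      moreover have "read_in w (?v + Suc e) = read_in w (?y + Suc e)" using * by blast
      ultimately have "?a ! e = ?b ! e" unfolding read_in_drop by (simp only: if_True option.inject)
      with b show ?thesis by blast
    qed
    then show ?R using l(3,4) unfolding l' bitsym_at by blast
  next
    assume ?R
    then obtain l where l: "\<not> bit_at ?a l" "\<not> bit_at ?b l" "\<And>e. e < l \<Longrightarrow> bit_at ?a e \<and> bit_at ?b e \<and> ?a ! e = ?b ! e" by blast
    \<comment> \<open>The texts cannot agree on more digits than the input has, so the common length
      lies in the range of the quantifier.\<close>
    have "l \<le> length w"
    proof (rule ccontr)
      assume "\<not> l \<le> length w"
      then have "bit_at ?a (length w)" using l(3)[of "length w"] by simp
      then show False unfolding bit_at_def by auto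
    qed
    then have "Suc l < npos w" by simp
    moreover have "bitsym (read_in w (?v + e)) \<and> bitsym (read_in w (?y + e)) \<and>
        read_in w (?v + e) = read_in w (?y + e)" if e: "0 < e" "e < Suc l" for e
    proof -
      obtain e' where e': "e = Suc e'" "e' < l" using e by (cases e) auto
      have b: "bit_at ?a e'" "bit_at ?b e'" "?a ! e' = ?b ! e'" using l(3)[OF e'(2)] by simp_all
      then have "read_in w (?v + e) = read_in w (?y + e)" unfolding e'(1) read_in_drop bit_at_def by (simp only: if_True)
      then show ?thesis using b(1,2) unfolding e'(1) bitsym_at by blast
    qed
    moreover have "\<not> bitsym (read_in w (?v + Suc l))" "\<not> bitsym (read_in w (?y + Suc l))"
      using l(1,2) unfolding bitsym_at by blast+
    ultimately show ?L by blast
  qed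
  also have "\<dots> \<longleftrightarrow> tok_at w ?v = tok_at w ?y" by (rule takeWhile_eq_iff[symmetric])
  finally show ?thesis .
qed

lemma read_in_block:
  assumes "u \<le> length w"
  shows "(\<exists>v<npos w. \<not> v < u \<and> (u < v \<longrightarrow> read_in w v = Some Sep) \<and>
      (\<forall>z<npos w. u < z \<longrightarrow> \<not> v < z \<longrightarrow> bitsym (read_in w z) \<or> read_in w z = Some Sep) \<and> tok_at w v = t) \<longleftrightarrow>
    in_block t (drop u w)" (is "?L \<longleftrightarrow> _")
proof
  assume ?L
  then obtain v where v: "v < npos w" "u \<le> v" "u < v \<Longrightarrow> read_in w v = Some Sep"
    "\<And>z. z < npos w \<Longrightarrow> u < z \<Longrightarrow> \<not> v < z \<Longrightarrow> bitsym (read_in w z) \<or> read_in w z = Some Sep" "tok_at w v = t" by force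
  define j where "j = v - u"
  have vj: "v = u + j" using v(2) by (simp add: j_def)
  let ?ys = "drop u w"
  have jl: "j \<le> length ?ys"
  proof (cases j)
    case (Suc i)
    then have "read_in w (u + Suc i) = Some Sep" using v(3) vj by simp
    then show ?thesis using Suc unfolding read_in_drop by (simp split: if_splits)
  qed simp
  have sep: "is_bit (?ys ! i) \<or> ?ys ! i = Sep" if "i < j" for i
  proof -
    have "bitsym (read_in w (u + Suc i)) \<or> read_in w (u + Suc i) = Some Sep"
      using v(4)[of "u + Suc i"] v(1) that unfolding vj by simp
    then show ?thesis using that jl unfolding read_in_drop by auto
  qed
  have "\<forall>x\<in>set (take j ?ys). is_bit x \<or> x = Sep"
  proof
    fix x assume "x \<in> set (take j ?ys)"
    then obtain i where "i < j" "x = ?ys ! i" unfolding in_set_conv_nth by auto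
    with sep show "is_bit x \<or> x = Sep" by blast
  qed
  moreover have "take j ?ys = [] \<or> last (take j ?ys) = Sep"
  proof (cases j)
    case (Suc i)
    then have "read_in w (u + Suc i) = Some Sep" using v(3) vj by simp
    then have "?ys ! i = Sep" unfolding read_in_drop by (simp split: if_splits)
    moreover have "take j ?ys = take i ?ys @ [?ys ! i]" using Suc jl by (simp add: take_Suc_conv_app_nth)
    ultimately show ?thesis by simp
  qed simp
  moreover have "takeWhile is_bit (drop j ?ys) = t" using v(5) by (simp add: vj add.commute)
  ultimately show "in_block t ?ys" unfolding in_block_def
    by (metis append_take_drop_id)
next
  let ?ys = "drop u w"
  assume "in_block t ?ys"
  then obtain ps rest where p: "?ys = ps @ rest" "\<forall>x\<in>set ps. is_bit x \<or> x = Sep"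
     "ps = [] \<or> last ps = Sep" "takeWhile is_bit rest = t" unfolding in_block_def by blast
  let ?v = "u + length ps"
  have len: "length ps \<le> length ?ys" using p(1) by simp
  then have vN: "?v < npos w" using assms by simp
  have dr: "drop ?v w = rest"
  proof -
    have "drop ?v w = drop (length ps) ?ys" by (simp add: add.commute)
    then show ?thesis unfolding p(1) by simp
  qed
  have rd: "read_in w (u + Suc i) = Some (ps ! i)" if "i < length ps" for i
    using that unfolding read_in_drop p(1) by (simp add: nth_append)
  have "read_in w ?v = Some Sep" if "u < ?v"
  proof -
    have ne: "ps \<noteq> []" using that by auto
    then have "ps ! (length ps - 1) = Sep" using p(3) by (simp add: last_conv_nth)
    then show ?thesis using rd[of "length ps - 1"] ne by simp
  qed
  moreover have "bitsym (read_in w z) \<or> read_in w z = Some Sep" if z: "u < z" "\<not> ?v < z" for z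
  proof -
    define i where "i = z - Suc u"
    have i: "z = u + Suc i" "i < length ps" using z by (auto simp: i_def)
    then show ?thesis using rd[OF i(2)] p(2) nth_mem[OF i(2)] by auto
  qed
  ultimately show ?L using vN dr p(4) by (intro exI[of _ ?v]) simp
qed

lemma tsem_has:
  assumes d: "length \<rho> = d" "i < d" "y < d"
  shows "tsem w \<rho> (has d i y) \<longleftrightarrow> occl (\<rho> ! i) (in_block (tok_at w (\<rho> ! y))) w"
proof -
  let ?t = "tok_at w (\<rho> ! y)"
  let ?c = "\<lambda>u. length (filter (\<lambda>i. read_in w i = Some TLab) [0..<u])"
  have t: "tsem w (\<rho> @ [v]) (tokeq (d + 1) d y) \<longleftrightarrow> tok_at w v = ?t" for v
    using tsem_tokeq[of "\<rho> @ [v]" "d + 1" d y w] d by (simp add: nth_append)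
  have i: "((\<rho> @ [v]) @ [u]) ! (d + 1) = u" "((\<rho> @ [v]) @ [u]) ! d = v" "((\<rho> @ [v]) @ [u]) ! i = \<rho> ! i"
    "(((\<rho> @ [v]) @ [u]) @ [z]) ! (d + 1 + 1) = z" "(((\<rho> @ [v]) @ [u]) @ [z]) ! (d + 1) = u"
    "(((\<rho> @ [v]) @ [u]) @ [z]) ! d = v" for u v z
    using d by (simp_all add: nth_append)
  have l0: "tsem w (\<rho> @ [v]) (labtok (d + 1) i d) \<longleftrightarrow> (\<exists>u<npos w. read_in w u = Some TLab \<and> ?c u = \<rho> ! i \<and>
      \<not> v < u \<and> \<not> (u < v \<and> \<not> read_in w v = Some Sep) \<and>
      \<not> (\<exists>z<npos w. u < z \<and> \<not> v < z \<and> \<not> (bitsym (read_in w z) \<or> read_in w z = Some Sep)))" for v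
    unfolding labtok_def tsem.simps i list.map sum_list.Cons sum_list.Nil add_0_right ..
  have l: "tsem w (\<rho> @ [v]) (labtok (d + 1) i d) \<longleftrightarrow> (\<exists>u<npos w. read_in w u = Some TLab \<and> ?c u = \<rho> ! i \<and>
      \<not> v < u \<and> (u < v \<longrightarrow> read_in w v = Some Sep) \<and>
      (\<forall>z<npos w. u < z \<longrightarrow> \<not> v < z \<longrightarrow> bitsym (read_in w z) \<or> read_in w z = Some Sep))" for v
    unfolding l0 by (intro ex_cong1 conj_cong refl) blast+
  \<comment> \<open>The test binds the start of the entry before the label position; the quantifiers
    are exchanged so that the label position comes first.\<close>
  have "tsem w \<rho> (has d i y) \<longleftrightarrow> (\<exists>u<npos w. read_in w u = Some TLab \<and> ?c u = \<rho> ! i \<and>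
      (\<exists>v<npos w. \<not> v < u \<and> (u < v \<longrightarrow> read_in w v = Some Sep) \<and>
      (\<forall>z<npos w. u < z \<longrightarrow> \<not> v < z \<longrightarrow> bitsym (read_in w z) \<or> read_in w z = Some Sep) \<and> tok_at w v = ?t))"
    unfolding has_def tsem.simps t l by blast
  also have "\<dots> \<longleftrightarrow> (\<exists>u<npos w. read_in w u = Some TLab \<and> ?c u = \<rho> ! i \<and> in_block ?t (drop u w))"
  proof -
    have "read_in w u = Some TLab \<Longrightarrow> u \<le> length w" for u by (auto simp: read_in_def split: if_splits)
    then show ?thesis using read_in_block by blast
  qed
  also have "\<dots> \<longleftrightarrow> occl (\<rho> ! i) (in_block ?t) w" by (rule read_occl)
  finally show ?thesis .
qed

section \<open>Programs that print the formula\<close>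

definition psq :: "prg list \<Rightarrow> prg" where "psq ps = foldr PSeq ps (PEmit [])"

lemma psem_psq [simp]: "psem w \<rho> (psq ps) = concat (map (psem w \<rho>) ps)"
  by (induction ps) (simp_all add: psq_def)

lemma wfprg_psq [simp]: "wfprg mb d (psq ps) \<longleftrightarrow> (\<forall>p\<in>set ps. wfprg mb d p)"
  by (induction ps) (simp_all add: psq_def)

text \<open>Loop over the states: variable 1 holds their number.\<close>

definition ups :: "nat \<Rightarrow> prg \<Rightarrow> prg" where
  "ups d p = PFor (PIf (Lt d 1) p (PEmit []))"

text \<open>Two fixed ones and \<open>i\<close> further ones form the numeral of \<open>sn\<close>,
  see \<open>enc_sp\<close>.\<close>

definition sps :: "nat \<Rightarrow> nat \<Rightarrow> prg" where
  "sps d i = psq [PEmit [TP, B1, B1], PFor (PIf (Lt d i) (PEmit [B1]) (PEmit [])), PEmit [Sep]]"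

lemma concat_below: "m \<le> n \<Longrightarrow> concat (map (\<lambda>v. if v < m then f v else []) [0..<n]) = concat (map f [0..<m])"
proof -
  assume "m \<le> n"
  then have "[0..<n] = [0..<m] @ [m..<n]" by (metis upt_add_eq_append le_add_diff_inverse zero_le)
  moreover have "concat (map (\<lambda>v. if v < m then f v else []) [0..<m]) = concat (map f [0..<m])"
    by (rule arg_cong[where f = concat], rule map_cong) auto
  moreover have "concat (map (\<lambda>v. if v < m then f v else []) [m..<n]) = []" by auto
  ultimately show ?thesis by (simp only: map_append concat_append append_Nil2)
qed

lemma psem_ups:
  assumes "length \<rho> = d" "1 < d" "\<rho> ! 1 \<le> npos w"
  shows "psem w \<rho> (ups d p) = concat (map (\<lambda>v. psem w (\<rho> @ [v]) p) [0..<\<rho> ! 1])"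
proof -
  have "psem w \<rho> (ups d p) = concat (map (\<lambda>v. if v < \<rho> ! 1 then psem w (\<rho> @ [v]) p else []) [0..<npos w])"
    unfolding ups_def psem.simps using assms(1,2)
    by (intro arg_cong[where f = concat] map_cong refl) (simp add: nth_append)
  also have "\<dots> = concat (map (\<lambda>v. psem w (\<rho> @ [v]) p) [0..<\<rho> ! 1])" by (rule concat_below[OF assms(3)])
  finally show ?thesis .
qed

lemma psem_sps:
  assumes "length \<rho> = d" "i < d" "\<rho> ! i \<le> npos w"
  shows "psem w \<rho> (sps d i) = enc_fml (sp (\<rho> ! i))"
proof -
  have "psem w \<rho> (PFor (PIf (Lt d i) (PEmit [B1]) (PEmit []))) =
      concat (map (\<lambda>v. if v < \<rho> ! i then [B1] else []) [0..<npos w])"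
    unfolding psem.simps using assms(1,2)
    by (intro arg_cong[where f = concat] map_cong refl) (simp add: nth_append)
  also have "\<dots> = concat (map (\<lambda>_. [B1]) [0..<\<rho> ! i])" by (rule concat_below[OF assms(3)])
  also have "\<dots> = replicate (\<rho> ! i) B1" by (simp add: map_replicate_const)
  finally show ?thesis unfolding sps_def enc_sp psem_psq by (simp del: psem.simps(4))
qed

lemma concat_map_concat: "concat (map f (concat (map g xs))) = concat (map (\<lambda>x. concat (map f (g x))) xs)"
  by (induction xs) auto

abbreviation encs :: "fml list \<Rightarrow> sym list" where "encs xs \<equiv> concat (map (\<lambda>x. TConj # enc_fml x) xs)"

definition exclP :: prg where
  "exclP = ups 3 (ups 4 (PIf (Lt 3 4) (psq [PEmit [TConj, TNeg, TConj], sps 5 3, sps 5 4]) (PEmit [])))"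

definition marksP :: prg where
  "marksP = ups 3 (psq [PEmit ([TConj, TSim, TNeg, TConj] @ enc_fml (Prop 1)), sps 4 3])"

definition constrP :: prg where
  "constrP = psq [PEmit ([TSim, TFut, TSim] @ encs frame), exclP, marksP, PEmit (enc_fml Top)]"

definition agreeP :: prg where
  "agreeP = psq [PEmit ([TSim, TConj, TSim, TNeg] @ enc_fml (Prop 1)),
     ups 3 (psq [PEmit ([TConj, TSim, TConj, TSim, TNeg, TConj] @ enc_fml (Prop 1)), sps 4 3,
       PEmit ([TNeg, TConj] @ enc_fml (Prop 0) @ [TNeg]), sps 4 3]),
     PEmit (enc_fml Top)]"

definition fullP :: prg where
  "fullP = psq [PEmit ([TSim, TDisj] @ enc_fml (Neg (Prop 0)) @ [TSim, TDisj] @ enc_fml (Neg (Neg (Prop 0))) @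
     [TConj] @ enc_fml (Sim (Neg (Prop 0))) @ [TSim, TFut, TSim]), agreeP]"

definition pathP :: prg where
  "pathP = psq [PEmit [TConj], sps 3 2, PEmit [TNeg, TFut],
     ups 3 (ups 4 (PIf (edge 5 3 4) (psq [PEmit [TConj, TNeg, TConj], sps 5 3, PEmit [TNxt], sps 5 4]) (PEmit []))),
     PEmit (enc_fml Top)]"

definition labP :: "nat \<Rightarrow> prg" where
  "labP y = psq [ups 4 (PIf (has 5 4 y) (PEmit []) (psq [PEmit [TConj, TNeg], sps 5 4])), PEmit (enc_fml Top)]"

text \<open>Each position after \<open>THash\<close> prints its own contribution. Digits and
  separators print nothing, because the whole numeral is dealt with at its
  \<open>TP\<close>.\<close>

definition phiP :: prg where
  "phiP = PFor (PIf (Exi (An (isS 4 THash) (Lt 4 3)))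
     (psq (map (\<lambda>s. PIf (isS 3 s) (PEmit [s]) (PEmit [])) ops @ [PIf (isS 3 TP) (labP 3) (PEmit [])]))
     (PEmit []))"

definition wrapP :: prg where
  "wrapP = psq [PEmit [TConj], constrP, PEmit [TConj], fullP, PEmit [TDisj, TNeg], pathP, PEmit [TConj, TNeg, TNeg], pathP, phiP]"

text \<open>Variable 1 holds the number of label lists; comparing the binary state count with it
  brings that count down to the range of the variables. Positivity is implied by the root
  test.\<close>

definition wfT :: tst where
  "wfT = An (kn_ok 2 1) (An (root_ok 2 1) (An (edges_ok 2 1) (serial 2 1)))"

text \<open>The two loops serve as bindings: the guard lets the body run for a single value, the
  number of label lists in the outer loop and the root in the inner one.\<close>

definition mainP :: "(nat \<Rightarrow> sym \<Rightarrow> nat) \<Rightarrow> (nat \<Rightarrow> bool) \<Rightarrow> prg" where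
  "mainP \<delta> acc = PIf (Df \<delta> acc)
     (PFor (PIf (Ct 0 1) (PIf wfT (PFor (PIf (rootT 3 2) wrapP (PEmit []))) (PEmit [THash])) (PEmit [])))
     (PEmit [THash])"

lemmas wf_defs = adj_def edge_def edges_ok_def serial_def kn_ok_def rootT_def root_ok_def same_def tokeq_def labtok_def has_def
  ups_def sps_def exclP_def marksP_def constrP_def agreeP_def fullP_def pathP_def labP_def phiP_def wrapP_def wfT_def mainP_def

lemma wfprg_mainP: "\<forall>q<mb. \<forall>s. \<delta> q s < mb \<Longrightarrow> wfprg mb 1 (mainP \<delta> acc)"
  by (simp add: wf_defs)

lemma psem_constrP:
  assumes "M \<le> npos w"
  shows "psem w [N, M, r] constrP = enc_fml (constr M)"
proof -
  have "psem w [N, M, r] exclP = encs (excl M)"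
  proof -
    have "psem w [N, M, r] exclP = concat (map (\<lambda>i. concat (map (\<lambda>j. psem w [N, M, r, i, j]
       (PIf (Lt 3 4) (psq [PEmit [TConj, TNeg, TConj], sps 5 3, sps 5 4]) (PEmit []))) [0..<M])) [0..<M])"
      using assms unfolding exclP_def by (simp add: psem_ups)
    also have "\<dots> = concat (map (\<lambda>i. concat (map (\<lambda>j. encs (if i < j then [Neg (Conj (sp i) (sp j))] else [])) [0..<M])) [0..<M])"
      using assms by (intro arg_cong[where f = concat] map_cong refl) (auto simp: psem_sps)
    also have "\<dots> = encs (excl M)" unfolding excl_def concat_map_concat ..
    finally show ?thesis .
  qed
  moreover have "psem w [N, M, r] marksP = encs (marks M)"
  proof -
    have "psem w [N, M, r] marksP = concat (map (\<lambda>i. psem w [N, M, r, i]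
        (psq [PEmit ([TConj, TSim, TNeg, TConj] @ enc_fml (Prop 1)), sps 4 3])) [0..<M])"
      using assms unfolding marksP_def by (simp add: psem_ups)
    also have "\<dots> = encs (marks M)"
      unfolding marks_def map_map using assms
      by (intro arg_cong[where f = concat] map_cong refl) (auto simp: psem_sps)
    finally show ?thesis .
  qed
  ultimately show ?thesis by (simp add: constrP_def constr_def Always_def enc_bigC)
qed

lemma psem_fullP:
  assumes "M \<le> npos w"
  shows "psem w [N, M, r] fullP = enc_fml (full M)"
proof -
  let ?p = "psq [PEmit ([TConj, TSim, TConj, TSim, TNeg, TConj] @ enc_fml (Prop 1)), sps 4 3,
       PEmit ([TNeg, TConj] @ enc_fml (Prop 0) @ [TNeg]), sps 4 3]"
  have "psem w [N, M, r] (ups 3 ?p) = concat (map (\<lambda>i. psem w [N, M, r, i] ?p) [0..<M])"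
    using assms by (simp add: psem_ups)
  also have "\<dots> = encs (map (\<lambda>i. Sim (Conj (Sim (Neg (Conj (Prop 1) (sp i)))) (Neg (Conj (Prop 0) (Neg (sp i)))))) [0..<M])"
    unfolding map_map using assms
    by (intro arg_cong[where f = concat] map_cong refl) (auto simp: psem_sps)
  finally have "psem w [N, M, r] agreeP = enc_fml (agree M)"
    by (simp add: agreeP_def agree_def enc_bigC)
  then show ?thesis by (simp add: fullP_def full_def Always_def)
qed

text \<open>The order in which the nested loops of \<open>pathP\<close> meet the edges; repetitions
  in \<open>kE K\<close> disappear.\<close>

definition edge_list :: "(nat \<times> nat) set \<Rightarrow> nat \<Rightarrow> (nat \<times> nat) list" where
  "edge_list E m = concat (map (\<lambda>a. concat (map (\<lambda>b. if (a, b) \<in> E then [(a, b)] else []) [0..<m])) [0..<m])"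

lemma set_edge_list: "\<forall>(a, b)\<in>E. a < m \<and> b < m \<Longrightarrow> set (edge_list E m) = E"
  by (auto simp: edge_list_def split: if_splits)

lemma psem_pathP:
  assumes M: "M < npos w" and r: "r \<le> npos w"
    and e: "\<And>a b. a < M \<Longrightarrow> b < M \<Longrightarrow> tsem w [N, M, r, a, b] (edge 5 3 4) \<longleftrightarrow> (a, b) \<in> E"
  shows "psem w [N, M, r] pathP = enc_fml (pathf r (edge_list E M))"
proof -
  let ?p = "PIf (edge 5 3 4) (psq [PEmit [TConj, TNeg, TConj], sps 5 3, PEmit [TNxt], sps 5 4]) (PEmit [])"
  let ?f = "\<lambda>(a, b). Neg (Conj (sp a) (Nxt (sp b)))"
  have "psem w [N, M, r] (ups 3 (ups 4 ?p)) = concat (map (\<lambda>i. concat (map (\<lambda>j. psem w [N, M, r, i, j] ?p) [0..<M])) [0..<M])"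
    using M by (simp add: psem_ups)
  also have "\<dots> = concat (map (\<lambda>a. concat (map (\<lambda>b. concat (map (\<lambda>x. TConj # enc_fml (?f x)) (if (a, b) \<in> E then [(a, b)] else []))) [0..<M])) [0..<M])"
    using M e by (intro arg_cong[where f = concat] map_cong refl) (auto simp: psem_sps)
  also have "\<dots> = encs (map ?f (edge_list E M))"
    unfolding edge_list_def map_map comp_def concat_map_concat ..
  finally show ?thesis using r by (simp add: pathP_def pathf_def enc_bigC psem_sps)
qed

text \<open>The position loop of \<open>phiP\<close> as a recursion over the text; \<open>F\<close>
  receives the digits that follow a \<open>TP\<close>.\<close>

primrec emit_from :: "(sym list \<Rightarrow> sym list) \<Rightarrow> sym list \<Rightarrow> sym list" where
  "emit_from F [] = []"
| "emit_from F (x # xs) = (if x \<in> set ops then [x] else if x = TP then F (takeWhile is_bit xs) else []) @ emit_from F xs"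

lemma emit_from_nth: "emit_from F z = concat (map (\<lambda>j. if z ! j \<in> set ops then [z ! j]
     else if z ! j = TP then F (takeWhile is_bit (drop (Suc j) z)) else []) [0..<length z])"
proof (induction z)
  case (Cons x xs)
  have "[0..<length (x # xs)] = 0 # map Suc [0..<length xs]" by (simp add: upt_conv_Cons map_Suc_upt del: upt_Suc)
  then show ?case using Cons by (simp only: list.map map_map comp_def nth_Cons_0 nth_Cons_Suc drop_Suc_Cons concat.simps emit_from.simps drop0)
qed simp

lemma emit_from_bits: "\<forall>x\<in>set xs. is_bit x \<or> x = Sep \<Longrightarrow> emit_from F (xs @ ys) = emit_from F ys"
  by (induction xs) auto

lemma emit_from_toks: "\<forall>t\<in>set ts. tok_ok t \<Longrightarrow> emit_from F (enc_toks ts) =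
    concat (map (\<lambda>t. case t of Op s \<Rightarrow> [s] | Var x \<Rightarrow> F (bin x)) ts)"
proof (induction ts)
  case (Cons t ts)
  show ?case
  proof (cases t)
    case (Op s)
    then show ?thesis using Cons by simp
  next
    case (Var x)
    have "\<forall>y\<in>set (bin x @ [Sep]). is_bit y \<or> y = Sep" using bin_bits by auto
    from emit_from_bits[OF this, of F "enc_toks ts"] show ?thesis using Var Cons by (simp add: enc_nat_def)
  qed
qed simp

context input
begin

lemma edges_read:
  "(\<exists>e<npos w. \<exists>s<npos w. read_in w e = Some TEdge \<and> adjs w e s \<and> P (tok_at w e) (tok_at w s)) \<longleftrightarrow>
    (\<exists>(a, b)\<in>set (kE K). P (bin a) (bin b))"
proof -
  have "(\<exists>s<npos w. adjs w e s \<and> P (tok_at w e) (tok_at w s)) \<longleftrightarrow>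
     (\<exists>rest. dropWhile is_bit (drop e w) = Sep # rest \<and> P (tok_at w e) (takeWhile is_bit rest))" if "e < npos w" for e
    using read_adj[OF that, where P = "\<lambda>rest. P (tok_at w e) (takeWhile is_bit rest)"] unfolding adjs_def by simp
  then have "(\<exists>e<npos w. \<exists>s<npos w. read_in w e = Some TEdge \<and> adjs w e s \<and> P (tok_at w e) (tok_at w s)) \<longleftrightarrow>
     (\<exists>e<npos w. read_in w e = Some TEdge \<and>
       (\<exists>rest. dropWhile is_bit (drop e w) = Sep # rest \<and> P (tok_at w e) (takeWhile is_bit rest)))" by blast
  also have "\<dots> \<longleftrightarrow> (\<exists>(a, b)\<in>set (kE K). P (bin a) (bin b))"
    using read_occ[of w TEdge "\<lambda>ys. \<exists>rest. dropWhile is_bit ys = Sep # rest \<and> P (takeWhile is_bit ys) (takeWhile is_bit rest)"]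
      occ_TEdge[of P] by simp
  finally show ?thesis .
qed

lemma tsem_edge:
  assumes "length \<rho> = d" "a < d" "b < d" "\<rho> ! a < npos w" "\<rho> ! b < npos w"
  shows "tsem w \<rho> (edge d a b) \<longleftrightarrow> (\<rho> ! a, \<rho> ! b) \<in> set (kE K)"
proof -
  have "tsem w \<rho> (edge d a b) \<longleftrightarrow> (\<exists>e<npos w. \<exists>s<npos w. read_in w e = Some TEdge \<and> adjs w e s \<and>
      satval (npos w) 0 (tok_at w e) = \<rho> ! a \<and> satval (npos w) 0 (tok_at w s) = \<rho> ! b)"
    using assms(1-3) unfolding edge_def tsem.simps by (simp add: tsem_adj nth_append)
  also have "\<dots> \<longleftrightarrow> (\<exists>(a', b')\<in>set (kE K). satval (npos w) 0 (bin a') = \<rho> ! a \<and> satval (npos w) 0 (bin b') = \<rho> ! b)"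
    by (rule edges_read[where P = "\<lambda>x y. satval (npos w) 0 x = \<rho> ! a \<and> satval (npos w) 0 y = \<rho> ! b"])
  also have "\<dots> \<longleftrightarrow> (\<rho> ! a, \<rho> ! b) \<in> set (kE K)"
    unfolding satval_bin_eq[OF assms(4)] satval_bin_eq[OF assms(5)] by auto
  finally show ?thesis .
qed

lemma tsem_kn_ok: "length \<rho> = d \<Longrightarrow> m < d \<Longrightarrow> \<rho> ! m < npos w \<Longrightarrow> tsem w \<rho> (kn_ok d m) \<longleftrightarrow> kn K = \<rho> ! m"
  using read_occ[of w TState "\<lambda>ys. satval (npos w) 0 (takeWhile is_bit ys) = \<rho> ! m"]
    occ_TState[of "\<lambda>t. satval (npos w) 0 t = \<rho> ! m"] satval_bin_eq[of "\<rho> ! m" "npos w" "kn K"]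
  unfolding kn_ok_def tsem.simps by (simp add: nth_append)

lemma tsem_root: "length \<rho> = d \<Longrightarrow> m < d \<Longrightarrow> \<rho> ! m < npos w \<Longrightarrow> tsem w \<rho> (rootT d m) \<longleftrightarrow> kr K = \<rho> ! m"
  using read_occ[of w TRoot "\<lambda>ys. satval (npos w) 0 (takeWhile is_bit ys) = \<rho> ! m"]
    occ_TRoot[of "\<lambda>t. satval (npos w) 0 t = \<rho> ! m"] satval_bin_eq[of "\<rho> ! m" "npos w" "kr K"]
  unfolding rootT_def tsem.simps by (simp add: nth_append)

lemma tsem_root_ok:
  assumes "length \<rho> = d" "m < d" "\<rho> ! m < npos w"
  shows "tsem w \<rho> (root_ok d m) \<longleftrightarrow> kr K < \<rho> ! m"
proof -
  have "tsem w (\<rho> @ [v]) (rootT (d + 1) d) \<longleftrightarrow> kr K = v" if "v < npos w" for v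
    using tsem_root[of "\<rho> @ [v]" "d + 1" d] assms(1) that by (simp add: nth_append)
  then have "tsem w \<rho> (root_ok d m) \<longleftrightarrow> (\<exists>v<npos w. v < \<rho> ! m \<and> kr K = v)"
    unfolding root_ok_def tsem.simps using assms by (auto simp: nth_append)
  then show ?thesis using assms(3) by auto
qed

lemma tsem_edges_ok:
  assumes "length \<rho> = d" "m < d" "\<rho> ! m < npos w"
  shows "tsem w \<rho> (edges_ok d m) \<longleftrightarrow> (\<forall>(a, b)\<in>set (kE K). a < \<rho> ! m \<and> b < \<rho> ! m)"
proof -
  let ?V = "\<lambda>t. \<exists>v<npos w. v < \<rho> ! m \<and> satval (npos w) 0 t = v"
  \<comment> \<open>Saturation does no harm here: a frozen value is at least \<open>npos w\<close>
    and so differs from every \<open>v\<close> below the bound.\<close>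
  have V: "?V (bin a) \<longleftrightarrow> a < \<rho> ! m" for a
  proof -
    have "(v < npos w \<and> v < \<rho> ! m \<and> satval (npos w) 0 (bin a) = v) \<longleftrightarrow> (v < \<rho> ! m \<and> a = v)" for v
      using assms(3) satval_bin_eq[of v "npos w" a] by auto
    then show ?thesis by auto
  qed
  have "tsem w \<rho> (edges_ok d m) \<longleftrightarrow> \<not> (\<exists>e<npos w. \<exists>s<npos w. read_in w e = Some TEdge \<and> adjs w e s \<and>
      \<not> (?V (tok_at w e) \<and> ?V (tok_at w s)))"
    using assms(1,2) unfolding edges_ok_def tsem.simps by (simp add: tsem_adj nth_append)
  also have "\<dots> \<longleftrightarrow> \<not> (\<exists>(a, b)\<in>set (kE K). \<not> (?V (bin a) \<and> ?V (bin b)))"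
    using edges_read[where P = "\<lambda>x y. \<not> (?V x \<and> ?V y)"] by (simp only:)
  also have "\<dots> \<longleftrightarrow> (\<forall>(a, b)\<in>set (kE K). a < \<rho> ! m \<and> b < \<rho> ! m)"
    unfolding V by auto
  finally show ?thesis .
qed

lemma tsem_serial:
  assumes "length \<rho> = d" "m < d" "\<rho> ! m < npos w"
  shows "tsem w \<rho> (serial d m) \<longleftrightarrow> (\<forall>a<\<rho> ! m. \<exists>b<\<rho> ! m. (a, b) \<in> set (kE K))"
proof -
  have e: "tsem w ((\<rho> @ [a]) @ [b]) (edge (d + 2) d (d + 1)) \<longleftrightarrow> (a, b) \<in> set (kE K)" if "a < npos w" "b < npos w" for a b
    using tsem_edge[of "(\<rho> @ [a]) @ [b]" "d + 2" d "d + 1"] assms(1) that by (simp add: nth_append)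
  have i: "(\<rho> @ [a]) ! d = a" "(\<rho> @ [a]) ! m = \<rho> ! m" "((\<rho> @ [a]) @ [b]) ! (d + 1) = b" "((\<rho> @ [a]) @ [b]) ! m = \<rho> ! m" for a b
    using assms(1,2) by (simp_all add: nth_append)
  have "tsem w \<rho> (serial d m) \<longleftrightarrow> \<not> (\<exists>a<npos w. a < \<rho> ! m \<and> \<not> (\<exists>b<npos w. b < \<rho> ! m \<and> (a, b) \<in> set (kE K)))"
    unfolding serial_def tsem.simps i by (simp only: e cong: conj_cong)
  also have "\<dots> \<longleftrightarrow> (\<forall>a<\<rho> ! m. \<exists>b<\<rho> ! m. (a, b) \<in> set (kE K))"
  proof -
    have "(x < npos w \<and> x < \<rho> ! m \<and> Q) \<longleftrightarrow> (x < \<rho> ! m \<and> Q)" for x Q using assms(3) by auto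
    then show ?thesis by (simp only:) blast
  qed
  finally show ?thesis .
qed

lemma labs_npos: "length (kL K) < npos w"
  using labs_w length_filter_le[of "\<lambda>x. x = TLab" w] unfolding labs_def by simp

lemma tsem_wfT: "tsem w [npos w, length (kL K)] wfT \<longleftrightarrow> wf_kripke K"
proof -
  let ?\<rho> = "[npos w, length (kL K)]"
  have "?\<rho> ! 1 < npos w" using labs_npos by simp
  then have 1: "tsem w ?\<rho> wfT \<longleftrightarrow> kn K = length (kL K) \<and> kr K < length (kL K) \<and>
     (\<forall>(a, b)\<in>set (kE K). a < length (kL K) \<and> b < length (kL K)) \<and>
     (\<forall>a<length (kL K). \<exists>b<length (kL K). (a, b) \<in> set (kE K))"
    unfolding wfT_def tsem.simps by (simp add: tsem_kn_ok tsem_root_ok tsem_edges_ok tsem_serial)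
  show ?thesis
  proof (cases "kn K = length (kL K) \<and> (\<forall>(a, b)\<in>set (kE K). a < length (kL K) \<and> b < length (kL K))")
    case True
    \<comment> \<open>\<open>serial\<close> looks for successors below the bound only; once all
      edges are in range this is the seriality of \<open>wf_kripke\<close>.\<close>
    then have "(\<exists>b<length (kL K). (a, b) \<in> set (kE K)) \<longleftrightarrow> (\<exists>b. (a, b) \<in> set (kE K))" for a by blast
    then show ?thesis unfolding 1 wf_kripke_def using True by auto
  next
    case False
    then show ?thesis unfolding 1 wf_kripke_def by metis
  qed
qed

lemma occ_THash:
  "\<exists>h\<le>length w. drop h w = enc_toks ts \<and> (\<forall>y. (\<exists>u<npos w. read_in w u = Some THash \<and> u < y) \<longleftrightarrow> h < y)"
proof -
  let ?p = "enc_kripke K"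
  let ?h = "Suc (length ?p)"
  have 1: "THash \<notin> set ?p"
    unfolding enc_kripke_def
    using enc_nat_syms[of THash] enc_edges_syms[of THash] enc_labs_syms[of THash] by auto
  have 2: "THash \<notin> set (enc_toks ts)" using enc_toks_syms[OF ts, of THash] by simp
  have "read_in w u = Some THash \<longleftrightarrow> u = ?h" for u
  proof (cases "u \<le> length ?p")
    case True
    have "read_in w u \<noteq> Some THash"
    proof
      assume "read_in w u = Some THash"
      then have "0 < u" "w ! (u - 1) = THash" by (auto simp: read_in_def split: if_splits)
      moreover have "u - 1 < length ?p" using True \<open>0 < u\<close> by simp
      ultimately have "?p ! (u - 1) = THash" "u - 1 < length ?p" by (simp_all add: w nth_append)
      then show False using 1 nth_mem by metis
    qed
    then show ?thesis using True by auto
  next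
    case False
    then obtain j where j: "u = ?h + j" by (metis not_less_eq_eq le_iff_add)
    show ?thesis
    proof (cases j)
      case 0
      then show ?thesis using j by (simp add: read_in_def w)
    next
      case (Suc i)
      have d: "drop ?h w = enc_toks ts" by (simp add: w)
      have "read_in w u \<noteq> Some THash"
        using 2 unfolding j Suc read_in_drop d by (auto simp: in_set_conv_nth)
      then show ?thesis using j Suc by simp
    qed
  qed
  then have "\<forall>y. (\<exists>u<npos w. read_in w u = Some THash \<and> u < y) \<longleftrightarrow> ?h < y" by (simp add: w)
  moreover have "drop ?h w = enc_toks ts" "?h \<le> length w" by (simp_all add: w)
  ultimately show ?thesis by blast
qed

lemma psem_phiP:
  defines "M \<equiv> length (kL K)"
  shows "psem w [npos w, M, r] phiP = subst_toks (labf M (\<lambda>i. set (kL K ! i))) ts"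
proof -
  let ?\<rho> = "[npos w, M, r]"
  have M: "M < npos w" using labs_npos by (simp add: M_def)
  define F where "F t = encs (map (\<lambda>i. Neg (sp i)) (filter (\<lambda>i. \<not> occl i (in_block t) w) [0..<M])) @ enc_fml Top" for t
  have lab: "psem w [npos w, M, r, y] (labP 3) = F (tok_at w y)" for y
  proof -
    let ?p = "PIf (has 5 4 3) (PEmit []) (psq [PEmit [TConj, TNeg], sps 5 4])"
    have has: "tsem w [npos w, M, r, y, i] (has 5 4 3) \<longleftrightarrow> occl i (in_block (tok_at w y)) w" for i
      using tsem_has[of "[npos w, M, r, y, i]" 5 4 3 w] by simp
    have ft: "encs (map f (filter (\<lambda>i. \<not> P i) xs)) = concat (map (\<lambda>i. if P i then [] else TConj # enc_fml (f i)) xs)" for f P and xs :: "nat list"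
      by (induction xs) auto
    have "psem w [npos w, M, r, y] (ups 4 ?p) = concat (map (\<lambda>i. psem w [npos w, M, r, y, i] ?p) [0..<M])"
      using M by (simp add: psem_ups)
    also have "\<dots> = concat (map (\<lambda>i. if occl i (in_block (tok_at w y)) w then [] else TConj # enc_fml (Neg (sp i))) [0..<M])"
    proof (intro arg_cong[where f = concat] map_cong refl)
      fix i assume "i \<in> set [0..<M]"
      then show "psem w [npos w, M, r, y, i] ?p =
          (if occl i (in_block (tok_at w y)) w then [] else TConj # enc_fml (Neg (sp i)))"
        unfolding psem.simps has using M by (simp add: psem_sps)
    qed
    finally show ?thesis unfolding labP_def F_def ft by simp
  qed
  obtain h where h: "h \<le> length w" "drop h w = enc_toks ts"
    "\<And>y. (\<exists>u<npos w. read_in w u = Some THash \<and> u < y) \<longleftrightarrow> h < y" using occ_THash by blast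
  let ?z = "enc_toks ts"
  have hz: "length w = h + length ?z" using h(1) h(2)[symmetric] by simp
  let ?b = "psq (map (\<lambda>s. PIf (isS 3 s) (PEmit [s]) (PEmit [])) ops @ [PIf (isS 3 TP) (labP 3) (PEmit [])])"
  let ?G = "\<lambda>y. psem w [npos w, M, r, y] ?b"
  have "psem w ?\<rho> phiP = concat (map (\<lambda>y. if h < y then ?G y else []) [0..<npos w])"
  proof -
    have "tsem w [npos w, M, r, y] (Exi (An (isS 4 THash) (Lt 4 3))) \<longleftrightarrow> h < y" for y
      using h(3)[of y] by simp
    then show ?thesis unfolding phiP_def psem.simps(1,3,4) append_Cons append_Nil by (simp only:)
  qed
  \<comment> \<open>Here \<open>h\<close> is the head position of \<open>THash\<close>. Positions up
    to it and the right end marker print nothing; in between lie the symbols of the tokens.\<close>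
  also have "[0..<npos w] = [0..<Suc h] @ map (\<lambda>j. h + Suc j) [0..<length ?z] @ [h + Suc (length ?z)]"
  proof -
    have "map (\<lambda>j. h + Suc j) [0..<length ?z] = [Suc h..<Suc h + length ?z]"
      using map_add_upt[of "Suc h" "length ?z"] by (simp add: add.commute)
    then have "map (\<lambda>j. h + Suc j) [0..<length ?z] @ [h + Suc (length ?z)] = [Suc h..<npos w]"
      unfolding hz by simp
    moreover have "[0..<npos w] = [0..<Suc h] @ [Suc h..<npos w]"
      using hz upt_add_eq_append[of 0 "Suc h" "npos w - Suc h"] by simp
    ultimately show ?thesis by simp
  qed
  also have "concat (map (\<lambda>y. if h < y then ?G y else []) ([0..<Suc h] @ map (\<lambda>j. h + Suc j) [0..<length ?z] @ [h + Suc (length ?z)]))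
     = concat (map (\<lambda>j. ?G (h + Suc j)) [0..<length ?z])"
  proof -
    have 1: "concat (map (\<lambda>y. if h < y then ?G y else []) [0..<Suc h]) = []" by auto
    have "read_in w (h + Suc (length ?z)) = None" by (simp add: read_in_def hz)
    then have 2: "?G (h + Suc (length ?z)) = []" by simp
    have 3: "map (\<lambda>y. if h < y then ?G y else []) (map (\<lambda>j. h + Suc j) [0..<length ?z]) = map (\<lambda>j. ?G (h + Suc j)) [0..<length ?z]"
      by simp
    show ?thesis unfolding map_append concat_append 1 3 using 2 by simp
  qed
  also have "\<dots> = emit_from F ?z"
  proof -
    have "?G (h + Suc j) = (if ?z ! j \<in> set ops then [?z ! j]
     else if ?z ! j = TP then F (takeWhile is_bit (drop (Suc j) ?z)) else [])" if j: "j < length ?z" for j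
    proof -
      have rd: "read_in w (h + Suc j) = Some (?z ! j)" unfolding read_in_drop h(2) using j by simp
      have "drop (h + Suc j) w = drop (Suc j) ?z" unfolding h(2)[symmetric] by (simp add: add.commute)
      then have "psem w [npos w, M, r, h + Suc j] (labP 3) = F (takeWhile is_bit (drop (Suc j) ?z))" unfolding lab by simp
      then show ?thesis using rd by (cases "?z ! j") simp_all
    qed
    then show ?thesis unfolding emit_from_nth by (intro arg_cong[where f = concat] map_cong refl) simp
  qed
  also have "\<dots> = subst_toks (labf M (\<lambda>i. set (kL K ! i))) ts"
  proof -
    have F: "F (bin x) = enc_fml (labf M (\<lambda>i. set (kL K ! i)) x)" for x
    proof -
      have "occl i (in_block (bin x)) w \<longleftrightarrow> x \<in> set (kL K ! i)" if "i < M" for i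
        using occl_w[OF bin_neq_Nil, of i x] that by (auto simp: bin_inj M_def)
      then have "filter (\<lambda>i. \<not> occl i (in_block (bin x)) w) [0..<M] = filter (\<lambda>i. x \<notin> set (kL K ! i)) [0..<M]"
        by (intro filter_cong) auto
      then show ?thesis by (simp add: F_def labf_def enc_bigC)
    qed
    have c: "(case t of Op s \<Rightarrow> [s] | Var x \<Rightarrow> F (bin x)) = subst_tok (labf M (\<lambda>i. set (kL K ! i))) t" for t
      using F by (cases t) simp_all
    show ?thesis unfolding emit_from_toks[OF ts] subst_toks_def
      by (intro arg_cong[where f = concat] map_cong refl) (rule c)
  qed
  finally show ?thesis .
qed

lemma psem_wrapP:
  assumes "wf_kripke K"
  shows "psem w [npos w, kn K, kr K] wrapP = wrap_prefix (kn K) (kr K) (edge_list (set (kE K)) (kn K)) @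
     subst_toks (labf (kn K) (\<lambda>i. set (kL K ! i))) ts"
proof -
  have len: "length (kL K) = kn K" "kr K < kn K" using assms by (auto simp: wf_kripke_def)
  have M: "kn K < npos w" using labs_npos len by simp
  have "tsem w [npos w, kn K, kr K, a, b] (edge 5 3 4) \<longleftrightarrow> (a, b) \<in> set (kE K)" if "a < kn K" "b < kn K" for a b
    using tsem_edge[of "[npos w, kn K, kr K, a, b]" 5 3 4] that M by simp
  then have p: "psem w [npos w, kn K, kr K] pathP = enc_fml (pathf (kr K) (edge_list (set (kE K)) (kn K)))"
    using psem_pathP[of "kn K" w "kr K" "npos w" "set (kE K)"] M len by simp
  have "psem w [npos w, kn K, kr K] constrP = enc_fml (constr (kn K))"
    "psem w [npos w, kn K, kr K] fullP = enc_fml (full (kn K))"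
    using M by (simp_all add: psem_constrP psem_fullP)
  then show ?thesis unfolding wrapP_def wrap_prefix_def psem_psq list.map psem.simps(1) p
      psem_phiP[of "kr K", unfolded len] by simp
qed

lemma concat_unique: "c < n \<Longrightarrow> concat (map (\<lambda>v. if c = v then f v else []) [0..<n]) = f c"
proof (induction n)
  case (Suc n)
  have "concat (map (\<lambda>v. if n = v then f v else []) [0..<n]) = []" by auto
  with Suc show ?case by (cases "c = n") auto
qed simp

lemma psem_mainP:
  assumes "acc (foldl \<delta> 0 w)"
  shows "psem w [npos w] (mainP \<delta> acc) = (if wf_kripke K then
     wrap_prefix (kn K) (kr K) (edge_list (set (kE K)) (kn K)) @ subst_toks (labf (kn K) (\<lambda>i. set (kL K ! i))) ts else [THash])"
proof -
  let ?M = "length (kL K)"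
  let ?in = "PIf wfT (PFor (PIf (rootT 3 2) wrapP (PEmit []))) (PEmit [THash])"
  have t: "tsem w [npos w, v] (Ct 0 1) \<longleftrightarrow> ?M = v" for v
    using count_read_all[of w] labs_w by (simp del: upt_Suc)
  have "psem w [npos w] (mainP \<delta> acc) = concat (map (\<lambda>v. if ?M = v then psem w [npos w, v] ?in else []) [0..<npos w])"
    unfolding mainP_def psem.simps(1,3,4) tsem.simps(5) append_Cons append_Nil t if_P[OF assms] ..
  also have "\<dots> = psem w [npos w, ?M] ?in" by (rule concat_unique) (rule labs_npos)
  also have "\<dots> = (if wf_kripke K then psem w [npos w, ?M] (PFor (PIf (rootT 3 2) wrapP (PEmit []))) else [THash])"
    by (simp only: psem.simps tsem_wfT)
  also have "\<dots> = (if wf_kripke K then psem w [npos w, kn K, kr K] wrapP else [THash])"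
  proof (cases "wf_kripke K")
    case True
    then have len: "?M = kn K" "kr K < npos w" using labs_npos by (auto simp: wf_kripke_def)
    have "psem w [npos w, ?M] (PFor (PIf (rootT 3 2) wrapP (PEmit []))) =
       concat (map (\<lambda>v. if kr K = v then psem w [npos w, ?M, v] wrapP else []) [0..<npos w])"
      unfolding psem.simps(1,3,4) append_Cons append_Nil
    proof (intro arg_cong[where f = concat] map_cong refl)
      fix v assume "v \<in> set [0..<npos w]"
      then have "v < npos w" unfolding set_upt atLeastLessThan_iff ..
      then have "tsem w [npos w, ?M, v] (rootT 3 2) \<longleftrightarrow> kr K = v"
        using tsem_root[of "[npos w, ?M, v]" 3 2] by simp
      then show "(if tsem w [npos w, ?M, v] (rootT 3 2) then psem w [npos w, ?M, v] wrapP else []) =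
          (if kr K = v then psem w [npos w, ?M, v] wrapP else [])" by (simp only:)
    qed
    also have "\<dots> = psem w [npos w, ?M, kr K] wrapP" by (rule concat_unique) (rule len)
    finally show ?thesis using True len by simp
  qed simp
  also have "\<dots> = (if wf_kripke K then
     wrap_prefix (kn K) (kr K) (edge_list (set (kE K)) (kn K)) @ subst_toks (labf (kn K) (\<lambda>i. set (kL K ! i))) ts else [THash])"
    using psem_wrapP by simp
  finally show ?thesis .
qed

end

lemma THash_not_SAT: "[THash] \<notin> SAT_lang k"
proof -
  have "enc_fml \<phi> \<noteq> [THash]" for \<phi> by (cases \<phi>) auto
  then show ?thesis by (auto simp: SAT_lang_def) metis
qed

theorem mainTheorem17:
  fixes k :: nat
  assumes "k \<ge> 2"
  shows "logspace_reducible (MC_lang k) (SAT_lang k)"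
proof -
  \<comment> \<open>\<open>Df\<close> starts its automaton in memory value 0, so
    \<open>Start\<close> must have code 0.\<close>
  obtain code :: "dst \<Rightarrow> nat" where code: "inj_on code UNIV" "code ` UNIV \<subseteq> {..<card (UNIV :: dst set)}" "code Start = 0"
    using finite_enum_with_zero[OF finite_dst, of Start] by auto
  define dec where "dec = inv_into UNIV code"
  define \<delta> where "\<delta> n s = code (dd (dec n) s)" for n s
  define acc where "acc n \<longleftrightarrow> dec n = SF" for n
  have dec: "dec (code q) = q" for q using code(1) by (simp add: dec_def)
  have fold: "foldl \<delta> (code q) xs = code (foldl dd q xs)" for q xs
    by (induction xs arbitrary: q) (simp_all add: \<delta>_def dec)
  have acc: "acc (foldl \<delta> 0 xs) \<longleftrightarrow> runs Start xs" for xs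
    using fold[of Start xs] by (simp add: code(3) acc_def dec)
  \<comment> \<open>The summand 3 ensures the memory values 0, 1 and 2 used by the search loops,
    whatever the size of the automaton.\<close>
  let ?mb = "card (UNIV :: dst set) + 3"
  let ?p = "mainP \<delta> acc"
  let ?f = "\<lambda>w. psem w [npos w] ?p"
  have "\<delta> q s < ?mb" for q s
  proof -
    have "code x < card (UNIV :: dst set)" for x using code(2) by auto
    then show ?thesis by (simp add: \<delta>_def trans_less_add1)
  qed
  then have "wfprg ?mb 1 ?p" by (intro wfprg_mainP) blast
  then obtain M where M: "logspace_computes M ?f" using logspace_prg[of ?mb ?p] by auto
  have "w \<in> MC_lang k \<longleftrightarrow> ?f w \<in> SAT_lang k" for w
  proof
    assume "w \<in> MC_lang k"
    then obtain K \<phi> where w: "w = enc_kripke K @ THash # enc_fml \<phi>" and K: "wf_kripke K"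
      and \<phi>: "\<phi> \<in> LTL_FX k" "tsat (team_of K) \<phi>" unfolding MC_lang_def by blast
    let ?es = "edge_list (set (kE K)) (kn K)"
    let ?\<psi> = "wrap (kn K) (kr K) ?es (subst (labf (kn K) (\<lambda>i. set (kL K ! i))) \<phi>)"
    interpret input K "ftoks \<phi>" w by unfold_locales (use w ftoks_ok in \<open>auto simp: enc_ftoks\<close>)
    have "acc (foldl \<delta> 0 w)" unfolding acc using runs_encoding[OF ts, of K] w by (simp add: enc_ftoks)
    from psem_mainP[where acc = acc, OF this] K have "?f w = enc_fml ?\<psi>" by (simp add: enc_wrap subst_ftoks)
    moreover have "?\<psi> \<in> LTL_FX k" using wrap_LTL_FX[OF assms] \<phi>(1) by blast
    moreover have "\<exists>T. tsat T ?\<psi>"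
      using wrap_satisfiable[OF K set_edge_list, where \<phi> = \<phi>] K \<phi>(2) by (auto simp: wf_kripke_def)
    ultimately show "?f w \<in> SAT_lang k" unfolding SAT_lang_def by blast
  next
    assume sat: "?f w \<in> SAT_lang k"
    show "w \<in> MC_lang k"
    \<comment> \<open>Both kinds of rejection print \<open>[THash]\<close>, so an output in
      \<open>SAT_lang k\<close> certifies the lexical shape and then the well-formedness of
      \<open>K\<close>.\<close>
    proof (cases "runs Start w")
      case False
      then have "?f w = [THash]" using acc[of w] by (simp add: mainP_def)
      then show ?thesis using sat THash_not_SAT by simp
    next
      case True
      then obtain K :: kripke and ts where enc: "w = enc_kripke K @ THash # enc_toks ts" "\<forall>t\<in>set ts. tok_ok t"
        using runs_Start by blast
      interpret input K ts w by unfold_locales (use enc in auto)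
      let ?es = "edge_list (set (kE K)) (kn K)" let ?g = "labf (kn K) (\<lambda>i. set (kL K ! i))"
      have out: "?f w = (if wf_kripke K then wrap_prefix (kn K) (kr K) ?es @ subst_toks ?g ts else [THash])"
        using psem_mainP[where acc = acc] acc[of w] True by blast
      have K: "wf_kripke K" using out sat THash_not_SAT by (cases "wf_kripke K") simp_all
      obtain \<chi> T where \<chi>: "?f w = enc_fml \<chi>" "\<chi> \<in> LTL_FX k" "tsat T \<chi>" using sat unfolding SAT_lang_def by blast
      obtain \<psi> where \<psi>: "\<chi> = wrap (kn K) (kr K) ?es \<psi>" "subst_toks ?g ts = enc_fml \<psi>"
        using wrap_prefix_eq[of "kn K" "kr K" ?es "subst_toks ?g ts" \<chi>] out K \<chi>(1) by auto
      obtain \<phi> where \<phi>: "ts = ftoks \<phi>" "\<psi> = subst ?g \<phi>" using subst_toks_is_fml[OF enc(2) \<psi>(2)] by blast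
      have "\<phi> \<in> LTL_FX k" using \<chi>(2) wrap_LTL_FX[OF assms] unfolding \<psi>(1) \<phi>(2) by blast
      moreover have "tsat (team_of K) \<phi>"
        using wrap_satisfiable[OF K set_edge_list, where \<phi> = \<phi>] \<chi>(3) K unfolding \<psi>(1) \<phi>(2) by (auto simp: wf_kripke_def)
      moreover have "w = enc_kripke K @ THash # enc_fml \<phi>" using enc(1) \<phi>(1) by (simp add: enc_ftoks)
      ultimately show ?thesis using K unfolding MC_lang_def by blast
    qed
  qed
  with M show ?thesis unfolding logspace_reducible_def by blast
qed

end
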